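(* Let $F$ be a (smooth) vector bundle over a manifold $M$ and $k\ge1$. The following objects are in bijection with each other: (1) multilinear connections $L$ on $T^kF$; (2) isomorphisms $\Phi:A^kF\to T^kF$ of multilinear bundles over $M$ such that the restriction of $\Phi$ to each axis $F^\alpha$ is the identity map on this axis (the corresponding axes $F^\alpha$ of $A^kF$ and of $T^kF$ being identified with each other). The bijection is described as follows: given $\Phi$, the linear structure $L=L^\Phi$ is the push-forward by $\Phi$ of the canonical linear structure $L_0$ on $A^kF$. Given $L$, one lets $$\Phi:=\Phi^L:\ A^kF=\bigoplus_{\alpha>0}F^\alpha\to T^kF,\qquad (x;v_\alpha)_{\alpha>0}\mapsto\sum_{\alpha>0}v_\alpha,$$ where the sum on the right-hand side is taken in the fiber $(T^kF)_x$ with respect to the linear structure $L_x$.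
   Context: $\mathbb{K}$ is a commutative unital Hausdorff topological ring with open dense unit group and continuous inversion; topological modules are Hausdorff. A map $f:V\supset U\to W$ ($U$ open, $V,W$ topological $\mathbb{K}$-modules) is $C^1$ if there is a continuous $f^{[1]}$ on $U^{[1]}=\{(x,v,t)\in U\times V\times\mathbb{K}:x+tv\in U\}$ with $f(x+tv)-f(x)=tf^{[1]}(x,v,t)$; $df(x)v=f^{[1]}(x,v,0)$; $f$ is $C^{j+1}$ if it is $C^1$ and $f^{[1]}$ is $C^j$; smooth means $C^j$ for all $j$. Manifolds, tangent bundles and vector bundles are defined by charts as usual; $M$ is modelled on $V$, the fibers of $F$ on $W$. Index set: $I_{k+1}=\{0,1\}^{k+1}$, $\alpha=(\alpha_0,\dots,\alpha_k)$; $\alpha>0$ means $\alpha\neq0$. A partition of $\alpha$ is a set $\Lambda=\{\Lambda^1,\dots,\Lambda^\ell\}$ of nonzero elements of $I_{k+1}$ with $\sum_i\Lambda^i=\alpha$; $\mathcal P(\alpha)$ is the set of partitions, $\ell(\Lambda)=\ell$. A bundle chart of $F$ over $U\subset V$ identifies $F|_U$ with $U\times W$, written $x+\varepsilon_0w$. Applying $T$ successively with units $\varepsilon_1,\dots,\varepsilon_k$, points of $T^kF$ over $U$ are written $x+\sum_{\alpha>0}\varepsilon^\alpha v_\alpha$, $\varepsilon^\alpha=\prod_{i=0}^k\varepsilon_i^{\alpha_i}$, where $v_\alpha\in V$ if $\alpha_0=0$ and $v_\alpha\in W$ if $\alpha_0=1$ (no relation on $\varepsilon_0$ beyond this bookkeeping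 is needed). $T^kF$ is a fiber bundle over $M$. Put $F^\alpha=$ a copy of $TM$ if $\alpha_0=0$, and of $F$ if $\alpha_0=1$; the axis $F^\alpha\subset T^kF$ is the image of the canonical (chart-independent) inclusion given in charts by $(x;v_\alpha)\mapsto x+\varepsilon^\alpha v_\alpha$. $A^kF=\bigoplus_{\alpha>0}F^\alpha$ (direct sum of vector bundles over $M$), with its vector bundle structure $L_0$. For a family of $\mathbb{K}$-modules $(V_\alpha)_{\alpha>0}$ and $E=\bigoplus_{\alpha>0}V_\alpha$, the general multilinear group $\mathrm{Gm}^{0,k+1}(E)$ consists of all maps $f_b(\sum_\alpha v_\alpha)=\sum_{\alpha>0}\sum_{\Lambda\in\mathcal P(\alpha)}b^\Lambda(v_{\Lambda^1},\dots,v_{\Lambda^\ell})$ with $b^\Lambda:V_{\Lambda^1}\times\dots\times V_{\Lambda^\ell}\to V_\alpha$ multilinear, and $b^{\{\alpha\}}$ bijective for all $\alpha$. Transition functions of $T^kF$ act on fibers by elements of this group. A linear structure on $T^kF$ over $M$ consists of smooth bundle maps $T^kF\times_MT^kF\to T^kF$ (addition) and $\mathbb{K}\times T^kF\to T^kF$ (scalar multiplication) turning each fiber $(T^kF)_x$ into a $\mathbb{K}$-module $L_x$. It is a multilinear connection if, for all $x$ and every bundle chart at $x$, $L_x$ is conjugate, under the general multilinear group of the fiber, to the $\mathbb{K}$-module structure on $(T^kF)_x$ induced by the chart. An isomorphism of multilinear bundles $A^kF\to T^kF$ over $M$ is a diffeomorphism preserving the fibers over $M$, which in bundle charts is given on fibers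 by elements of the general multilinear group. *)

theory Defs
  imports "HOL-Analysis.Analysis" "HOL-Library.Function_Algebras" "HOL-Library.Product_Plus"
    "HOL-Algebra.Module"
begin

section \<open>Base ring and topological modules\<close>

class topological_comm_ring_1 = comm_ring_1 + topological_ab_group_add + topological_monoid_mult

class topological_base_ring = topological_comm_ring_1 + t2_space +
  assumes open_unit_group: "open {u. u dvd 1}"
    and dense_unit_group: "\<And>S. open S \<Longrightarrow> S \<noteq> {} \<Longrightarrow> S \<inter> {u. u dvd 1} \<noteq> {}"
    and continuous_inversion:
      "\<And>u v. u * v = 1 \<Longrightarrow> ((\<lambda>x. THE y. x * y = 1) \<longlongrightarrow> v) (at u within {x. x dvd 1})"

instance prod :: (topological_monoid_add, topological_monoid_add) topological_monoid_add
proof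
  fix a b :: "'a \<times> 'b"
  show "((\<lambda>x. fst x + snd x) \<longlongrightarrow> a + b) (nhds a \<times>\<^sub>F nhds b)"
    unfolding nhds_prod[symmetric] plus_prod_def
    by (intro tendsto_Pair tendsto_add tendsto_fst tendsto_snd)
      (simp_all add: filterlim_ident tendsto_fst[of "\<lambda>x. x" "(a, b)", simplified]
        tendsto_snd[of "\<lambda>x. x" "(a, b)", simplified])
qed

instance prod :: (topological_group_add, topological_group_add) topological_group_add
proof
  fix a :: "'a \<times> 'b"
  show "(uminus \<longlongrightarrow> - a) (nhds a)"
    unfolding uminus_prod_def
    by (intro tendsto_Pair tendsto_minus tendsto_fst tendsto_snd) (simp_all add: filterlim_ident)
qed

instance prod :: (topological_ab_group_add, topological_ab_group_add) topological_ab_group_add ..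

text \<open>The Hausdorff condition and the continuity of the group operations of a topological module
  are expressed by the type classes of its type.\<close>

definition topological_module ::
  "('k::topological_base_ring \<Rightarrow> 'v::{topological_ab_group_add,t2_space} \<Rightarrow> 'v) \<Rightarrow> bool" where
  "topological_module s \<longleftrightarrow> Modules.module s \<and> continuous_on UNIV (\<lambda>(t, v). s t v)"

section \<open>A universe of topological modules\<close>

text \<open>Both \<open>f \<mapsto> f\<^sup>[\<^sup>1\<^sup>]\<close> and the tangent functor replace the model module by a larger
  product, so their iterates cannot be typed with a separate type for every stage. We therefore use
  one type that contains the model space \<open>'a\<close>, the ring \<open>'k\<close> and, up to canonical isomorphism of
  topological modules, all finite products formed from these: the families indexed by the nodes
  (finite words of truth values) of the binary tree, with the product topology and the pointwise
  operations. A vector or a scalar sits at the root, and \<open>pair p q\<close> hangs \<open>p\<close> and \<open>q\<close> below the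
  root. A topological module in this universe is given by its underlying set, with the
  subspace topology.\<close>

type_synonym ('a, 'k) pt = "bool list \<Rightarrow> 'a \<times> 'k"

definition vpt :: "'a::zero \<Rightarrow> ('a, 'k::zero) pt" where
  "vpt v = (\<lambda>w. if w = [] then (v, 0) else 0)"

definition spt :: "'k::zero \<Rightarrow> ('a::zero, 'k) pt" where
  "spt t = (\<lambda>w. if w = [] then (0, t) else 0)"

definition pair :: "('a::zero, 'k::zero) pt \<Rightarrow> ('a, 'k) pt \<Rightarrow> ('a, 'k) pt" where
  "pair p q = (\<lambda>w. case w of [] \<Rightarrow> 0 | b # w' \<Rightarrow> (if b then q w' else p w'))"

definition lpt :: "('a, 'k) pt \<Rightarrow> ('a, 'k) pt" where
  "lpt p = (\<lambda>w. p (False # w))"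

definition rpt :: "('a, 'k) pt \<Rightarrow> ('a, 'k) pt" where
  "rpt p = (\<lambda>w. p (True # w))"

definition prd :: "('a::zero, 'k::zero) pt set \<Rightarrow> ('a, 'k) pt set \<Rightarrow> ('a, 'k) pt set" where
  "prd E F = {pair p q | p q. p \<in> E \<and> q \<in> F}"

definition pscale :: "('k::times \<Rightarrow> 'a \<Rightarrow> 'a) \<Rightarrow> 'k \<Rightarrow> ('a, 'k) pt \<Rightarrow> ('a, 'k) pt" where
  "pscale s t p = (\<lambda>w. (s t (fst (p w)), t * snd (p w)))"

section \<open>The classes \<open>C\<^sup>j\<close>\<close>

text \<open>In this section \<open>E\<close>, \<open>F\<close> are modules of the universe, \<open>U\<close> is a subset of \<open>E\<close> and
  \<open>f: U \<rightarrow> F\<close>; \<open>s\<close> is the scalar multiplication of the model space. The domain of \<open>f\<^sup>[\<^sup>1\<^sup>]\<close> is the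
  subset \<open>dom1 s E U\<close> of the module \<open>mod1 E\<close>, which represents \<open>E \<times> E \<times> \<K>\<close>.\<close>

definition mod1 :: "('a::zero, 'k::zero) pt set \<Rightarrow> ('a, 'k) pt set" where
  "mod1 E = prd E (prd E (range spt))"

definition dom1 ::
  "('k::comm_ring_1 \<Rightarrow> 'a::ab_group_add \<Rightarrow> 'a) \<Rightarrow> ('a, 'k) pt set \<Rightarrow> ('a, 'k) pt set \<Rightarrow> ('a, 'k) pt set"
  where
  "dom1 s E U = {pair x (pair v (spt t)) | x v t. x \<in> U \<and> v \<in> E \<and> x + pscale s t v \<in> U}"

definition is_quot ::
  "('k::topological_base_ring \<Rightarrow> 'a::{topological_ab_group_add,t2_space} \<Rightarrow> 'a)
    \<Rightarrow> ('a, 'k) pt set \<Rightarrow> ('a, 'k) pt set \<Rightarrow> ('a, 'k) pt set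
    \<Rightarrow> (('a, 'k) pt \<Rightarrow> ('a, 'k) pt) \<Rightarrow> (('a, 'k) pt \<Rightarrow> ('a, 'k) pt) \<Rightarrow> bool" where
  "is_quot s E F U f g \<longleftrightarrow>
     g \<in> dom1 s E U \<rightarrow> F \<and> continuous_on (dom1 s E U) g \<and>
     (\<forall>x\<in>U. \<forall>v\<in>E. \<forall>t. x + pscale s t v \<in> U \<longrightarrow>
        f (x + pscale s t v) - f x = pscale s t (g (pair x (pair v (spt t)))))"

definition C1 where
  "C1 s E F U f \<longleftrightarrow> f \<in> U \<rightarrow> F \<and> (\<exists>g. is_quot s E F U f g)"

text \<open>For open \<open>U\<close> the map \<open>f\<^sup>[\<^sup>1\<^sup>]\<close> is unique on \<open>dom1 s E U\<close>, because the units are dense and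
  the modules are Hausdorff. Its values outside that set are irrelevant.\<close>

definition quot where
  "quot s E F U f = (SOME g. is_quot s E F U f g)"

definition diff where
  "diff s E F U f x v = quot s E F U f (pair x (pair v (spt 0)))"

primrec Cn ::
  "('k::topological_base_ring \<Rightarrow> 'a::{topological_ab_group_add,t2_space} \<Rightarrow> 'a)
    \<Rightarrow> ('a, 'k) pt set \<Rightarrow> nat \<Rightarrow> ('a, 'k) pt set \<Rightarrow> ('a, 'k) pt set
    \<Rightarrow> (('a, 'k) pt \<Rightarrow> ('a, 'k) pt) \<Rightarrow> bool" where
  "Cn s F 0 = (\<lambda>E U f. f \<in> U \<rightarrow> F \<and> continuous_on U f)"
| "Cn s F (Suc j) =
     (\<lambda>E U f. C1 s E F U f \<and> Cn s F j (mod1 E) (dom1 s E U) (quot s E F U f))"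

definition smooth where
  "smooth s E F U f \<longleftrightarrow> openin (top_of_set E) U \<and> (\<forall>j. Cn s F j E U f)"

section \<open>Manifolds with atlas\<close>

text \<open>A manifold is a topological space with a family of charts. The atlas need not be maximal,
  but the family of all charts of a maximal atlas is an instance. No separation axiom is imposed
  on the space.\<close>

record ('p, 'i, 'u) mfd =
  mtop :: "'p topology"
  ind :: "'i set"
  cdom :: "'i \<Rightarrow> 'p set"
  chart :: "'i \<Rightarrow> 'p \<Rightarrow> 'u"
  model :: "'u set"

abbreviation pts :: "('p, 'i, 'u, 'z) mfd_scheme \<Rightarrow> 'p set" where
  "pts M \<equiv> topspace (mtop M)"

definition cinv :: "('p, 'i, 'u, 'z) mfd_scheme \<Rightarrow> 'i \<Rightarrow> 'u \<Rightarrow> 'p" where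
  "cinv M i = inv_into (cdom M i) (chart M i)"

definition overlap :: "('p, 'i, 'u, 'z) mfd_scheme \<Rightarrow> 'i \<Rightarrow> 'i \<Rightarrow> 'u set" where
  "overlap M i j = chart M i ` (cdom M i \<inter> cdom M j)"

definition transition :: "('p, 'i, 'u, 'z) mfd_scheme \<Rightarrow> 'i \<Rightarrow> 'i \<Rightarrow> 'u \<Rightarrow> 'u" where
  "transition M i j = chart M j \<circ> cinv M i"

definition manifold ::
  "('k::topological_base_ring \<Rightarrow> 'a::{topological_ab_group_add,t2_space} \<Rightarrow> 'a)
    \<Rightarrow> ('p, 'i, ('a, 'k) pt) mfd \<Rightarrow> bool" where
  "manifold s M \<longleftrightarrow>
     (\<Union>i\<in>ind M. cdom M i) = pts M \<and>
     (\<forall>i\<in>ind M. openin (mtop M) (cdom M i) \<and>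
        openin (top_of_set (model M)) (chart M i ` cdom M i) \<and>
        homeomorphic_map (subtopology (mtop M) (cdom M i)) (top_of_set (chart M i ` cdom M i))
          (chart M i)) \<and>
     (\<forall>i\<in>ind M. \<forall>j\<in>ind M.
        smooth s (model M) (model M) (overlap M i j) (transition M i j))"

definition smooth_map ::
  "('k::topological_base_ring \<Rightarrow> 'a::{topological_ab_group_add,t2_space} \<Rightarrow> 'a)
    \<Rightarrow> ('p, 'i, ('a, 'k) pt) mfd \<Rightarrow> ('q, 'j, ('a, 'k) pt) mfd \<Rightarrow> ('p \<Rightarrow> 'q) \<Rightarrow> bool" where
  "smooth_map s M N f \<longleftrightarrow>
     continuous_map (mtop M) (mtop N) f \<and>
     (\<forall>i\<in>ind M. \<forall>j\<in>ind N.
        smooth s (model M) (model N) (chart M i ` {p \<in> cdom M i. f p \<in> cdom N j})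
          (chart N j \<circ> f \<circ> cinv M i))"

definition diffeomorphism where
  "diffeomorphism s M N f \<longleftrightarrow>
     bij_betw f (pts M) (pts N) \<and> smooth_map s M N f \<and> smooth_map s N M (inv_into (pts M) f)"

text \<open>The topology on a set that is defined by bijective charts onto open sets of the model.\<close>

definition atlas_topology ::
  "'i set \<Rightarrow> ('i \<Rightarrow> 'p set) \<Rightarrow> ('i \<Rightarrow> 'p \<Rightarrow> 'u) \<Rightarrow> 'u::topological_space set \<Rightarrow> 'p topology" where
  "atlas_topology I D c E = topology (\<lambda>A. A \<subseteq> (\<Union>i\<in>I. D i) \<and>
     (\<forall>i\<in>I. openin (top_of_set E) (c i ` (A \<inter> D i))))"

section \<open>Tangent bundles\<close>

text \<open>A point of \<open>TM\<close> is a class of triples \<open>(i, x, v)\<close>, where \<open>x\<close> is in the range of the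
  \<open>i\<close>-th chart and \<open>v\<close> in the model, modulo \<open>(i, x, v) \<sim> (j, \<phi>\<^sub>j\<^sub>i(x), d\<phi>\<^sub>j\<^sub>i(x)v)\<close>.\<close>

definition tclass where
  "tclass s M i x v =
     {(j, pair (transition M i j x)
            (diff s (model M) (model M) (overlap M i j) (transition M i j) x v)) | j.
        j \<in> ind M \<and> cinv M i x \<in> cdom M j}"

definition tdom where
  "tdom s M i = {tclass s M i x v | x v. x \<in> chart M i ` cdom M i \<and> v \<in> model M}"

definition tchart :: "'i \<Rightarrow> ('i \<times> 'u) set \<Rightarrow> 'u" where
  "tchart i c = (THE p. (i, p) \<in> c)"

definition Tan ::
  "('k::topological_base_ring \<Rightarrow> 'a::{topological_ab_group_add,t2_space} \<Rightarrow> 'a)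
    \<Rightarrow> ('p, 'i, ('a, 'k) pt) mfd \<Rightarrow> (('i \<times> ('a, 'k) pt) set, 'i, ('a, 'k) pt) mfd" where
  "Tan s M =
     \<lparr>mtop = atlas_topology (ind M) (tdom s M) tchart (prd (model M) (model M)),
      ind = ind M, cdom = tdom s M, chart = tchart, model = prd (model M) (model M)\<rparr>"

definition tproj :: "('p, 'i, ('a, 'k) pt) mfd \<Rightarrow> ('i \<times> ('a, 'k) pt) set \<Rightarrow> 'p" where
  "tproj M c = (THE m. \<exists>(i, p)\<in>c. m = cinv M i (lpt p))"

text \<open>The iterated tangent bundle \<open>T\<^sup>kM\<close>, for \<open>k \<ge> 1\<close> only (the points of \<open>T\<^sup>0M\<close> have another type).\<close>

definition Tpow ::
  "('k::topological_base_ring \<Rightarrow> 'a::{topological_ab_group_add,t2_space} \<Rightarrow> 'a)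
    \<Rightarrow> nat \<Rightarrow> ('p, 'i, ('a, 'k) pt) mfd \<Rightarrow> (('i \<times> ('a, 'k) pt) set, 'i, ('a, 'k) pt) mfd" where
  "Tpow s k M = (Tan s ^^ (k - 1)) (Tan s M)"

text \<open>\<open>Tpow_proj s n M\<close> is the projection \<open>T\<^sup>n\<^sup>+\<^sup>1M \<rightarrow> M\<close>.\<close>

primrec Tpow_proj ::
  "('k::topological_base_ring \<Rightarrow> 'a::{topological_ab_group_add,t2_space} \<Rightarrow> 'a)
    \<Rightarrow> nat \<Rightarrow> ('p, 'i, ('a, 'k) pt) mfd \<Rightarrow> ('i \<times> ('a, 'k) pt) set \<Rightarrow> 'p" where
  "Tpow_proj s 0 M = tproj M"
| "Tpow_proj s (Suc n) M = Tpow_proj s n M \<circ> tproj (Tpow s (Suc n) M)"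

section \<open>Vector bundles\<close>

text \<open>The model of the total space is \<open>'v \<times> 'w\<close>; the base is modelled on its subspace \<open>'v \<times> 0\<close>.\<close>

definition vscale :: "('k \<Rightarrow> 'v \<Rightarrow> 'v) \<Rightarrow> ('k \<Rightarrow> 'w \<Rightarrow> 'w) \<Rightarrow> 'k \<Rightarrow> 'v \<times> 'w \<Rightarrow> 'v \<times> 'w" where
  "vscale sV sW t = (\<lambda>(v, w). (sV t v, sW t w))"

text \<open>\<open>M\<close> and \<open>F\<close> are given by atlases with a common index set: the \<open>i\<close>-th bundle chart of \<open>F\<close> lies
  over the \<open>i\<close>-th chart of \<open>M\<close>.\<close>

record ('m, 'f, 'i, 'v, 'w, 'k) vbundle =
  base :: "('m, 'i, ('v \<times> 'w, 'k) pt) mfd"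
  total :: "('f, 'i, ('v \<times> 'w, 'k) pt) mfd"
  proj :: "'f \<Rightarrow> 'm"

definition vector_bundle ::
  "('k::topological_base_ring \<Rightarrow> 'v::{topological_ab_group_add,t2_space} \<Rightarrow> 'v)
    \<Rightarrow> ('k \<Rightarrow> 'w::{topological_ab_group_add,t2_space} \<Rightarrow> 'w)
    \<Rightarrow> ('m, 'f, 'i, 'v, 'w, 'k) vbundle \<Rightarrow> bool" where
  "vector_bundle sV sW F \<longleftrightarrow>
     manifold (vscale sV sW) (base F) \<and> manifold (vscale sV sW) (total F) \<and>
     model (base F) = range (\<lambda>v. vpt (v, 0)) \<and> model (total F) = range vpt \<and>
     ind (total F) = ind (base F) \<and>
     proj F \<in> pts (total F) \<rightarrow> pts (base F) \<and>
     (\<forall>i\<in>ind (base F).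
        cdom (total F) i = {f \<in> pts (total F). proj F f \<in> cdom (base F) i} \<and>
        chart (total F) i ` cdom (total F) i =
          {vpt (x, w) | x w. vpt (x, 0) \<in> chart (base F) i ` cdom (base F) i} \<and>
        (\<forall>f\<in>cdom (total F) i. \<forall>x w. chart (total F) i f = vpt (x, w) \<longrightarrow>
            chart (base F) i (proj F f) = vpt (x, 0))) \<and>
     (\<forall>i\<in>ind (base F). \<forall>j\<in>ind (base F). \<forall>x. vpt (x, 0) \<in> overlap (base F) i j \<longrightarrow>
        module_hom sW sW (\<lambda>w. snd (fst (transition (total F) i j (vpt (x, w)) []))))"

section \<open>Multi-indices, partitions and the general multilinear group\<close>

text \<open>\<open>idx n\<close> is \<open>{0,1}\<^sup>n\<close>; a multi-index is continued by zero to a function on the natural numbers.\<close>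

type_synonym index = "nat \<Rightarrow> nat"

definition idx :: "nat \<Rightarrow> index set" where
  "idx n = {\<alpha>. (\<forall>i<n. \<alpha> i \<in> {0, 1}) \<and> (\<forall>i\<ge>n. \<alpha> i = 0)}"

definition pos :: "nat \<Rightarrow> index set" where
  "pos n = idx n - {0}"

definition parts :: "nat \<Rightarrow> index \<Rightarrow> index set set" where
  "parts n \<alpha> = {\<Lambda>. \<Lambda> \<subseteq> pos n \<and> \<Sum>\<Lambda> = \<alpha>}"

definition multilinear_on ::
  "('k \<Rightarrow> 'u \<Rightarrow> 'u) \<Rightarrow> 'b set \<Rightarrow> ('b \<Rightarrow> 'u set) \<Rightarrow> 'u set \<Rightarrow> (('b \<Rightarrow> 'u::ab_group_add) \<Rightarrow> 'u) \<Rightarrow> bool" where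
  "multilinear_on sc B V W f \<longleftrightarrow>
     (\<forall>v\<in>Pi\<^sub>E B V. f v \<in> W \<and>
        (\<forall>\<beta>\<in>B. \<forall>x\<in>V \<beta>. \<forall>y\<in>V \<beta>. f (v(\<beta> := x + y)) = f (v(\<beta> := x)) + f (v(\<beta> := y))) \<and>
        (\<forall>\<beta>\<in>B. \<forall>x\<in>V \<beta>. \<forall>t. f (v(\<beta> := sc t x)) = sc t (f (v(\<beta> := x)))))"

text \<open>\<open>Gm sc n V\<close> is the group \<open>Gm\<^sup>0\<^sup>,\<^sup>n(E)\<close> for \<open>E = \<Oplus>\<^sub>\<alpha>\<^sub>>\<^sub>0 V\<^sub>\<alpha>\<close>, the elements of \<open>E\<close> being the families
  in the extensional product.\<close>

definition Gm ::
  "('k \<Rightarrow> 'u \<Rightarrow> 'u) \<Rightarrow> nat \<Rightarrow> (index \<Rightarrow> 'u::ab_group_add set)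
    \<Rightarrow> ((index \<Rightarrow> 'u) \<Rightarrow> index \<Rightarrow> 'u) set" where
  "Gm sc n V = {f. f \<in> extensional (Pi\<^sub>E (pos n) V) \<and> (\<exists>b.
     (\<forall>\<alpha>\<in>pos n. \<forall>\<Lambda>\<in>parts n \<alpha>. multilinear_on sc \<Lambda> V (V \<alpha>) (b \<Lambda>)) \<and>
     (\<forall>\<alpha>\<in>pos n. bij_betw (\<lambda>x. b {\<alpha>} (\<lambda>\<beta>\<in>{\<alpha>}. x)) (V \<alpha>) (V \<alpha>)) \<and>
     (\<forall>v\<in>Pi\<^sub>E (pos n) V. f v = (\<lambda>\<alpha>\<in>pos n. \<Sum>\<Lambda>\<in>parts n \<alpha>. b \<Lambda> (restrict v \<Lambda>))))}"

section \<open>Coordinates on \<open>T\<^sup>kF\<close>\<close>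

text \<open>The model of \<open>T\<^sup>kF\<close> consists of binary trees of depth \<open>k\<close> whose leaves are in \<open>'v \<times> 'w\<close>. The
  outermost pair carries the last unit \<open>\<epsilon>\<^sub>k\<close>, the innermost one \<open>\<epsilon>\<^sub>1\<close>, and the two components
  of a leaf correspond to \<open>\<alpha>\<^sub>0 = 0\<close> and \<open>\<alpha>\<^sub>0 = 1\<close>.\<close>

definition addr :: "nat \<Rightarrow> index \<Rightarrow> bool list" where
  "addr k \<alpha> = rev (map (\<lambda>i. \<alpha> i = 1) [1..<Suc k])"

text \<open>The module \<open>V\<^sub>\<alpha>\<close>, the point \<open>\<epsilon>\<^sup>\<alpha>u\<close> for \<open>u\<close> in \<open>V\<^sub>\<alpha>\<close>, and the point \<open>x + \<Sum>\<^sub>\<alpha>\<^sub>>\<^sub>0 \<epsilon>\<^sup>\<alpha>v\<^sub>\<alpha>\<close>.\<close>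

definition Valpha :: "index \<Rightarrow> ('v::zero \<times> 'w::zero, 'k::zero) pt set" where
  "Valpha \<alpha> = (if \<alpha> 0 = 0 then range (\<lambda>v. vpt (v, 0)) else range (\<lambda>w. vpt (0, w)))"

definition eps :: "nat \<Rightarrow> index \<Rightarrow> ('a::zero, 'k::zero) pt \<Rightarrow> ('a, 'k) pt" where
  "eps k \<alpha> u = (\<lambda>w. if w = addr k \<alpha> then u [] else 0)"

definition pnt ::
  "nat \<Rightarrow> ('a::ab_group_add, 'k::ab_group_add) pt \<Rightarrow> (index \<Rightarrow> ('a, 'k) pt) \<Rightarrow> ('a, 'k) pt" where
  "pnt k x v = eps k 0 x + (\<Sum>\<alpha>\<in>pos (Suc k). eps k \<alpha> (v \<alpha>))"

abbreviation Efib :: "nat \<Rightarrow> (index \<Rightarrow> ('v::zero \<times> 'w::zero, 'k::zero) pt) set" where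
  "Efib k \<equiv> Pi\<^sub>E (pos (Suc k)) Valpha"

text \<open>The module operations of the direct sum \<open>E = \<Oplus>\<^sub>\<alpha>\<^sub>>\<^sub>0 V\<^sub>\<alpha>\<close>.\<close>

definition Eadd where
  "Eadd k v w = (\<lambda>\<alpha>\<in>pos (Suc k). v \<alpha> + w \<alpha>)"

definition Escale where
  "Escale sc k t v = (\<lambda>\<alpha>\<in>pos (Suc k). sc t (v \<alpha>))"

text \<open>The base coordinate \<open>x\<close> of a point of the model.\<close>

definition base_pt :: "nat \<Rightarrow> ('v::zero \<times> 'w::zero, 'k::zero) pt \<Rightarrow> ('v \<times> 'w, 'k) pt" where
  "base_pt k p = vpt (fst (fst (p (addr k 0))), 0)"

definition vert :: "nat \<Rightarrow> ('v::ab_group_add \<times> 'w::ab_group_add, 'k::ab_group_add) pt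
    \<Rightarrow> ('v \<times> 'w, 'k) pt" where
  "vert k p = p - eps k 0 (base_pt k p)"

section \<open>The bundle \<open>T\<^sup>kF\<close>\<close>

definition TkF where
  "TkF sV sW k F = Tpow (vscale sV sW) k (total F)"

definition TkF_proj where
  "TkF_proj sV sW k F = proj F \<circ> Tpow_proj (vscale sV sW) (k - 1) (total F)"

definition TkF_fiber where
  "TkF_fiber sV sW k F x = {c \<in> pts (TkF sV sW k F). TkF_proj sV sW k F c = x}"

text \<open>The point of the fiber of \<open>T\<^sup>kF\<close> over \<open>x\<close> with fiber coordinates \<open>v\<close> in the \<open>i\<close>-th bundle chart.\<close>

definition TkF_pt where
  "TkF_pt sV sW k F i x v = cinv (TkF sV sW k F) i (pnt k (chart (base F) i x) v)"

text \<open>The fiber product \<open>T\<^sup>kF \<times>\<^sub>M T\<^sup>kF\<close>: the second component contributes only its fiber coordinates.\<close>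

definition TkF_fprod where
  "TkF_fprod sV sW k F = (let N = TkF sV sW k F; \<pi> = TkF_proj sV sW k F;
       P = {(a, b). a \<in> pts N \<and> b \<in> pts N \<and> \<pi> a = \<pi> b} in
     \<lparr>mtop = subtopology (prod_topology (mtop N) (mtop N)) P,
      ind = ind N,
      cdom = (\<lambda>i. {(a, b) \<in> P. a \<in> cdom N i \<and> b \<in> cdom N i}),
      chart = (\<lambda>i (a, b). pair (chart N i a) (vert k (chart N i b))),
      model = prd (model N) (vert k ` model N)\<rparr>)"

definition scalar_times ::
  "('p, 'i, ('a::zero, 'k::{zero,topological_space}) pt) mfd \<Rightarrow> ('k \<times> 'p, 'i, ('a, 'k) pt) mfd" where
  "scalar_times N =
     \<lparr>mtop = prod_topology euclidean (mtop N),
      ind = ind N,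
      cdom = (\<lambda>i. UNIV \<times> cdom N i),
      chart = (\<lambda>i (t, a). pair (spt t) (chart N i a)),
      model = prd (range spt) (model N)\<rparr>"

section \<open>The axes and the bundle \<open>A\<^sup>kF\<close>\<close>

text \<open>The fiber over \<open>x\<close> of \<open>F\<^sup>\<alpha>\<close>, which is a copy of \<open>TM\<close> or of \<open>F\<close>, and the fiber coordinate of an
  element of \<open>F\<^sup>\<alpha>\<close> in the \<open>i\<close>-th bundle chart.\<close>

definition Falpha where
  "Falpha sV sW F \<alpha> x =
     (if \<alpha> 0 = 0
      then Inl ` {c \<in> pts (Tan (vscale sV sW) (base F)). tproj (base F) c = x}
      else Inr ` {f \<in> pts (total F). proj F f = x})"

definition Fcoord where
  "Fcoord F i u = (case u of
     Inl c \<Rightarrow> rpt (tchart i c)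
   | Inr f \<Rightarrow> vpt (0, snd (fst (chart (total F) i f []))))"

text \<open>The fiberwise module operations of the vector bundle \<open>F\<^sup>\<alpha>\<close>; they do not depend on the chart.\<close>

definition Fadd where
  "Fadd sV sW F \<alpha> x a b = (THE c. c \<in> Falpha sV sW F \<alpha> x \<and>
     (\<forall>i\<in>ind (base F). x \<in> cdom (base F) i \<longrightarrow> Fcoord F i c = Fcoord F i a + Fcoord F i b))"

definition Fscale where
  "Fscale sV sW F \<alpha> x t a = (THE c. c \<in> Falpha sV sW F \<alpha> x \<and>
     (\<forall>i\<in>ind (base F). x \<in> cdom (base F) i \<longrightarrow>
        Fcoord F i c = pscale (vscale sV sW) t (Fcoord F i a)))"

definition Fzero where
  "Fzero sV sW F \<alpha> x = (THE c. c \<in> Falpha sV sW F \<alpha> x \<and>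
     (\<forall>i\<in>ind (base F). x \<in> cdom (base F) i \<longrightarrow> Fcoord F i c = 0))"

definition AkF_dom where
  "AkF_dom sV sW k F i =
     {(x, u). x \<in> cdom (base F) i \<and> u \<in> Pi\<^sub>E (pos (Suc k)) (\<lambda>\<alpha>. Falpha sV sW F \<alpha> x)}"

definition AkF_chart where
  "AkF_chart k F i = (\<lambda>(x, u). pnt k (chart (base F) i x) (\<lambda>\<alpha>. Fcoord F i (u \<alpha>)))"

text \<open>The model \<open>V \<times> \<Oplus>\<^sub>\<alpha>\<^sub>>\<^sub>0 V\<^sub>\<alpha>\<close> of \<open>A\<^sup>kF\<close> is the same module as that of \<open>T\<^sup>kF\<close>; only the transition
  functions differ.\<close>

definition AkF where
  "AkF sV sW k F =
     \<lparr>mtop = atlas_topology (ind (base F)) (AkF_dom sV sW k F) (AkF_chart k F)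
        (model (TkF sV sW k F)),
      ind = ind (base F), cdom = AkF_dom sV sW k F, chart = AkF_chart k F,
      model = model (TkF sV sW k F)\<rparr>"

definition AkF_pt where
  "AkF_pt sV sW k F i x v = cinv (AkF sV sW k F) i (pnt k (chart (base F) i x) v)"

text \<open>The canonical linear structure \<open>L\<^sub>0\<close> on \<open>A\<^sup>kF\<close>.\<close>

definition L0_add where
  "L0_add sV sW k F = (\<lambda>((x, u), (y, v)).
     (x, \<lambda>\<alpha>\<in>pos (Suc k). Fadd sV sW F \<alpha> x (u \<alpha>) (v \<alpha>)))"

definition L0_scale where
  "L0_scale sV sW k F = (\<lambda>(t, (x, u)).
     (x, \<lambda>\<alpha>\<in>pos (Suc k). Fscale sV sW F \<alpha> x t (u \<alpha>)))"

text \<open>The inclusions of the axis \<open>F\<^sup>\<alpha>\<close>, on fibers over \<open>x\<close>.\<close>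

definition AkF_axis where
  "AkF_axis sV sW k F \<alpha> x u =
     (x, \<lambda>\<beta>\<in>pos (Suc k). if \<beta> = \<alpha> then u else Fzero sV sW F \<beta> x)"

definition TkF_axis where
  "TkF_axis sV sW k F \<alpha> x u = (THE c. c \<in> pts (TkF sV sW k F) \<and>
     (\<forall>i\<in>ind (base F). x \<in> cdom (base F) i \<longrightarrow> c \<in> cdom (TkF sV sW k F) i \<and>
        chart (TkF sV sW k F) i c = eps k 0 (chart (base F) i x) + eps k \<alpha> (Fcoord F i u)))"

section \<open>Linear structures, multilinear connections, isomorphisms\<close>

text \<open>A linear structure is a pair of an addition and a scalar multiplication. All maps between
  sets of points are extensional, so that equality of functions is equality of maps.\<close>

definition scalar_ring :: "'k::comm_ring_1 ring" where
  "scalar_ring = \<lparr>carrier = UNIV, monoid.mult = (*), one = 1, zero = 0, add = (+)\<rparr>"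

text \<open>The fiber over \<open>x\<close> with the operations of \<open>L\<close>. The fields for multiplication and
  unit are not used by the module locale.\<close>

definition fiber_module where
  "fiber_module sV sW k F L x =
     \<lparr>carrier = TkF_fiber sV sW k F x, monoid.mult = undefined, one = undefined,
      zero = (THE z. z \<in> TkF_fiber sV sW k F x \<and>
                (\<forall>a\<in>TkF_fiber sV sW k F x. fst L (z, a) = a)),
      add = (\<lambda>a b. fst L (a, b)), smult = (\<lambda>t a. snd L (t, a))\<rparr>"

definition linear_structure where
  "linear_structure sV sW k F L \<longleftrightarrow>
     (let N = TkF sV sW k F; P = TkF_fprod sV sW k F; \<pi> = TkF_proj sV sW k F in
      fst L \<in> extensional (pts P) \<and> snd L \<in> extensional (UNIV \<times> pts N) \<and>
      smooth_map (vscale sV sW) P N (fst L) \<and>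
      smooth_map (vscale sV sW) (scalar_times N) N (snd L) \<and>
      (\<forall>(a, b)\<in>pts P. \<pi> (fst L (a, b)) = \<pi> a) \<and>
      (\<forall>t. \<forall>a\<in>pts N. \<pi> (snd L (t, a)) = \<pi> a) \<and>
      (\<forall>x\<in>pts (base F). Module.module scalar_ring (fiber_module sV sW k F L x)))"

text \<open>The last condition says that \<open>f\<close> transports the module structure on the fiber induced by the
  chart to that of \<open>L\<close>.\<close>

definition multilinear_connections where
  "multilinear_connections sV sW k F = {L. linear_structure sV sW k F L \<and>
     (\<forall>i\<in>ind (base F). \<forall>x\<in>cdom (base F) i.
        \<exists>f\<in>Gm (pscale (vscale sV sW)) (Suc k) Valpha.
          \<forall>v\<in>Efib k. \<forall>w\<in>Efib k. \<forall>t.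
            fst L (TkF_pt sV sW k F i x (f v), TkF_pt sV sW k F i x (f w)) =
              TkF_pt sV sW k F i x (f (Eadd k v w)) \<and>
            snd L (t, TkF_pt sV sW k F i x (f v)) =
              TkF_pt sV sW k F i x (f (Escale (pscale (vscale sV sW)) k t v)))}"

definition multilinear_isos where
  "multilinear_isos sV sW k F = {\<Phi>. \<Phi> \<in> extensional (pts (AkF sV sW k F)) \<and>
     diffeomorphism (vscale sV sW) (AkF sV sW k F) (TkF sV sW k F) \<Phi> \<and>
     (\<forall>a\<in>pts (AkF sV sW k F). TkF_proj sV sW k F (\<Phi> a) = fst a) \<and>
     (\<forall>i\<in>ind (base F). \<forall>x\<in>cdom (base F) i.
        \<exists>f\<in>Gm (pscale (vscale sV sW)) (Suc k) Valpha.
          \<forall>v\<in>Efib k. \<Phi> (AkF_pt sV sW k F i x v) = TkF_pt sV sW k F i x (f v))}"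

definition identity_on_axes where
  "identity_on_axes sV sW k F \<Phi> \<longleftrightarrow>
     (\<forall>\<alpha>\<in>pos (Suc k). \<forall>x\<in>pts (base F). \<forall>u\<in>Falpha sV sW F \<alpha> x.
        \<Phi> (AkF_axis sV sW k F \<alpha> x u) = TkF_axis sV sW k F \<alpha> x u)"

text \<open>The push-forward \<open>L\<^sup>\<Phi>\<close> of \<open>L\<^sub>0\<close>, and the map \<open>\<Phi>\<^sup>L\<close>.\<close>

definition push_L0 where
  "push_L0 sV sW k F \<Phi> = (let \<Psi> = inv_into (pts (AkF sV sW k F)) \<Phi> in
     (\<lambda>(a, b)\<in>pts (TkF_fprod sV sW k F). \<Phi> (L0_add sV sW k F (\<Psi> a, \<Psi> b)),
      \<lambda>(t, a)\<in>UNIV \<times> pts (TkF sV sW k F). \<Phi> (L0_scale sV sW k F (t, \<Psi> a))))"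

definition sum_map where
  "sum_map sV sW k F L = (\<lambda>(x, u)\<in>pts (AkF sV sW k F).
     finsum (fiber_module sV sW k F L x) (\<lambda>\<alpha>. TkF_axis sV sW k F \<alpha> x (u \<alpha>)) (pos (Suc k)))"

end

theory Submission
  imports Defs
begin

text \<open>Why the theorem is true. In a bundle chart the fiber of \<open>T\<^sup>kF\<close> is the module
  \<open>E = \<Oplus>\<^sub>\<alpha>\<^sub>>\<^sub>0 V\<^sub>\<alpha>\<close>, and a multilinear connection is a module structure on the fibers that is
  transported from \<open>E\<close> by an element \<open>f\<close> of the general multilinear group. Such an \<open>f\<close> is
  triangular: apart from \<open>{\<alpha>}\<close> itself, a partition of \<open>\<alpha>\<close> consists of indices shorter than \<open>\<alpha>\<close>
  (\<open>wt_parts_less\<close>). Hence \<open>f\<close> is bijective and maps each axis onto itself by a linear bijection.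
  Since linear maps of \<open>E\<close> that act on each \<open>V\<^sub>\<alpha>\<close> separately do not change the transported
  structure, \<open>f\<close> can be composed with the inverses of these bijections (\<open>Mgrp_normalize\<close>,
  \<open>connection_normal\<close>), and the result \<open>g\<close> is the identity on the axes. The sum of the axis
  elements \<open>v\<^sub>\<alpha>\<close> with respect to the structure transported by \<open>g\<close> is then \<open>g(v)\<close> (\<open>sum_map_pt\<close>):
  so \<open>\<Phi>\<^sup>L\<close> is fiberwise an element of the group, it is the identity on the axes, and it transports
  \<open>L\<^sub>0\<close> to \<open>L\<close>. Conversely the structure \<open>L\<^sup>\<Phi>\<close> is transported by the chart representative of
  \<open>\<Phi>\<close>, and its sum map is \<open>\<Phi>\<close> for the same reason (\<open>push_conj\<close>, \<open>sum_map_push\<close>,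
  \<open>push_sum_map\<close>).

  It remains to see that everything is smooth. In a chart, \<open>\<Phi>\<^sup>L\<close> arises by adding the axis
  components one after the other with the smooth addition of \<open>L\<close> (\<open>sum_map_rep_smooth\<close>). Its
  inverse is smooth because solving \<open>g(v) = w\<close> for a triangular \<open>g\<close> with identity diagonal
  amounts to iterating \<open>v \<mapsto> w - (g(v) - v)\<close> finitely often, and this only involves
  compositions and sums of smooth maps (\<open>newton_solves\<close>, \<open>newton_smooth\<close>). The operations of
  \<open>L\<^sup>\<Phi>\<close> are compositions of \<open>\<Phi>\<close>, its inverse and the operations of the model (\<open>push_smooth\<close>).

  These arguments rest on three bodies of theory, developed first as far as they are needed:
  the calculus of the classes \<open>C\<^sup>j\<close> over \<open>\<K>\<close> (uniqueness of \<open>f\<^sup>[\<^sup>1\<^sup>]\<close>, chain rule, smoothness of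
  linear maps and of scalar multiplication); the construction of manifolds from an atlas, applied
  to tangent bundles; and the bundle charts of \<open>T\<^sup>kF\<close> and \<open>A\<^sup>kF\<close>. For \<open>T\<^sup>kF\<close> the essential point
  is that iterated tangent maps of the transition maps preserve the axes and act on them by the
  transition maps of \<open>TM\<close> and \<open>F\<close> (\<open>prolongation_Suc\<close>), so that the inclusions of the axes do not
  depend on the chart.

  Over a general ring \<open>\<K>\<close> being \<open>C\<^sup>j\<close> is not a local property, since \<open>f\<^sup>[\<^sup>1\<^sup>](x, v, t)\<close> with
  non-invertible \<open>t\<close> may relate distant points. Therefore smoothness is never checked locally: all
  maps in question preserve base points, hence map the domain of the \<open>i\<close>-th bundle chart to that of
  the \<open>i\<close>-th bundle chart, and are represented by one smooth map on the whole chart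
  (\<open>smooth_mapI\<close>).\<close>

section \<open>The topology of the universe\<close>

lemma continuous_on_UNIV_tendsto_nhds:
  "continuous_on UNIV f \<Longrightarrow> (f \<longlongrightarrow> f z) (nhds z)"
  by (simp add: continuous_on_def tendsto_at_iff_tendsto_nhds)

text \<open>Since the universe carries the product topology, its operations are continuous because they are
  so in each coordinate.\<close>

instance "fun" :: (type, topological_monoid_add) topological_monoid_add
proof
  fix a b :: "'a \<Rightarrow> 'b"
  have "continuous_on UNIV (\<lambda>z::('a \<Rightarrow> 'b) \<times> ('a \<Rightarrow> 'b). fst z + snd z)"
    unfolding plus_fun_def
    by (intro continuous_on_coordinatewise_then_product continuous_on_add
        continuous_on_product_then_coordinatewise[OF continuous_on_fst[OF continuous_on_id]]
        continuous_on_product_then_coordinatewise[OF continuous_on_snd[OF continuous_on_id]])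
  from continuous_on_UNIV_tendsto_nhds[OF this, of "(a, b)"]
  show "((\<lambda>x. fst x + snd x) \<longlongrightarrow> a + b) (nhds a \<times>\<^sub>F nhds b)"
    by (simp add: nhds_prod)
qed

instance "fun" :: (type, topological_group_add) topological_group_add
proof
  fix a :: "'a \<Rightarrow> 'b"
  have "continuous_on UNIV (\<lambda>z::'a \<Rightarrow> 'b. - z)"
    unfolding fun_Compl_def
    by (intro continuous_on_coordinatewise_then_product continuous_on_minus
        continuous_on_product_then_coordinatewise[OF continuous_on_id])
  from continuous_on_UNIV_tendsto_nhds[OF this, of a]
  show "(uminus \<longlongrightarrow> - a) (nhds a)" by simp
qed

instance "fun" :: (type, topological_ab_group_add) topological_ab_group_add ..

text \<open>Points of the universe are functions. The following rules would apply below an abstraction and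
  destroy sums of points.\<close>

declare plus_fun_apply [simp del] minus_apply [simp del] uminus_apply [simp del]

lemma lpt_pair [simp]: "lpt (pair p q) = p"
  by (simp add: lpt_def pair_def)

lemma rpt_pair [simp]: "rpt (pair p q) = q"
  by (simp add: rpt_def pair_def)

lemma pair_root [simp]: "pair p q [] = 0"
  by (simp add: pair_def)

lemma pair_eq_iff [simp]: "pair p q = pair p' q' \<longleftrightarrow> p = p' \<and> q = q'"
  by (metis lpt_pair rpt_pair)

lemma pair_lpt_rpt: "z [] = 0 \<Longrightarrow> pair (lpt z) (rpt z) = z"
  by (rule ext) (simp add: pair_def lpt_def rpt_def split: list.split)

lemma mem_prd_iff: "z \<in> prd E F \<longleftrightarrow> z [] = 0 \<and> lpt z \<in> E \<and> rpt z \<in> F"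
  unfolding prd_def by (auto, metis pair_lpt_rpt)

lemma pair_mem_prd [simp]: "pair p q \<in> prd E F \<longleftrightarrow> p \<in> E \<and> q \<in> F"
  by (simp add: mem_prd_iff)

lemma prdE:
  assumes "z \<in> prd E F" obtains p q where "z = pair p q" "p \<in> E" "q \<in> F"
  using assms unfolding prd_def by blast

text \<open>The scalar at the root, the inverse of \<open>spt\<close>.\<close>

definition sval :: "('a, 'k) pt \<Rightarrow> 'k" where
  "sval p = snd (p [])"

lemma sval_spt [simp]: "sval (spt t) = t"
  by (simp add: sval_def spt_def)

lemma spt_sval [simp]: "p \<in> range spt \<Longrightarrow> spt (sval p) = p"
  by auto

lemma spt_eq_iff [simp]: "spt t = spt u \<longleftrightarrow> t = u"
  by (metis sval_spt)

lemma pair_add: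
  fixes p :: "('a::ab_group_add, 'k::ab_group_add) pt"
  shows "pair p q + pair p' q' = pair (p + p') (q + q')"
  by (rule ext) (simp add: plus_fun_apply pair_def split: list.split)

lemma lpt_add: "lpt (p + q) = lpt p + lpt q"
  by (simp add: lpt_def fun_eq_iff plus_fun_apply)

lemma rpt_add: "rpt (p + q) = rpt p + rpt q"
  by (simp add: rpt_def fun_eq_iff plus_fun_apply)

lemma spt_add:
  "spt t + spt u = (spt (t + u) :: ('a::ab_group_add, 'k::ab_group_add) pt)"
  by (rule ext) (simp add: spt_def plus_fun_apply)

lemma spt_0 [simp]: "spt 0 = 0"
  by (rule ext) (simp add: spt_def zero_prod_def)

lemma vpt_add:
  "vpt v + vpt w = (vpt (v + w) :: ('a::ab_group_add, 'k::ab_group_add) pt)"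
  by (rule ext) (simp add: vpt_def plus_fun_apply)

lemma vpt_0 [simp]: "vpt 0 = 0"
  by (rule ext) (simp add: vpt_def zero_prod_def)

lemma vpt_eq_iff [simp]: "vpt v = vpt w \<longleftrightarrow> v = w"
  by (metis vpt_def fst_conv)

lemma fst_vpt_root [simp]: "fst (vpt v []) = v"
  by (simp add: vpt_def)

lemma continuous_on_lpt: "continuous_on A f \<Longrightarrow> continuous_on A (\<lambda>x. lpt (f x))"
  unfolding lpt_def
  by (rule continuous_on_coordinatewise_then_product) (rule continuous_on_product_then_coordinatewise)

lemma continuous_on_rpt: "continuous_on A f \<Longrightarrow> continuous_on A (\<lambda>x. rpt (f x))"
  unfolding rpt_def
  by (rule continuous_on_coordinatewise_then_product) (rule continuous_on_product_then_coordinatewise)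

lemma continuous_on_pair:
  assumes "continuous_on A f" "continuous_on A g"
  shows "continuous_on A (\<lambda>x. pair (f x) (g x))"
proof (rule continuous_on_coordinatewise_then_product)
  fix w :: "bool list"
  show "continuous_on A (\<lambda>x. pair (f x) (g x) w)"
    using assms[THEN continuous_on_product_then_coordinatewise]
    by (cases w; cases "hd w") (auto simp: pair_def)
qed

lemma continuous_on_spt:
  assumes "continuous_on A f" shows "continuous_on A (\<lambda>x. spt (f x))"
proof (rule continuous_on_coordinatewise_then_product)
  fix w :: "bool list"
  show "continuous_on A (\<lambda>x. spt (f x) w)"
    using assms by (cases "w = []") (auto simp: spt_def intro: continuous_on_Pair)
qed

lemma continuous_on_vpt:
  assumes "continuous_on A f" shows "continuous_on A (\<lambda>x. vpt (f x))"
proof (rule continuous_on_coordinatewise_then_product)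
  fix w :: "bool list"
  show "continuous_on A (\<lambda>x. vpt (f x) w)"
    using assms by (cases "w = []") (auto simp: vpt_def intro: continuous_on_Pair)
qed

lemma continuous_on_sval: "continuous_on A f \<Longrightarrow> continuous_on A (\<lambda>x. sval (f x))"
  unfolding sval_def by (rule continuous_on_snd, rule continuous_on_product_then_coordinatewise)

lemmas pt_intros = continuous_on_id continuous_on_const continuous_on_add continuous_on_minus
  continuous_on_diff continuous_on_lpt continuous_on_rpt continuous_on_pair continuous_on_spt
  continuous_on_vpt continuous_on_sval

lemma openin_prd:
  fixes E F :: "('a::topological_ab_group_add, 'k::topological_ab_group_add) pt set"
  assumes "openin (top_of_set E) U" "openin (top_of_set F) V"
  shows "openin (top_of_set (prd E F)) (prd U V)"
proof -
  obtain S T where ST: "open S" "open T" "U = E \<inter> S" "V = F \<inter> T"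
    using assms unfolding openin_open by blast
  have "open (lpt -` S :: ('a, 'k) pt set)"
    by (rule open_vimage[OF ST(1)]) (rule continuous_on_lpt[OF continuous_on_id])
  moreover have "open (rpt -` T :: ('a, 'k) pt set)"
    by (rule open_vimage[OF ST(2)]) (rule continuous_on_rpt[OF continuous_on_id])
  ultimately have "open (lpt -` S \<inter> rpt -` T :: ('a, 'k) pt set)" by (rule open_Int)
  moreover have "prd U V = prd E F \<inter> (lpt -` S \<inter> rpt -` T)"
    unfolding ST by (auto simp only: mem_prd_iff Int_iff vimage_eq)
  ultimately show ?thesis unfolding openin_open by blast
qed

text \<open>Since the units are dense, two continuous functions of a scalar that agree at the units
  agree everywhere; this is how the values of \<open>f\<^sup>[\<^sup>1\<^sup>]\<close> at non-invertible scalars are determined.\<close>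

lemma agree_on_units:
  fixes a b :: "'k::topological_base_ring \<Rightarrow> 'i \<Rightarrow> 'z::t2_space"
  assumes "open N" "continuous_on N a" "continuous_on N b"
    and eq: "\<And>t. t \<in> N \<Longrightarrow> t dvd 1 \<Longrightarrow> a t = b t" and "t \<in> N"
  shows "a t = b t"
proof (rule ccontr)
  assume "a t \<noteq> b t"
  then obtain i where i: "a t i \<noteq> b t i" by blast
  obtain A B where AB: "open A" "open B" "a t i \<in> A" "b t i \<in> B" "A \<inter> B = {}"
    using hausdorff[OF i] by blast
  define O' where "O' = ((\<lambda>t. a t i) -` A \<inter> N) \<inter> ((\<lambda>t. b t i) -` B \<inter> N)"
  note ab = assms(2,3)[THEN continuous_on_product_then_coordinatewise, of i,
      unfolded continuous_on_open_vimage[OF assms(1)], rule_format]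
  have "open O'" unfolding O'_def by (intro open_Int[of "_ \<inter> _" "_ \<inter> _"] ab AB)
  moreover have "t \<in> O'" using AB assms by (auto simp: O'_def)
  ultimately obtain u where "u \<in> O'" "u dvd 1" using dense_unit_group[of O'] by blast
  then show False using eq[of u] AB by (auto simp: O'_def)
qed

section \<open>Modules of the universe\<close>

locale base_module =
  fixes s :: "'k::topological_base_ring \<Rightarrow> 'a::{topological_ab_group_add,t2_space} \<Rightarrow> 'a"
  assumes topological_module: "topological_module s"
begin

lemma s_module: "Modules.module s" and s_continuous: "continuous_on UNIV (\<lambda>(t, v). s t v)"
  using topological_module by (auto simp: topological_module_def)

sublocale M: Modules.module s by (rule s_module)

sublocale P: Modules.module "pscale s"
  by standard
    (auto simp: pscale_def fun_eq_iff plus_fun_apply M.scale_right_distrib M.scale_left_distrib distrib_left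
      distrib_right mult.assoc prod_eq_iff)

abbreviation scale_pt (infixr "*\<^sub>p" 75) where
  "t *\<^sub>p p \<equiv> pscale s t p"

lemma continuous_on_pscale:
  assumes "continuous_on A f" "continuous_on A g"
  shows "continuous_on A (\<lambda>x. f x *\<^sub>p g x)"
  unfolding pscale_def
proof (intro continuous_on_coordinatewise_then_product continuous_on_Pair)
  fix w
  have "continuous_on A (\<lambda>x. (f x, fst (g x w)))"
    by (intro continuous_on_Pair continuous_on_fst assms(1)
        continuous_on_product_then_coordinatewise[OF assms(2)])
  from continuous_on_compose2[OF s_continuous this]
  show "continuous_on A (\<lambda>x. s (f x) (fst (g x w)))" by simp
  show "continuous_on A (\<lambda>x. f x * snd (g x w))"
    by (intro continuous_on_mult' continuous_on_snd assms(1)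
        continuous_on_product_then_coordinatewise[OF assms(2)])
qed

lemmas cont_intros = pt_intros continuous_on_pscale

lemma pscale_pair: "t *\<^sub>p pair p q = pair (t *\<^sub>p p) (t *\<^sub>p q)"
  by (rule ext) (simp add: pscale_def pair_def zero_prod_def split: list.split)

lemma lpt_pscale: "lpt (t *\<^sub>p p) = t *\<^sub>p lpt p"
  by (simp add: pscale_def lpt_def)

lemma rpt_pscale: "rpt (t *\<^sub>p p) = t *\<^sub>p rpt p"
  by (simp add: pscale_def rpt_def)

lemma pscale_spt: "t *\<^sub>p spt u = spt (t * u)"
  by (rule ext) (simp add: pscale_def spt_def zero_prod_def)

lemma pscale_vpt: "t *\<^sub>p vpt v = vpt (s t v)"
  by (rule ext) (simp add: pscale_def vpt_def zero_prod_def)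

lemma pscale_unit_cancel:
  assumes "t dvd 1" "t *\<^sub>p p = t *\<^sub>p q" shows "p = q"
proof -
  obtain u where "u * t = 1" using assms(1) by (metis dvdE mult.commute)
  then have "p = u *\<^sub>p (t *\<^sub>p p)" "q = u *\<^sub>p (t *\<^sub>p q)"
    by (simp_all add: P.scale_scale)
  with assms(2) show ?thesis by simp
qed

lemma subspace_prd: "P.subspace E \<Longrightarrow> P.subspace F \<Longrightarrow> P.subspace (prd E F)"
  unfolding P.subspace_def
  by (auto simp: mem_prd_iff lpt_add rpt_add lpt_pscale rpt_pscale)
    (auto simp: pscale_def lpt_def rpt_def zero_fun_def zero_prod_def plus_fun_apply)

lemma subspace_spt: "P.subspace (range spt)"
  unfolding P.subspace_def
  by (auto simp: spt_add pscale_spt intro: image_eqI[of _ _ 0])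

lemma subspace_mod1: "P.subspace E \<Longrightarrow> P.subspace (mod1 E)"
  unfolding mod1_def by (intro subspace_prd subspace_spt)

lemma mod1E:
  assumes "z \<in> mod1 E"
  obtains x v t where "z = pair x (pair v (spt t))" "x \<in> E" "v \<in> E"
  using assms unfolding mod1_def by (auto elim!: prdE)

lemma mem_mod1 [simp]: "pair x (pair v (spt t)) \<in> mod1 E \<longleftrightarrow> x \<in> E \<and> v \<in> E"
  unfolding mod1_def by auto

lemma mem_dom1 [simp]:
  "pair x (pair v (spt t)) \<in> dom1 s E U \<longleftrightarrow> x \<in> U \<and> v \<in> E \<and> x + t *\<^sub>p v \<in> U"
  unfolding dom1_def by auto

lemma dom1E:
  assumes "z \<in> dom1 s E U"
  obtains x v t where "z = pair x (pair v (spt t))" "x \<in> U" "v \<in> E" "x + t *\<^sub>p v \<in> U"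
  using assms unfolding dom1_def by auto

lemma openin_dom1:
  assumes E: "P.subspace E" and U: "openin (top_of_set E) U"
  shows "openin (top_of_set (mod1 E)) (dom1 s E U)"
proof -
  obtain T where T: "open T" "U = E \<inter> T" using U by (auto simp: openin_open)
  let ?e = "\<lambda>z. lpt z + sval (rpt (rpt z)) *\<^sub>p lpt (rpt z)"
  have "open (lpt -` T \<inter> ?e -` T)"
    using T by (intro open_Int open_vimage cont_intros) auto
  moreover have "dom1 s E U = mod1 E \<inter> (lpt -` T \<inter> ?e -` T)"
    using T(2) E by (auto elim!: mod1E dom1E simp: P.subspace_add P.subspace_scale)
  ultimately show ?thesis by (auto simp: openin_open)
qed

lemma open_line:
  assumes "openin (top_of_set E) U" "P.subspace E" "x \<in> E" "v \<in> E"
  shows "open {t. x + t *\<^sub>p v \<in> U}"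
proof -
  obtain T where T: "open T" "U = E \<inter> T" using assms by (auto simp: openin_open)
  have "open ((\<lambda>t. x + t *\<^sub>p v) -` T)"
    using T by (intro open_vimage cont_intros) auto
  moreover have "{t. x + t *\<^sub>p v \<in> U} = (\<lambda>t. x + t *\<^sub>p v) -` T"
    using assms T by (auto simp: P.subspace_add P.subspace_scale)
  ultimately show ?thesis by simp
qed

lemma mem_dom1_0 [simp]: "pair x (pair v 0) \<in> dom1 s E U \<longleftrightarrow> x \<in> U \<and> v \<in> E"
  using mem_dom1[of x v 0 E U] by auto

section \<open>Calculus\<close>

lemma is_quotD:
  assumes "is_quot s E F U f g"
  shows "x \<in> U \<Longrightarrow> v \<in> E \<Longrightarrow> x + t *\<^sub>p v \<in> U \<Longrightarrow>
      f (x + t *\<^sub>p v) - f x = t *\<^sub>p g (pair x (pair v (spt t)))"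
    and "x \<in> U \<Longrightarrow> v \<in> E \<Longrightarrow> x + t *\<^sub>p v \<in> U \<Longrightarrow>
      f (x + t *\<^sub>p v) = f x + t *\<^sub>p g (pair x (pair v (spt t)))"
    and "continuous_on (dom1 s E U) g"
    and "z \<in> dom1 s E U \<Longrightarrow> g z \<in> F"
  using assms unfolding is_quot_def by (auto simp: algebra_simps Pi_iff)

lemma continuous_on_quot_line:
  assumes "is_quot s E F U f g" "x \<in> U" "v \<in> E"
  shows "continuous_on {t. x + t *\<^sub>p v \<in> U} (\<lambda>t. g (pair x (pair v (spt t))))"
  using assms by (intro continuous_on_compose2[OF is_quotD(3)[OF assms(1)]] cont_intros) auto

text \<open>For invertible \<open>t\<close> the defining equation can be divided by \<open>t\<close>; the remaining values are limits
  of these along the line through \<open>x\<close> in direction \<open>v\<close>.\<close>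

lemma is_quot_unique:
  assumes E: "P.subspace E" and U: "openin (top_of_set E) U"
    and g: "is_quot s E F U f g" and g': "is_quot s E F' U f g'" and z: "z \<in> dom1 s E U"
  shows "g z = g' z"
proof -
  from z obtain x v t where z: "z = pair x (pair v (spt t))" "x \<in> U" "v \<in> E" "x + t *\<^sub>p v \<in> U"
    by (rule dom1E)
  have "x \<in> E" using U z by (auto simp: openin_open)
  show ?thesis unfolding z(1)
  proof (rule agree_on_units[where N = "{t. x + t *\<^sub>p v \<in> U}" and a = "\<lambda>t. g (pair x (pair v (spt t)))"
        and b = "\<lambda>t. g' (pair x (pair v (spt t)))"])
    show "open {t. x + t *\<^sub>p v \<in> U}" by (rule open_line[OF U E \<open>x \<in> E\<close> z(3)])
    show "g (pair x (pair v (spt t))) = g' (pair x (pair v (spt t)))"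
      if "t \<in> {t. x + t *\<^sub>p v \<in> U}" "t dvd 1" for t
      using that(1) is_quotD(1)[OF g z(2,3), of t] is_quotD(1)[OF g' z(2,3), of t]
      by - (rule pscale_unit_cancel[OF that(2)], simp)
  qed (use z in \<open>auto intro: continuous_on_quot_line[OF g] continuous_on_quot_line[OF g']\<close>)
qed

lemma is_quot_cong:
  assumes "\<And>x. x \<in> U \<Longrightarrow> f x = f' x"
  shows "is_quot s E F U f = is_quot s E F U f'"
proof (rule ext)
  fix g
  show "is_quot s E F U f g = is_quot s E F U f' g"
    using assms by (auto simp: is_quot_def)
qed

lemma quot_cong:
  assumes "\<And>x. x \<in> U \<Longrightarrow> f x = f' x"
  shows "quot s E F U f = quot s E F U f'"
  using is_quot_cong[OF assms, where E = E and F = F] by (simp add: quot_def)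

lemma diff_cong:
  assumes "\<And>x. x \<in> U \<Longrightarrow> f x = f' x"
  shows "diff s E F U f = diff s E F U f'"
  using quot_cong[OF assms, where E = E and F = F] by (simp add: diff_def fun_eq_iff)

lemma is_quot_quot: "C1 s E F U f \<Longrightarrow> is_quot s E F U f (quot s E F U f)"
  unfolding C1_def quot_def by (metis someI_ex)

lemma Cn_cong:
  assumes "\<And>x. x \<in> U \<Longrightarrow> f x = f' x"
  shows "Cn s F n E U f = Cn s F n E U f'"
proof (cases n)
  case 0
  have "continuous_on U f = continuous_on U f'" using assms by (rule continuous_on_cong[OF refl])
  then show ?thesis using assms 0 by (auto simp: Pi_iff)
next
  case (Suc j)
  have "C1 s E F U f = C1 s E F U f'"
    using is_quot_cong[OF assms, where E = E and F = F] assms by (simp add: C1_def Pi_iff)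
  then show ?thesis by (simp add: Suc quot_cong[OF assms])
qed

text \<open>By uniqueness, the quotient that is chosen in the definition of \<open>C\<^sup>j\<close> may be replaced by any
  other one.\<close>

lemma Cn_SucI:
  assumes E: "P.subspace E" and U: "openin (top_of_set E) U" and f: "f \<in> U \<rightarrow> F"
    and g: "is_quot s E F U f g" and C: "Cn s F j (mod1 E) (dom1 s E U) g"
  shows "Cn s F (Suc j) E U f"
proof -
  have C1: "C1 s E F U f" using f g by (auto simp: C1_def)
  show ?thesis
    using C1 C Cn_cong[OF is_quot_unique[OF E U is_quot_quot[OF C1] g]] by simp
qed

lemma Cn_SucE:
  assumes "Cn s F (Suc j) E U f"
  obtains g where "is_quot s E F U f g" "Cn s F j (mod1 E) (dom1 s E U) g" "f \<in> U \<rightarrow> F"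
proof (rule that)
  show "is_quot s E F U f (quot s E F U f)" using assms by (intro is_quot_quot) simp
qed (use assms in \<open>auto simp: C1_def\<close>)

lemma Cn_mem: "Cn s F n E U f \<Longrightarrow> x \<in> U \<Longrightarrow> f x \<in> F"
  by (cases n) (auto simp: C1_def)

lemma Cn_1_continuous:
  assumes E: "P.subspace E" and U: "openin (top_of_set E) U" and g: "is_quot s E F U f g"
  shows "continuous_on U f"
proof (cases "U = {}")
  case False
  then obtain x where x: "x \<in> U" by blast
  have UE: "U \<subseteq> E" using U by (auto simp: openin_open)
  have sub: "y - x \<in> E" if "y \<in> U" for y using that x UE E by (meson P.subspace_diff subsetD)
  \<comment> \<open>\<open>f(y)\<close> is expressed by \<open>f\<^sup>[\<^sup>1\<^sup>]\<close> at \<open>(x, y - x, 1)\<close>, for a fixed point \<open>x\<close>.\<close>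
  have "continuous_on U (\<lambda>y. f x + 1 *\<^sub>p g (pair x (pair (y - x) (spt 1))))"
    using x sub by (intro cont_intros continuous_on_compose2[OF is_quotD(3)[OF g]]) auto
  moreover have "f x + 1 *\<^sub>p g (pair x (pair (y - x) (spt 1))) = f y" if "y \<in> U" for y
    using is_quotD(2)[OF g x sub[OF that], of 1] that by simp
  ultimately show ?thesis by (simp cong: continuous_on_cong)
qed auto

lemma Cn_Suc_imp:
  assumes "P.subspace E" "openin (top_of_set E) U" "Cn s F (Suc n) E U f"
  shows "Cn s F n E U f"
  using assms
proof (induction n arbitrary: E U f)
  case 0
  then show ?case by (elim Cn_SucE) (auto intro: Cn_1_continuous)
next
  case (Suc n)
  from Suc.prems(3) obtain g where g: "is_quot s E F U f g"
    "Cn s F (Suc n) (mod1 E) (dom1 s E U) g" "f \<in> U \<rightarrow> F"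
    by (rule Cn_SucE)
  show ?case
    by (rule Cn_SucI[OF Suc.prems(1,2) g(3,1)
        Suc.IH[OF subspace_mod1[OF Suc.prems(1)] openin_dom1[OF Suc.prems(1,2)] g(2)]])
qed

definition lin_on :: "('a, 'k) pt set \<Rightarrow> ('a, 'k) pt set \<Rightarrow> (('a, 'k) pt \<Rightarrow> ('a, 'k) pt) \<Rightarrow> bool" where
  "lin_on E F l \<longleftrightarrow> l \<in> E \<rightarrow> F \<and> (\<forall>x\<in>E. \<forall>y\<in>E. l (x + y) = l x + l y) \<and>
     (\<forall>t. \<forall>x\<in>E. l (t *\<^sub>p x) = t *\<^sub>p l x) \<and> continuous_on E l"

lemma lin_onD:
  assumes "lin_on E F l"
  shows "x \<in> E \<Longrightarrow> l x \<in> F" "x \<in> E \<Longrightarrow> y \<in> E \<Longrightarrow> l (x + y) = l x + l y"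
    "x \<in> E \<Longrightarrow> l (t *\<^sub>p x) = t *\<^sub>p l x" "continuous_on E l"
  using assms by (auto simp: lin_on_def)

lemma lin_on_mod1_dir: "P.subspace E \<Longrightarrow> lin_on E F l \<Longrightarrow> lin_on (mod1 E) F (\<lambda>z. l (lpt (rpt z)))"
  unfolding lin_on_def
  by (auto elim!: mod1E simp: lpt_add rpt_add lpt_pscale rpt_pscale
      intro!: continuous_on_compose2[of E l] cont_intros)

text \<open>\<open>l\<^sup>[\<^sup>1\<^sup>](x, v, t) = l(v)\<close> is linear again, so the induction closes.\<close>

lemma Cn_lin:
  assumes "P.subspace E" "openin (top_of_set E) U" "lin_on E F l"
  shows "Cn s F n E U l"
  using assms
proof (induction n arbitrary: E U l)
  case 0
  then show ?case using openin_imp_subset[OF 0(2)]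
    by (auto simp: lin_on_def Pi_iff intro: continuous_on_subset)
next
  case (Suc n)
  note UE = openin_imp_subset[OF Suc.prems(2)]
  have mU: "openin (top_of_set (mod1 E)) (dom1 s E U)" using Suc.prems by (intro openin_dom1)
  show ?case
  proof (rule Cn_SucI[OF Suc.prems(1,2)])
    show "l \<in> U \<rightarrow> F" using Suc.prems(3) UE by (auto simp: lin_on_def)
    show "is_quot s E F U l (\<lambda>z. l (lpt (rpt z)))"
      unfolding is_quot_def
    proof (intro conjI ballI allI impI)
      show "(\<lambda>z. l (lpt (rpt z))) \<in> dom1 s E U \<rightarrow> F"
        using Suc.prems(3) by (auto elim!: dom1E simp: lin_on_def)
      show "continuous_on (dom1 s E U) (\<lambda>z. l (lpt (rpt z)))"
        by (rule continuous_on_subset[OF lin_onD(4)[OF lin_on_mod1_dir[OF Suc.prems(1,3)]]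
              openin_imp_subset[OF mU]])
      fix x v t assume "x \<in> U" "v \<in> E"
      then have "x \<in> E" "t *\<^sub>p v \<in> E" using UE Suc.prems(1) by (auto simp: P.subspace_scale)
      then show "l (x + t *\<^sub>p v) - l x = t *\<^sub>p l (lpt (rpt (pair x (pair v (spt t)))))"
        using lin_onD(2,3)[OF Suc.prems(3)] \<open>v \<in> E\<close> by simp
    qed
    show "Cn s F n (mod1 E) (dom1 s E U) (\<lambda>z. l (lpt (rpt z)))"
      using Suc.prems by (intro Suc.IH subspace_mod1 mU lin_on_mod1_dir)
  qed
qed

lemma lin_on_pair:
  "lin_on E F f \<Longrightarrow> lin_on E F' g \<Longrightarrow> lin_on E (prd F F') (\<lambda>x. pair (f x) (g x))"
  unfolding lin_on_def by (auto simp: pair_add pscale_pair intro!: cont_intros)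

lemma lin_on_comp: "lin_on E F f \<Longrightarrow> lin_on F G g \<Longrightarrow> lin_on E G (\<lambda>x. g (f x))"
  unfolding lin_on_def by (auto intro!: continuous_on_compose2[of F g E f] simp: Pi_iff)

lemma lin_on_lpt: "lin_on (prd E F) E lpt"
  unfolding lin_on_def by (auto simp: mem_prd_iff lpt_add lpt_pscale intro!: cont_intros)

lemma lin_on_rpt: "lin_on (prd E F) F rpt"
  unfolding lin_on_def by (auto simp: mem_prd_iff rpt_add rpt_pscale intro!: cont_intros)

lemma lin_on_id: "E \<subseteq> F \<Longrightarrow> lin_on E F (\<lambda>x. x)"
  unfolding lin_on_def by (auto intro!: cont_intros)

lemma lin_on_zero: "P.subspace F \<Longrightarrow> lin_on E F (\<lambda>x. 0)"
  unfolding lin_on_def by (auto simp: P.subspace_0)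

lemma lin_on_plus: "P.subspace F \<Longrightarrow> lin_on E F f \<Longrightarrow> lin_on E F g \<Longrightarrow> lin_on E F (\<lambda>x. f x + g x)"
  unfolding lin_on_def
  by (auto simp: Pi_iff P.subspace_add algebra_simps P.scale_right_distrib intro!: cont_intros)

lemma lin_on_minus: "P.subspace F \<Longrightarrow> lin_on E F f \<Longrightarrow> lin_on E F (\<lambda>x. - f x)"
  unfolding lin_on_def
  by (auto simp: Pi_iff P.subspace_neg algebra_simps intro!: cont_intros)

text \<open>The chain rule for a linear inner map comes first: the proof of the general chain rule composes
  maps with projections of \<open>E \<times> E \<times> \<K>\<close>. With the identity as inner map it says that restrictions
  are again \<open>C\<^sup>n\<close>.\<close>

lemma Cn_comp_lin:
  assumes "P.subspace E" "P.subspace E'" "openin (top_of_set E) W" "openin (top_of_set E') U"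
    "lin_on E E' l" "\<And>x. x \<in> W \<Longrightarrow> l x \<in> U" "Cn s F n E' U f"
  shows "Cn s F n E W (\<lambda>x. f (l x))"
  using assms
proof (induction n arbitrary: E E' W U l f)
  case 0
  then show ?case using openin_imp_subset[OF 0(3)] lin_onD(4)[OF 0(5)]
    by (auto intro!: continuous_on_compose2[of U f] intro: continuous_on_subset)
next
  case (Suc n)
  note WE = openin_imp_subset[OF Suc.prems(3)]
  from Suc.prems(7) obtain g where g: "is_quot s E' F U f g"
    "Cn s F n (mod1 E') (dom1 s E' U) g" "f \<in> U \<rightarrow> F"
    by (rule Cn_SucE)
  let ?L = "\<lambda>z. pair (l (lpt z)) (pair (l (lpt (rpt z))) (rpt (rpt z)))"
  note l = lin_onD[OF Suc.prems(5)]
  have L: "lin_on (mod1 E) (mod1 E') ?L"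
    unfolding mod1_def
    by (intro lin_on_pair lin_on_comp[OF _ Suc.prems(5)] lin_on_lpt lin_on_comp[OF lin_on_rpt lin_on_lpt]
        lin_on_comp[OF lin_on_rpt lin_on_rpt])
  have W1: "openin (top_of_set (mod1 E)) (dom1 s E W)" and U1: "openin (top_of_set (mod1 E')) (dom1 s E' U)"
    using Suc.prems by (auto intro!: openin_dom1)
  have lW: "l x + t *\<^sub>p l v \<in> U" "l (x + t *\<^sub>p v) = l x + t *\<^sub>p l v"
    if "x \<in> W" "v \<in> E" "x + t *\<^sub>p v \<in> W" for x v t
  proof -
    show "l (x + t *\<^sub>p v) = l x + t *\<^sub>p l v"
      using that l(2)[of x "t *\<^sub>p v"] l(3)[of v t] WE P.subspace_scale[OF Suc.prems(1), of v t] by auto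
    then show "l x + t *\<^sub>p l v \<in> U" using Suc.prems(6)[OF that(3)] by simp
  qed
  have LW: "?L z \<in> dom1 s E' U" if "z \<in> dom1 s E W" for z
    using that lW Suc.prems(6) l by (auto elim!: dom1E)
  show ?case
  proof (rule Cn_SucI[OF Suc.prems(1,3)])
    show "(\<lambda>x. f (l x)) \<in> W \<rightarrow> F" using g(3) Suc.prems(6) by auto
    show "is_quot s E F W (\<lambda>x. f (l x)) (\<lambda>z. g (?L z))"
      unfolding is_quot_def
    proof (intro conjI ballI allI impI)
      show "(\<lambda>z. g (?L z)) \<in> dom1 s E W \<rightarrow> F" using LW is_quotD(4)[OF g(1)] by blast
      show "continuous_on (dom1 s E W) (\<lambda>z. g (?L z))"
        using LW continuous_on_subset[OF lin_onD(4)[OF L] openin_imp_subset[OF W1]]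
        by (intro continuous_on_compose2[OF is_quotD(3)[OF g(1)]]) auto
      show "f (l (x + t *\<^sub>p v)) - f (l x) = t *\<^sub>p g (?L (pair x (pair v (spt t))))"
        if "x \<in> W" "v \<in> E" "x + t *\<^sub>p v \<in> W" for x v t
        using lW[OF that] is_quotD(1)[OF g(1) Suc.prems(6)[OF that(1)] l(1)[OF that(2)]] by simp
    qed
    show "Cn s F n (mod1 E) (dom1 s E W) (\<lambda>z. g (?L z))"
      by (rule Suc.IH[OF subspace_mod1[OF Suc.prems(1)] subspace_mod1[OF Suc.prems(2)] W1 U1 L LW g(2)])
  qed
qed

lemma Cn_pair:
  assumes "P.subspace E" "openin (top_of_set E) U" "Cn s F n E U f" "Cn s F' n E U f'"
  shows "Cn s (prd F F') n E U (\<lambda>x. pair (f x) (f' x))"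
  using assms
proof (induction n arbitrary: E U f f')
  case 0
  then show ?case by (auto intro!: cont_intros)
next
  case (Suc n)
  from Suc.prems(3) obtain g where g: "is_quot s E F U f g"
    "Cn s F n (mod1 E) (dom1 s E U) g" "f \<in> U \<rightarrow> F"
    by (rule Cn_SucE)
  from Suc.prems(4) obtain g' where g': "is_quot s E F' U f' g'"
    "Cn s F' n (mod1 E) (dom1 s E U) g'" "f' \<in> U \<rightarrow> F'"
    by (rule Cn_SucE)
  have pd: "pair p q - pair p' q' = pair (p - p') (q - q')" for p q p' q' :: "('a, 'k) pt"
    by (rule ext) (simp add: pair_def minus_apply split: list.split)
  show ?case
  proof (rule Cn_SucI[OF Suc.prems(1,2)])
    show "is_quot s E (prd F F') U (\<lambda>x. pair (f x) (f' x)) (\<lambda>z. pair (g z) (g' z))"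
      using g(1) g'(1) unfolding is_quot_def
      by (auto simp: pscale_pair pd intro!: cont_intros)
    show "Cn s (prd F F') n (mod1 E) (dom1 s E U) (\<lambda>z. pair (g z) (g' z))"
      using Suc.prems(1,2) g(2) g'(2) by (intro Suc.IH subspace_mod1 openin_dom1)
  qed (use g g' in auto)
qed

text \<open>The chain rule is \<open>(f \<circ> g)\<^sup>[\<^sup>1\<^sup>](x, v, t) = f\<^sup>[\<^sup>1\<^sup>](g(x), g\<^sup>[\<^sup>1\<^sup>](x, v, t), t)\<close>, which makes
  \<open>(f \<circ> g)\<^sup>[\<^sup>1\<^sup>]\<close> again a composition of maps of one order less.\<close>

lemma Cn_comp:
  assumes "P.subspace E" "P.subspace E'" "openin (top_of_set E) W" "openin (top_of_set E') U"
    "Cn s E' n E W g" "\<And>x. x \<in> W \<Longrightarrow> g x \<in> U" "Cn s F n E' U f"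
  shows "Cn s F n E W (\<lambda>x. f (g x))"
  using assms
proof (induction n arbitrary: E E' W U g f)
  case 0
  then show ?case by (auto intro!: continuous_on_compose2[of U f])
next
  case (Suc n)
  note WE = openin_imp_subset[OF Suc.prems(3)]
  from Suc.prems(7) obtain q where q: "is_quot s E' F U f q"
    "Cn s F n (mod1 E') (dom1 s E' U) q" "f \<in> U \<rightarrow> F"
    by (rule Cn_SucE)
  from Suc.prems(5) obtain r where r: "is_quot s E E' W g r"
    "Cn s E' n (mod1 E) (dom1 s E W) r" "g \<in> W \<rightarrow> E'"
    by (rule Cn_SucE)
  let ?L = "\<lambda>z. pair (g (lpt z)) (pair (r z) (rpt (rpt z)))"
  have W1: "openin (top_of_set (mod1 E)) (dom1 s E W)" and U1: "openin (top_of_set (mod1 E')) (dom1 s E' U)"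
    using Suc.prems by (auto intro!: openin_dom1)
  have gC: "Cn s E' n E W g" by (rule Cn_Suc_imp[OF Suc.prems(1,3,5)])
  have r1: "lin_on (mod1 E) E lpt" "lin_on (mod1 E) (range spt) (\<lambda>z. rpt (rpt z))"
    unfolding mod1_def by (intro lin_on_lpt lin_on_comp[OF lin_on_rpt lin_on_rpt])+
  have L: "Cn s (mod1 E') n (mod1 E) (dom1 s E W) ?L"
    unfolding mod1_def[of E']
  proof (rule Cn_pair[OF subspace_mod1[OF Suc.prems(1)] W1 _
        Cn_pair[OF subspace_mod1[OF Suc.prems(1)] W1 r(2)]])
    show "Cn s E' n (mod1 E) (dom1 s E W) (\<lambda>z. g (lpt z))"
      by (rule Cn_comp_lin[OF subspace_mod1[OF Suc.prems(1)] Suc.prems(1) W1 Suc.prems(3) r1(1) _ gC])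
        (auto elim: dom1E)
    show "Cn s (range spt) n (mod1 E) (dom1 s E W) (\<lambda>z. rpt (rpt z))"
      by (rule Cn_lin[OF subspace_mod1[OF Suc.prems(1)] W1 r1(2)])
  qed
  have LW: "?L z \<in> dom1 s E' U" if "z \<in> dom1 s E W" for z
    using that Suc.prems(6) is_quotD(4)[OF r(1) that] is_quotD(2)[OF r(1)]
    by (auto elim!: dom1E simp flip: is_quotD(2)[OF r(1)])
  show ?case
  proof (rule Cn_SucI[OF Suc.prems(1,3)])
    show "(\<lambda>x. f (g x)) \<in> W \<rightarrow> F" using q(3) Suc.prems(6) by auto
    have Lc: "continuous_on (dom1 s E W) ?L"
    proof (intro cont_intros continuous_on_compose2[OF Cn_1_continuous[OF Suc.prems(1,3) r(1)]])
      show "continuous_on (dom1 s E W) r" by (rule is_quotD(3)[OF r(1)])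
    qed (auto elim: dom1E)
    show "is_quot s E F W (\<lambda>x. f (g x)) (\<lambda>z. q (?L z))"
      unfolding is_quot_def
    proof (intro conjI ballI allI impI)
      show "(\<lambda>z. q (?L z)) \<in> dom1 s E W \<rightarrow> F" using LW is_quotD(4)[OF q(1)] by blast
      show "continuous_on (dom1 s E W) (\<lambda>z. q (?L z))"
        using LW Lc by (intro continuous_on_compose2[OF is_quotD(3)[OF q(1)]]) auto
      show "f (g (x + t *\<^sub>p v)) - f (g x) = t *\<^sub>p q (?L (pair x (pair v (spt t))))"
        if "x \<in> W" "v \<in> E" "x + t *\<^sub>p v \<in> W" for x v t
        using LW[of "pair x (pair v (spt t))"] that
        by (simp add: is_quotD(2)[OF r(1)] is_quotD(1)[OF q(1)])
    qed
    show "Cn s F n (mod1 E) (dom1 s E W) (\<lambda>z. q (?L z))"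
      by (rule Suc.IH[OF subspace_mod1[OF Suc.prems(1)] subspace_mod1[OF Suc.prems(2)] W1 U1 L LW q(2)])
  qed
qed

lemma lin_on_sum2: "P.subspace E \<Longrightarrow> lin_on (prd E E) E (\<lambda>z. lpt z + rpt z)"
  by (intro lin_on_plus lin_on_lpt lin_on_rpt)

lemma Cn_add:
  assumes "P.subspace E" "P.subspace F" "openin (top_of_set E) U" "Cn s F n E U f" "Cn s F n E U g"
  shows "Cn s F n E U (\<lambda>x. f x + g x)"
proof -
  have FF: "P.subspace (prd F F)" by (intro subspace_prd assms(2))
  have "Cn s F n E U (\<lambda>x. (\<lambda>z. lpt z + rpt z) (pair (f x) (g x)))"
    using Cn_mem[OF assms(4)] Cn_mem[OF assms(5)]
    by (intro Cn_comp[OF assms(1) FF assms(3) _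
          Cn_pair[OF assms(1,3,4,5)] _ Cn_lin[OF FF _ lin_on_sum2[OF assms(2)]], where U = "prd F F"]) auto
  then show ?thesis by simp
qed

lemma Cn_minus:
  assumes "P.subspace E" "P.subspace F" "openin (top_of_set E) U" "Cn s F n E U f"
  shows "Cn s F n E U (\<lambda>x. - f x)"
  using Cn_mem[OF assms(4)]
  by (intro Cn_comp[OF assms(1,2,3) _ assms(4) _ Cn_lin[OF assms(2) _ lin_on_minus[OF assms(2) lin_on_id]],
        where U = F]) auto

text \<open>For the scalar multiplication \<open>m(t, p) = tp\<close> one has
  \<open>m\<^sup>[\<^sup>1\<^sup>]((t, p), (u, q), r) = tq + up + r(uq)\<close>, a combination of linear maps and of \<open>m\<close> itself.\<close>

lemma Cn_scale:
  assumes E: "P.subspace E"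
  shows "Cn s E n (prd (range spt) E) (prd (range spt) E) (\<lambda>z. sval (lpt z) *\<^sub>p rpt z)"
    (is "Cn s E n ?S ?S ?m")
proof (induction n)
  case 0
  show ?case using E
    by (auto simp: mem_prd_iff P.subspace_scale intro!: cont_intros)
next
  case (Suc n)
  have S: "P.subspace ?S" by (intro subspace_prd subspace_spt E)
  have dom: "dom1 s ?S ?S = mod1 ?S"
    using S by (auto elim!: mod1E dom1E simp: P.subspace_add P.subspace_scale simp del: pair_mem_prd)
  let ?a = "\<lambda>z. pair (lpt (lpt z)) (rpt (lpt (rpt z)))"
  let ?b = "\<lambda>z. pair (lpt (lpt (rpt z))) (rpt (lpt z))"
  let ?c = "\<lambda>z. pair (lpt (lpt (rpt z))) (rpt (lpt (rpt z)))"
  let ?r = "\<lambda>z. rpt (rpt z)"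
  let ?g = "\<lambda>z. (?m (?a z) + ?m (?b z)) + ?m (pair (?r z) (?m (?c z)))"
  note rl = lin_on_comp[OF lin_on_rpt lin_on_lpt]
  have l: "lin_on (mod1 ?S) ?S ?a" "lin_on (mod1 ?S) ?S ?b" "lin_on (mod1 ?S) ?S ?c"
    "lin_on (mod1 ?S) (range spt) ?r"
    unfolding mod1_def
    by (rule lin_on_pair lin_on_comp[OF lin_on_lpt lin_on_lpt] lin_on_comp[OF rl lin_on_rpt]
        lin_on_comp[OF rl lin_on_lpt] lin_on_comp[OF lin_on_lpt lin_on_rpt]
        lin_on_comp[OF lin_on_rpt lin_on_rpt])+
  have M: "P.subspace (mod1 ?S)" by (intro subspace_mod1 S)
  have Cm: "Cn s E n (mod1 ?S) (mod1 ?S) (\<lambda>z. ?m (l z))" if "Cn s ?S n (mod1 ?S) (mod1 ?S) l" for l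
    by (rule Cn_comp[where f = ?m and g = l and U = ?S, OF M S _ _ that])
      (use Suc.IH Cn_mem[OF that] in auto)
  have "Cn s E n (mod1 ?S) (mod1 ?S) ?g"
    using l M by (intro Cn_add[OF M E] Cm Cn_pair Cn_lin) auto
  moreover have "is_quot s ?S E ?S ?m ?g"
    unfolding is_quot_def dom
  proof (intro conjI ballI allI impI)
    show "?g \<in> mod1 ?S \<rightarrow> E"
      by (auto elim!: mod1E simp: mem_prd_iff intro!: P.subspace_add[OF E] P.subspace_scale[OF E])
    show "continuous_on (mod1 ?S) ?g" by (intro cont_intros)
    show "?m (x + t *\<^sub>p v) - ?m x = t *\<^sub>p ?g (pair x (pair v (spt t)))"
      if "x \<in> ?S" "v \<in> ?S" "x + t *\<^sub>p v \<in> ?S" for x v t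
      using that
      by (auto elim!: prdE simp: pair_add pscale_pair pscale_spt spt_add P.scale_left_distrib
          P.scale_right_distrib algebra_simps)
  qed
  ultimately show ?case
    using S E by (intro Cn_SucI[where g = ?g]) (auto simp: dom mem_prd_iff P.subspace_scale)
qed

lemma smooth_openin: "smooth s E F U f \<Longrightarrow> openin (top_of_set E) U"
  by (simp add: smooth_def)

lemma smooth_mem: "smooth s E F U f \<Longrightarrow> x \<in> U \<Longrightarrow> f x \<in> F"
  unfolding smooth_def using Cn_mem by blast

lemma smooth_continuous: "smooth s E F U f \<Longrightarrow> continuous_on U f"
  unfolding smooth_def by (metis Cn.simps(1))

lemma smooth_C1: "smooth s E F U f \<Longrightarrow> C1 s E F U f"
  unfolding smooth_def by (metis Cn.simps(2))

lemma smooth_cong: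
  "\<lbrakk>\<And>x. x \<in> U \<Longrightarrow> f x = f' x\<rbrakk> \<Longrightarrow> smooth s E F U f = smooth s E F U f'"
  using Cn_cong[of U f f'] by (auto simp: smooth_def)

lemma smooth_lin:
  "P.subspace E \<Longrightarrow> openin (top_of_set E) U \<Longrightarrow> lin_on E F l \<Longrightarrow> smooth s E F U l"
  by (simp add: smooth_def Cn_lin)

lemma smooth_pair:
  "P.subspace E \<Longrightarrow> smooth s E F U f \<Longrightarrow> smooth s E F' U g \<Longrightarrow>
    smooth s E (prd F F') U (\<lambda>x. pair (f x) (g x))"
  by (simp add: smooth_def Cn_pair)

lemma smooth_comp:
  assumes "P.subspace E" "P.subspace E'" "smooth s E E' W g" "\<And>x. x \<in> W \<Longrightarrow> g x \<in> U"
    "smooth s E' F U f"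
  shows "smooth s E F W (\<lambda>x. f (g x))"
  using assms by (auto simp: smooth_def intro: Cn_comp)

lemma smooth_comp_lin:
  assumes "P.subspace E" "P.subspace E'" "openin (top_of_set E) W" "lin_on E E' l"
    "\<And>x. x \<in> W \<Longrightarrow> l x \<in> U" "smooth s E' F U f"
  shows "smooth s E F W (\<lambda>x. f (l x))"
  by (rule smooth_comp[OF assms(1,2) smooth_lin[OF assms(1,3,4)] assms(5,6)])

lemma smooth_restrict:
  assumes "P.subspace E" "openin (top_of_set E) W" "W \<subseteq> U" "smooth s E F U f"
  shows "smooth s E F W f"
  by (rule smooth_comp_lin[OF assms(1,1,2) lin_on_id[OF order_refl] subsetD[OF assms(3)] assms(4)])

lemma smooth_add:
  assumes "P.subspace E" "P.subspace F" "smooth s E F U f" "smooth s E F U g"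
  shows "smooth s E F U (\<lambda>x. f x + g x)"
  using assms by (simp add: smooth_def Cn_add)

lemma smooth_minus:
  assumes "P.subspace E" "P.subspace F" "smooth s E F U f"
  shows "smooth s E F U (\<lambda>x. - f x)"
  using assms by (simp add: smooth_def Cn_minus)

lemma smooth_sum:
  assumes "P.subspace E" "P.subspace F" "openin (top_of_set E) U" "\<And>a. a \<in> A \<Longrightarrow> smooth s E F U (f a)"
  shows "smooth s E F U (\<lambda>x. \<Sum>a\<in>A. f a x)"
  using assms(4)
proof (induction A rule: infinite_finite_induct)
  case (insert a A)
  then show ?case using assms(1,2) by (simp add: smooth_add)
qed (use assms in \<open>simp_all add: smooth_lin lin_on_zero\<close>)

lemma smooth_scale:
  assumes "P.subspace E"
  shows "smooth s (prd (range spt) E) E (prd (range spt) E) (\<lambda>z. sval (lpt z) *\<^sub>p rpt z)"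
  using assms by (simp add: smooth_def Cn_scale)

text \<open>\<open>df(x)v\<close> is the limit of the difference quotient along the line through \<open>x\<close>: any continuous
  quotient on a neighbourhood of \<open>0\<close> determines it.\<close>

lemma diff_eqI:
  assumes E: "P.subspace E" and U: "openin (top_of_set E) U" and f: "C1 s E F U f"
    and x: "x \<in> U" and v: "v \<in> E" and N: "open N" "0 \<in> N" "continuous_on N h"
    and h: "\<And>t. t \<in> N \<Longrightarrow> x + t *\<^sub>p v \<in> U \<and> f (x + t *\<^sub>p v) - f x = t *\<^sub>p h t"
  shows "diff s E F U f x v = h 0"
  unfolding diff_def
proof (rule agree_on_units[where N = N])
  note q = is_quot_quot[OF f]
  show "continuous_on N (\<lambda>t. quot s E F U f (pair x (pair v (spt t))))"
    using h by (intro continuous_on_subset[OF continuous_on_quot_line[OF q x v]]) auto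
  show "quot s E F U f (pair x (pair v (spt t))) = h t" if "t \<in> N" "t dvd 1" for t
    using h[OF that(1)] is_quotD(1)[OF q x v, of t]
    by - (rule pscale_unit_cancel[OF that(2)], auto)
qed (use N in auto)

lemma diff_mem:
  assumes "C1 s E F U f" "x \<in> U" "v \<in> E"
  shows "diff s E F U f x v \<in> F"
  unfolding diff_def using assms by (intro is_quotD(4)[OF is_quot_quot]) auto

text \<open>A continuous quotient in direction \<open>rv\<close> is \<open>r f\<^sup>[\<^sup>1\<^sup>](x, v, tr)\<close>.\<close>

lemma diff_scale:
  assumes E: "P.subspace E" and U: "openin (top_of_set E) U" and f: "C1 s E F U f"
    and x: "x \<in> U" and v: "v \<in> E"
  shows "diff s E F U f x (r *\<^sub>p v) = r *\<^sub>p diff s E F U f x v"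
proof -
  note q = is_quot_quot[OF f]
  let ?q = "quot s E F U f"
  have xE: "x \<in> E" using x openin_imp_subset[OF U] by blast
  have rv: "r *\<^sub>p v \<in> E" by (rule P.subspace_scale[OF E v])
  let ?N = "{t. x + t *\<^sub>p (r *\<^sub>p v) \<in> U}"
  have "diff s E F U f x (r *\<^sub>p v) = r *\<^sub>p ?q (pair x (pair v (spt (0 * r))))"
  proof (rule diff_eqI[OF E U f x rv, where N = ?N])
    show "open ?N" by (rule open_line[OF U E xE rv])
    show "continuous_on ?N (\<lambda>t. r *\<^sub>p ?q (pair x (pair v (spt (t * r)))))"
      using x v
      by (intro cont_intros continuous_on_mult' continuous_on_compose2[OF is_quotD(3)[OF q]])
        auto
  qed (use x v is_quotD(1)[OF q x v] in \<open>auto simp: mult.commute\<close>)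
  then show ?thesis by (simp add: diff_def)
qed

text \<open>The difference of \<open>f\<close> in direction \<open>v + w\<close> is split at the intermediate point \<open>x + tv\<close>, which
  gives the quotient \<open>f\<^sup>[\<^sup>1\<^sup>](x, v, t) + f\<^sup>[\<^sup>1\<^sup>](x + tv, w, t)\<close>.\<close>

lemma diff_add:
  assumes E: "P.subspace E" and U: "openin (top_of_set E) U" and f: "C1 s E F U f"
    and x: "x \<in> U" and v: "v \<in> E" and w: "w \<in> E"
  shows "diff s E F U f x (v + w) = diff s E F U f x v + diff s E F U f x w"
proof -
  note q = is_quot_quot[OF f]
  let ?q = "quot s E F U f"
  have xE: "x \<in> E" using x openin_imp_subset[OF U] by blast
  have vw: "v + w \<in> E" by (rule P.subspace_add[OF E v w])
  let ?N = "{t. x + t *\<^sub>p v \<in> U} \<inter> {t. x + t *\<^sub>p (v + w) \<in> U}"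
  have "diff s E F U f x (v + w)
      = ?q (pair x (pair v (spt 0))) + ?q (pair (x + 0 *\<^sub>p v) (pair w (spt 0)))"
  proof (rule diff_eqI[OF E U f x vw, where N = ?N])
    show "open ?N" by (intro open_Int open_line[OF U E xE] v vw)
    show "continuous_on ?N
        (\<lambda>t. ?q (pair x (pair v (spt t))) + ?q (pair (x + t *\<^sub>p v) (pair w (spt t))))"
      using x v w
      by (intro cont_intros continuous_on_compose2[OF is_quotD(3)[OF q]])
        (auto simp: P.scale_right_distrib add.assoc)
    show "x + t *\<^sub>p (v + w) \<in> U \<and> f (x + t *\<^sub>p (v + w)) - f x =
        t *\<^sub>p (?q (pair x (pair v (spt t))) + ?q (pair (x + t *\<^sub>p v) (pair w (spt t))))"
      if "t \<in> ?N" for t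
    proof -
      have "f (x + t *\<^sub>p v + t *\<^sub>p w) - f (x + t *\<^sub>p v) = t *\<^sub>p ?q (pair (x + t *\<^sub>p v) (pair w (spt t)))"
        using that by (intro is_quotD(1)[OF q _ w]) (auto simp: P.scale_right_distrib add.assoc)
      with is_quotD(1)[OF q x v, of t] that show ?thesis
        by (auto simp: P.scale_right_distrib algebra_simps)
    qed
  qed (use x in auto)
  then show ?thesis by (simp add: diff_def)
qed

lemma diff_zero:
  assumes "P.subspace E" "openin (top_of_set E) U" "C1 s E F U f" "x \<in> U"
  shows "diff s E F U f x 0 = 0"
  using diff_scale[OF assms, of 0 0] P.subspace_0[OF assms(1)] by simp

lemma diff_ident:
  assumes E: "P.subspace E" and U: "openin (top_of_set E) U" and x: "x \<in> U" and v: "v \<in> E"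
    and f: "C1 s E F U f" "\<And>y. y \<in> U \<Longrightarrow> f y = y"
  shows "diff s E F U f x v = v"
proof (rule diff_eqI[OF E U f(1) x v, where N = "{t. x + t *\<^sub>p v \<in> U}"])
  show "open {t. x + t *\<^sub>p v \<in> U}"
    using x openin_imp_subset[OF U] by (intro open_line[OF U E _ v]) auto
qed (use x v f(2) in auto)

lemma diff_comp:
  assumes E: "P.subspace E" and E': "P.subspace E'" and g: "C1 s E E' W g" and f: "C1 s E' F U f"
    and W: "openin (top_of_set E) W" and U: "openin (top_of_set E') U"
    and gW: "\<And>x. x \<in> W \<Longrightarrow> g x \<in> U" and fg: "C1 s E F W (\<lambda>x. f (g x))"
    and x: "x \<in> W" and v: "v \<in> E"
  shows "diff s E F W (\<lambda>x. f (g x)) x v = diff s E' F U f (g x) (diff s E E' W g x v)"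
proof -
  note q = is_quot_quot[OF f] and r = is_quot_quot[OF g]
  let ?q = "quot s E' F U f" and ?r = "quot s E E' W g"
  have xE: "x \<in> E" using x openin_imp_subset[OF W] by blast
  let ?N = "{t. x + t *\<^sub>p v \<in> W}"
  let ?z = "\<lambda>t. pair (g x) (pair (?r (pair x (pair v (spt t)))) (spt t))"
  have z: "?z t \<in> dom1 s E' U" if "t \<in> ?N" for t
    using that x v gW is_quotD(4)[OF r] by (auto simp flip: is_quotD(2)[OF r])
  have "diff s E F W (\<lambda>x. f (g x)) x v = ?q (?z 0)"
  proof (rule diff_eqI[OF E W fg x v, where N = ?N])
    show "open ?N" by (rule open_line[OF W E xE v])
    show "continuous_on ?N (\<lambda>t. ?q (?z t))"
      using z by (intro cont_intros continuous_on_compose2[OF is_quotD(3)[OF q]]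
          continuous_on_quot_line[OF r x v]) auto
    show "x + t *\<^sub>p v \<in> W \<and> f (g (x + t *\<^sub>p v)) - f (g x) = t *\<^sub>p ?q (?z t)" if "t \<in> ?N" for t
      using that z[OF that] x v by (simp add: is_quotD(2)[OF r] is_quotD(1)[OF q])
  qed (use x in auto)
  then show ?thesis by (simp add: diff_def)
qed

text \<open>The tangent map is \<open>(x, v) \<mapsto> (f(x), f\<^sup>[\<^sup>1\<^sup>](x, v, 0))\<close>, hence smooth if \<open>f\<close> is.\<close>

lemma smooth_tangent:
  assumes E: "P.subspace E" and F: "P.subspace F" and f: "smooth s E F U f"
  shows "smooth s (prd E E) (prd F F) (prd U E)
    (\<lambda>z. pair (f (lpt z)) (diff s E F U f (lpt z) (rpt z)))"
proof -
  have EE: "P.subspace (prd E E)" by (intro subspace_prd E)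
  note U = smooth_openin[OF f]
  have UE: "openin (top_of_set (prd E E)) (prd U E)" by (intro openin_prd U) auto
  have q: "smooth s (mod1 E) F (dom1 s E U) (quot s E F U f)"
    using f openin_dom1[OF E U] unfolding smooth_def by (metis Cn.simps(2))
  have l: "lin_on (prd E E) (mod1 E) (\<lambda>z. pair (lpt z) (pair (rpt z) (spt 0)))"
    unfolding mod1_def
    using P.subspace_0[OF subspace_spt]
    by (intro lin_on_pair lin_on_lpt lin_on_rpt) (auto simp: lin_on_def)
  have "smooth s (prd E E) F (prd U E) (\<lambda>z. diff s E F U f (lpt z) (rpt z))"
    unfolding diff_def
    by (rule smooth_comp_lin[OF EE subspace_mod1[OF E] UE l _ q]) (auto elim!: prdE)
  moreover have "smooth s (prd E E) F (prd U E) (\<lambda>z. f (lpt z))"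
    using f by (intro smooth_comp_lin[OF EE E UE lin_on_lpt]) (auto elim!: prdE)
  ultimately show ?thesis by (intro smooth_pair EE)
qed

end

section \<open>Manifolds and their smooth maps\<close>

text \<open>Injectivity of the charts is what makes the intersection of two open sets open.\<close>

lemma istopology_atlas:
  assumes inj: "\<And>i. i \<in> I \<Longrightarrow> inj_on (c i) (D i)"
  shows "istopology (\<lambda>A. A \<subseteq> (\<Union>i\<in>I. D i) \<and> (\<forall>i\<in>I. openin (top_of_set E) (c i ` (A \<inter> D i))))"
  unfolding istopology_def
proof (rule conjI; intro allI impI)
  fix S T
  assume S: "S \<subseteq> (\<Union>i\<in>I. D i) \<and> (\<forall>i\<in>I. openin (top_of_set E) (c i ` (S \<inter> D i)))"
    and T: "T \<subseteq> (\<Union>i\<in>I. D i) \<and> (\<forall>i\<in>I. openin (top_of_set E) (c i ` (T \<inter> D i)))"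
  have "openin (top_of_set E) (c i ` (S \<inter> T \<inter> D i))" if i: "i \<in> I" for i
  proof -
    have "c i ` (S \<inter> T \<inter> D i) = c i ` ((S \<inter> D i) \<inter> (T \<inter> D i))" by (rule arg_cong[of _ _ "image (c i)"]) blast
    also have "\<dots> = c i ` (S \<inter> D i) \<inter> c i ` (T \<inter> D i)"
      by (rule inj_on_image_Int[OF inj[OF i]]) auto
    finally show ?thesis using S T i by (simp add: openin_Int)
  qed
  then show "S \<inter> T \<subseteq> (\<Union>i\<in>I. D i) \<and> (\<forall>i\<in>I. openin (top_of_set E) (c i ` (S \<inter> T \<inter> D i)))"
    using S by blast
next
  fix K
  assume K: "\<forall>A\<in>K. A \<subseteq> (\<Union>i\<in>I. D i) \<and> (\<forall>i\<in>I. openin (top_of_set E) (c i ` (A \<inter> D i)))"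
  have "openin (top_of_set E) (c i ` (\<Union>K \<inter> D i))" if i: "i \<in> I" for i
  proof -
    have "c i ` (\<Union>K \<inter> D i) = (\<Union>A\<in>K. c i ` (A \<inter> D i))" by blast
    then show ?thesis using K i by (auto intro!: openin_Union)
  qed
  then show "\<Union>K \<subseteq> (\<Union>i\<in>I. D i) \<and> (\<forall>i\<in>I. openin (top_of_set E) (c i ` (\<Union>K \<inter> D i)))"
    using K by blast
qed

lemma openin_atlas_topology:
  assumes "\<And>i. i \<in> I \<Longrightarrow> inj_on (c i) (D i)"
  shows "openin (atlas_topology I D c E) A \<longleftrightarrow>
    A \<subseteq> (\<Union>i\<in>I. D i) \<and> (\<forall>i\<in>I. openin (top_of_set E) (c i ` (A \<inter> D i)))"
  unfolding atlas_topology_def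
  by (subst topology_inverse'[OF istopology_atlas[where I = I and c = c and D = D and E = E, OF assms]])
    simp_all

lemma atlas_topology_props:
  assumes inj: "\<And>i. i \<in> I \<Longrightarrow> inj_on (c i) (D i)"
    and ov: "\<And>i j. i \<in> I \<Longrightarrow> j \<in> I \<Longrightarrow> openin (top_of_set E) (c i ` (D i \<inter> D j))"
  shows "i \<in> I \<Longrightarrow> openin (atlas_topology I D c E) (D i)"
    and "topspace (atlas_topology I D c E) = (\<Union>i\<in>I. D i)"
proof -
  have oat: "openin (atlas_topology I D c E) A \<longleftrightarrow>
    A \<subseteq> (\<Union>i\<in>I. D i) \<and> (\<forall>i\<in>I. openin (top_of_set E) (c i ` (A \<inter> D i)))" for A
    by (rule openin_atlas_topology[OF inj])
  have *: "openin (atlas_topology I D c E) (D i)" if "i \<in> I" for i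
    unfolding oat
  proof (intro conjI ballI)
    show "openin (top_of_set E) (c j ` (D i \<inter> D j))" if "j \<in> I" for j
      using ov[OF that \<open>i \<in> I\<close>] by (simp only: Int_commute[of "D i"])
  qed (use that in blast)
  show "i \<in> I \<Longrightarrow> openin (atlas_topology I D c E) (D i)" by (rule *)
  have "openin (atlas_topology I D c E) (\<Union>i\<in>I. D i)" using * by blast
  moreover have "topspace (atlas_topology I D c E) \<subseteq> (\<Union>i\<in>I. D i)"
    using openin_topspace[of "atlas_topology I D c E"] unfolding oat by blast
  ultimately show "topspace (atlas_topology I D c E) = (\<Union>i\<in>I. D i)"
    using openin_subset by blast
qed

context base_module begin

lemma smooth_eq: "smooth s E F U f \<Longrightarrow> (\<And>x. x \<in> U \<Longrightarrow> f x = f' x) \<Longrightarrow> smooth s E F U f'"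
  using smooth_cong[of U f f'] by blast

text \<open>An atlas of bijective charts with open overlaps and smooth transition maps makes its union
  a manifold: continuity of the transition maps turns the charts into homeomorphisms.\<close>

lemma manifold_atlas:
  assumes inj: "\<And>i. i \<in> I \<Longrightarrow> inj_on (c i) (D i)"
    and ov: "\<And>i j. i \<in> I \<Longrightarrow> j \<in> I \<Longrightarrow> openin (top_of_set E) (c i ` (D i \<inter> D j))"
    and tr: "\<And>i j. i \<in> I \<Longrightarrow> j \<in> I \<Longrightarrow>
      smooth s E E (c i ` (D i \<inter> D j)) (\<lambda>z. c j (inv_into (D i) (c i) z))"
    and M: "M = \<lparr>mtop = atlas_topology I D c E, ind = I, cdom = D, chart = c, model = E\<rparr>"
  shows "manifold s M" "pts M = (\<Union>i\<in>I. D i)"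
proof -
  let ?T = "atlas_topology I D c E"
  have oat: "openin ?T A \<longleftrightarrow>
    A \<subseteq> (\<Union>i\<in>I. D i) \<and> (\<forall>i\<in>I. openin (top_of_set E) (c i ` (A \<inter> D i)))" for A
    by (rule openin_atlas_topology[OF inj])
  have top: "topspace ?T = (\<Union>i\<in>I. D i)" by (rule atlas_topology_props(2)[OF inj ov])
  have op: "openin ?T (D i)" if "i \<in> I" for i by (rule atlas_topology_props(1)[OF inj ov that])
  have im: "openin (top_of_set E) (c i ` D i)" if "i \<in> I" for i using ov[OF that that] by simp
  have homeo: "homeomorphic_map (subtopology ?T (D i)) (top_of_set (c i ` D i)) (c i)"
    if i: "i \<in> I" for i
  proof (rule bijective_open_imp_homeomorphic_map)
    have ts: "topspace (subtopology ?T (D i)) = D i" using i by (auto simp: top)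
    show "c i ` topspace (subtopology ?T (D i)) = topspace (top_of_set (c i ` D i))"
      unfolding ts by simp
    show "inj_on (c i) (topspace (subtopology ?T (D i)))" unfolding ts by (rule inj[OF i])
    show "open_map (subtopology ?T (D i)) (top_of_set (c i ` D i)) (c i)"
      unfolding open_map_def
    proof (intro allI impI)
      fix U assume "openin (subtopology ?T (D i)) U"
      then have U: "openin ?T U" "U \<subseteq> D i" using openin_open_subtopology[OF op[OF i]] by auto
      then have "openin (top_of_set E) (c i ` (U \<inter> D i))"
        using i unfolding oat by blast
      then have "openin (top_of_set E) (c i ` U)" using U(2) by (simp add: Int_absorb2)
      then show "openin (top_of_set (c i ` D i)) (c i ` U)"
        by (rule openin_subset_trans[OF _ image_mono[OF U(2)] openin_imp_subset[OF im[OF i]]])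
    qed
    show "continuous_map (subtopology ?T (D i)) (top_of_set (c i ` D i)) (c i)"
      unfolding continuous_map_def ts
    proof (intro conjI allI impI)
      show "c i \<in> D i \<rightarrow> topspace (top_of_set (c i ` D i))" by auto
      fix V assume "openin (top_of_set (c i ` D i)) V"
      then have V: "openin (top_of_set E) V" "V \<subseteq> c i ` D i"
        using im[OF i] openin_trans openin_imp_subset by blast+
      have "openin ?T {x \<in> D i. c i x \<in> V}"
        unfolding oat
      proof (intro conjI ballI)
        fix j assume j: "j \<in> I"
        have inv: "inv_into (D j) (c j) (c j p) = p" if "p \<in> D j" for p
          by (rule inv_into_f_f[OF inj[OF j] that])
        have cont: "continuous_on (c j ` (D j \<inter> D i)) (\<lambda>z. c i (inv_into (D j) (c j) z))"
          by (rule smooth_continuous[OF tr[OF j i]])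
        have eq: "c j ` ({x \<in> D i. c i x \<in> V} \<inter> D j)
            = c j ` (D j \<inter> D i) \<inter> (\<lambda>z. c i (inv_into (D j) (c j) z)) -` V"
          by (auto simp: inv)
        have "openin (top_of_set (c j ` (D j \<inter> D i)))
            (c j ` (D j \<inter> D i) \<inter> (\<lambda>z. c i (inv_into (D j) (c j) z)) -` V)"
          by (rule continuous_openin_preimage[OF cont _ V(1)])
            (use smooth_mem[OF tr[OF j i]] in auto)
        then show "openin (top_of_set E) (c j ` ({x \<in> D i. c i x \<in> V} \<inter> D j))"
          unfolding eq by (rule openin_trans[OF _ ov[OF j i]])
      qed (use i in auto)
      then show "openin (subtopology ?T (D i)) {x \<in> D i. c i x \<in> V}"
        using openin_open_subtopology[OF op[OF i]] by auto
    qed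
  qed
  show "manifold s M"
    unfolding manifold_def M overlap_def transition_def cinv_def comp_def
    using top op im homeo tr by auto
  show "pts M = (\<Union>i\<in>I. D i)" unfolding M using top by simp
qed

lemma manifoldD:
  assumes M: "manifold s M" and i: "i \<in> ind M"
  shows manifold_inj: "inj_on (chart M i) (cdom M i)"
    and manifold_openin_cdom: "openin (mtop M) (cdom M i)"
    and manifold_cdom_subset: "cdom M i \<subseteq> pts M"
    and manifold_openin_image: "openin (top_of_set (model M)) (chart M i ` cdom M i)"
    and manifold_chart_continuous:
      "continuous_map (subtopology (mtop M) (cdom M i)) (top_of_set (model M)) (chart M i)"
    and manifold_cinv_continuous:
      "continuous_map (top_of_set (chart M i ` cdom M i)) (mtop M) (cinv M i)"
proof -
  have hm: "homeomorphic_map (subtopology (mtop M) (cdom M i)) (top_of_set (chart M i ` cdom M i)) (chart M i)"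
    and op: "openin (mtop M) (cdom M i)"
    and im: "openin (top_of_set (model M)) (chart M i ` cdom M i)"
    using M i unfolding manifold_def by blast+
  show "openin (mtop M) (cdom M i)" "openin (top_of_set (model M)) (chart M i ` cdom M i)"
    by (rule op im)+
  show sub: "cdom M i \<subseteq> pts M" using op by (rule openin_subset)
  have ts: "topspace (subtopology (mtop M) (cdom M i)) = cdom M i" using sub by auto
  show inj: "inj_on (chart M i) (cdom M i)"
    using homeomorphic_imp_injective_map[OF hm] unfolding ts .
  have "continuous_map (subtopology (mtop M) (cdom M i)) (top_of_set (chart M i ` cdom M i)) (chart M i)"
    by (rule homeomorphic_imp_continuous_map[OF hm])
  then show "continuous_map (subtopology (mtop M) (cdom M i)) (top_of_set (model M)) (chart M i)"
    using openin_imp_subset[OF im] by (auto simp: continuous_map_in_subtopology)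
  obtain g where g: "homeomorphic_maps (subtopology (mtop M) (cdom M i))
      (top_of_set (chart M i ` cdom M i)) (chart M i) g"
    using hm homeomorphic_map_maps by blast
  then have gc: "continuous_map (top_of_set (chart M i ` cdom M i)) (mtop M) g"
    and gi: "\<And>p. p \<in> cdom M i \<Longrightarrow> g (chart M i p) = p"
    unfolding homeomorphic_maps_def ts by (auto simp: continuous_map_in_subtopology)
  have "g z = cinv M i z" if "z \<in> chart M i ` cdom M i" for z
    using that gi inj by (auto simp: cinv_def)
  then show "continuous_map (top_of_set (chart M i ` cdom M i)) (mtop M) (cinv M i)"
    by (intro continuous_map_eq[OF gc]) auto
qed

lemma manifold_cover: "manifold s M \<Longrightarrow> (\<Union>i\<in>ind M. cdom M i) = pts M"
  unfolding manifold_def by blast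

lemma manifold_transition_smooth:
  "manifold s M \<Longrightarrow> i \<in> ind M \<Longrightarrow> j \<in> ind M \<Longrightarrow>
    smooth s (model M) (model M) (overlap M i j) (transition M i j)"
  unfolding manifold_def by blast

lemma cinv_chart:
  "manifold s M \<Longrightarrow> i \<in> ind M \<Longrightarrow> p \<in> cdom M i \<Longrightarrow> cinv M i (chart M i p) = p"
  unfolding cinv_def by (rule inv_into_f_f[OF manifold_inj])

lemma chart_cinv: "z \<in> chart M i ` cdom M i \<Longrightarrow> chart M i (cinv M i z) = z"
  unfolding cinv_def by (rule f_inv_into_f)

lemma cinv_mem: "z \<in> chart M i ` cdom M i \<Longrightarrow> cinv M i z \<in> cdom M i"
  unfolding cinv_def by (rule inv_into_into)

lemma transition_chart:
  "manifold s M \<Longrightarrow> i \<in> ind M \<Longrightarrow> p \<in> cdom M i \<Longrightarrow> transition M i j (chart M i p) = chart M j p"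
  unfolding transition_def by (simp add: cinv_chart)

lemma overlap_iff:
  assumes "manifold s M" "i \<in> ind M" "z \<in> chart M i ` cdom M i"
  shows "z \<in> overlap M i j \<longleftrightarrow> cinv M i z \<in> cdom M j"
  using assms manifold_inj[OF assms(1,2)] unfolding overlap_def
  by (auto simp: cinv_chart[OF assms(1,2)])

lemma overlap_self: "overlap M i i = chart M i ` cdom M i"
  unfolding overlap_def by simp

text \<open>A criterion for smoothness that suits maps between bundles over the same base: if \<open>f\<close>
  preserves the domains of the charts, it is enough to look at one chart representative of \<open>f\<close> for
  each index, because all others are obtained from it by restriction to an overlap and composition
  with a transition map of the target.\<close>

lemma smooth_mapI:
  fixes M :: "('p, 'i, ('a, 'k) pt) mfd" and N :: "('q, 'i, ('a, 'k) pt) mfd"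
  assumes N: "manifold s N" "P.subspace (model N)" "ind N = ind M"
    and cov: "(\<Union>i\<in>ind M. cdom M i) = pts M"
    and op: "\<And>i. i \<in> ind M \<Longrightarrow> openin (mtop M) (cdom M i)"
    and ch: "\<And>i. i \<in> ind M \<Longrightarrow>
      continuous_map (subtopology (mtop M) (cdom M i)) (top_of_set (model M)) (chart M i)"
    and inj: "\<And>i. i \<in> ind M \<Longrightarrow> inj_on (chart M i) (cdom M i)"
    and ov: "\<And>i j. i \<in> ind M \<Longrightarrow> j \<in> ind M \<Longrightarrow> openin (top_of_set (model M)) (overlap M i j)"
    and sub: "P.subspace (model M)"
    and f: "\<And>i p. i \<in> ind M \<Longrightarrow> p \<in> pts M \<Longrightarrow> f p \<in> cdom N i \<longleftrightarrow> p \<in> cdom M i"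
    and sm: "\<And>i. i \<in> ind M \<Longrightarrow>
      smooth s (model M) (model N) (chart M i ` cdom M i) (\<lambda>z. chart N i (f (cinv M i z)))"
  shows "smooth_map s M N f"
  unfolding smooth_map_def
proof (intro conjI ballI)
  have cM: "cdom M i \<subseteq> pts M" if "i \<in> ind M" for i using openin_subset[OF op[OF that]] .
  have ci: "cinv M i (chart M i p) = p" if "i \<in> ind M" "p \<in> cdom M i" for i p
    unfolding cinv_def by (rule inv_into_f_f[OF inj[OF that(1)] that(2)])
  show "continuous_map (mtop M) (mtop N) f"
  proof (rule pasting_lemma[where I = "ind M" and T = "cdom M" and f = "\<lambda>_. f"])
    fix i assume i: "i \<in> ind M"
    show "openin (mtop M) (cdom M i)" by (rule op[OF i])
    let ?h = "\<lambda>z. chart N i (f (cinv M i z))"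
    have iN: "i \<in> ind N" using i N by simp
    have c1: "continuous_map (subtopology (mtop M) (cdom M i)) (top_of_set (chart M i ` cdom M i)) (chart M i)"
      using ch[OF i] cM[OF i] by (auto simp: continuous_map_in_subtopology)
    have c2: "continuous_map (top_of_set (chart M i ` cdom M i)) (top_of_set (chart N i ` cdom N i)) ?h"
      using smooth_continuous[OF sm[OF i]] f[OF i] cM[OF i]
      by (auto simp: continuous_map_in_subtopology continuous_map_iff_continuous ci[OF i])
    have "continuous_map (subtopology (mtop M) (cdom M i)) (mtop N)
        (cinv N i \<circ> (?h \<circ> chart M i))"
      by (intro continuous_map_compose[OF continuous_map_compose[OF c1 c2]]
          manifold_cinv_continuous[OF N(1) iN])
    then show "continuous_map (subtopology (mtop M) (cdom M i)) (mtop N) f"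
    proof (rule continuous_map_eq)
      fix p assume "p \<in> topspace (subtopology (mtop M) (cdom M i))"
      then have p: "p \<in> pts M" "p \<in> cdom M i" by auto
      then have "f p \<in> cdom N i" using f[OF i p(1)] by simp
      then show "(cinv N i \<circ> (?h \<circ> chart M i)) p = f p"
        using cinv_chart[OF N(1) iN] by (simp add: ci[OF i p(2)])
    qed
  qed (use cov in auto)
  fix i j assume i: "i \<in> ind M" and j: "j \<in> ind N"
  have iN: "i \<in> ind N" and jM: "j \<in> ind M" using i j N by simp_all
  have eq: "chart M i ` {p \<in> cdom M i. f p \<in> cdom N j} = overlap M i j"
    unfolding overlap_def using f[OF jM] cM[OF i] by (intro arg_cong[of _ _ "image (chart M i)"]) blast
  have hm: "chart N i (f (cinv M i z)) \<in> overlap N i j" if "z \<in> overlap M i j" for z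
    using that f[OF i] f[OF jM] cM[OF i] unfolding overlap_def by (auto simp: ci[OF i])
  have sub1: "overlap M i j \<subseteq> chart M i ` cdom M i" unfolding overlap_def by blast
  have "smooth s (model M) (model N) (overlap M i j)
      (\<lambda>z. transition N i j (chart N i (f (cinv M i z))))"
    by (rule smooth_comp[OF sub N(2) smooth_restrict[OF sub ov[OF i jM] sub1 sm[OF i]] hm
          manifold_transition_smooth[OF N(1) iN j]])
  moreover have "transition N i j (chart N i (f (cinv M i z))) = (chart N j \<circ> f \<circ> cinv M i) z"
    if "z \<in> overlap M i j" for z
    using that f[OF i] cM[OF i] transition_chart[OF N(1) iN]
    unfolding overlap_def by (auto simp: ci[OF i])
  ultimately show "smooth s (model M) (model N) (chart M i ` {p \<in> cdom M i. f p \<in> cdom N j})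
      (chart N j \<circ> f \<circ> cinv M i)"
    unfolding eq by (rule smooth_eq)
qed

lemma smooth_map_between_manifoldsI:
  fixes M :: "('p, 'i, ('a, 'k) pt) mfd" and N :: "('q, 'i, ('a, 'k) pt) mfd"
  assumes M: "manifold s M" "P.subspace (model M)" and N: "manifold s N" "P.subspace (model N)"
    and ind: "ind N = ind M"
    and f: "\<And>i p. i \<in> ind M \<Longrightarrow> p \<in> pts M \<Longrightarrow> f p \<in> cdom N i \<longleftrightarrow> p \<in> cdom M i"
    and sm: "\<And>i. i \<in> ind M \<Longrightarrow>
      smooth s (model M) (model N) (chart M i ` cdom M i) (\<lambda>z. chart N i (f (cinv M i z)))"
  shows "smooth_map s M N f"
  by (rule smooth_mapI[OF N ind manifold_cover[OF M(1)] manifold_openin_cdom[OF M(1)]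
        manifold_chart_continuous[OF M(1)] manifold_inj[OF M(1)]
        smooth_openin[OF manifold_transition_smooth[OF M(1)]] M(2) f sm])

lemma smooth_map_rep:
  assumes "smooth_map s M N f" "i \<in> ind M" "i \<in> ind N" "\<And>p. p \<in> cdom M i \<Longrightarrow> f p \<in> cdom N i"
  shows "smooth s (model M) (model N) (chart M i ` cdom M i) (\<lambda>z. chart N i (f (cinv M i z)))"
proof -
  have "{p \<in> cdom M i. f p \<in> cdom N i} = cdom M i" using assms(4) by blast
  then show ?thesis using assms(1-3) unfolding smooth_map_def comp_def by force
qed

section \<open>The tangent bundle is a manifold\<close>

text \<open>A quotient of \<open>f\<close> on \<open>U\<close> is also one on \<open>W\<close>.\<close>

lemma diff_restrict:
  assumes E: "P.subspace E" and W: "openin (top_of_set E) W" and U: "openin (top_of_set E) U"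
    and WU: "W \<subseteq> U" and f: "C1 s E F U f" and x: "x \<in> W" and v: "v \<in> E"
  shows "diff s E F W f x v = diff s E F U f x v"
proof -
  note q = is_quot_quot[OF f]
  have dd: "dom1 s E W \<subseteq> dom1 s E U" using WU by (auto elim!: dom1E)
  have q': "is_quot s E F W f (quot s E F U f)"
    unfolding is_quot_def
    using WU dd is_quotD(1)[OF q] is_quotD(4)[OF q] continuous_on_subset[OF is_quotD(3)[OF q] dd]
    by (auto simp: subset_iff)
  have "C1 s E F W f" using q' f WU by (auto simp: C1_def Pi_iff subset_iff)
  from is_quot_unique[OF E W is_quot_quot[OF this] q', of "pair x (pair v (spt 0))"]
  show ?thesis unfolding diff_def using x v by simp
qed

lemma Tan_simps [simp]:
  "ind (Tan s N) = ind N" "cdom (Tan s N) = tdom s N" "chart (Tan s N) = tchart"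
  "model (Tan s N) = prd (model N) (model N)"
  by (simp_all add: Tan_def)

context
  fixes N :: "('p, 'i, ('a, 'k) pt) mfd"
  assumes N: "manifold s N" and E: "P.subspace (model N)"
begin

abbreviation (input) "dtrans i j \<equiv> diff s (model N) (model N) (overlap N i j) (transition N i j)"

lemma transition_C1:
  "i \<in> ind N \<Longrightarrow> j \<in> ind N \<Longrightarrow> C1 s (model N) (model N) (overlap N i j) (transition N i j)"
  by (rule smooth_C1[OF manifold_transition_smooth[OF N]])

lemma openin_overlap:
  "i \<in> ind N \<Longrightarrow> j \<in> ind N \<Longrightarrow> openin (top_of_set (model N)) (overlap N i j)"
  by (rule smooth_openin[OF manifold_transition_smooth[OF N]])

lemma transition_mem_overlap:
  assumes "i \<in> ind N" "x \<in> overlap N i j" "x \<in> overlap N i l"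
  shows "transition N i j x \<in> overlap N j l"
proof -
  obtain p q where "x = chart N i p" "p \<in> cdom N i" "p \<in> cdom N j"
    "x = chart N i q" "q \<in> cdom N i" "q \<in> cdom N l"
    using assms(2,3) unfolding overlap_def by blast
  moreover from this have "p = q" using inj_onD[OF manifold_inj[OF N assms(1)]] by metis
  ultimately show ?thesis using transition_chart[OF N assms(1)] unfolding overlap_def by auto
qed

lemma transition_cocycle:
  assumes "i \<in> ind N" "j \<in> ind N" "x \<in> overlap N i j"
  shows "transition N j l (transition N i j x) = transition N i l x"
  using assms transition_chart[OF N assms(1)] transition_chart[OF N assms(2)]
  unfolding overlap_def by auto

lemma cinv_transition:
  assumes "i \<in> ind N" "j \<in> ind N" "x \<in> overlap N i j"
  shows "cinv N j (transition N i j x) = cinv N i x"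
  using assms transition_chart[OF N assms(1)] cinv_chart[OF N] unfolding overlap_def by auto

lemma transition_self:
  assumes "i \<in> ind N" "x \<in> chart N i ` cdom N i" shows "transition N i i x = x"
  using assms transition_chart[OF N assms(1)] by auto

lemma dtrans_self:
  assumes "i \<in> ind N" "x \<in> chart N i ` cdom N i" "v \<in> model N" shows "dtrans i i x v = v"
  using assms transition_self[OF assms(1)]
  by (intro diff_ident[OF E openin_overlap _ _ transition_C1]) (auto simp: overlap_self)

lemma dtrans_mem:
  assumes "i \<in> ind N" "j \<in> ind N" "x \<in> overlap N i j" "v \<in> model N"
  shows "dtrans i j x v \<in> model N"
  by (rule diff_mem[OF transition_C1[OF assms(1,2)] assms(3,4)])

text \<open>The chain rule for the transition maps, on the part of the \<open>i\<close>-th chart that lies over the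
  intersection of three charts.\<close>

lemma dtrans_cocycle:
  assumes i: "i \<in> ind N" and j: "j \<in> ind N" and l: "l \<in> ind N"
    and x: "x \<in> overlap N i j" "x \<in> overlap N i l" and v: "v \<in> model N"
  shows "dtrans j l (transition N i j x) (dtrans i j x v) = dtrans i l x v"
proof -
  let ?E = "model N" and ?W = "overlap N i j \<inter> overlap N i l"
  have W: "openin (top_of_set ?E) ?W" by (intro openin_Int openin_overlap i j l)
  have g: "smooth s ?E ?E ?W (transition N i j)"
    by (rule smooth_restrict[OF E W _ manifold_transition_smooth[OF N i j]]) blast
  have gW: "transition N i j y \<in> overlap N j l" if "y \<in> ?W" for y
    using transition_mem_overlap[OF i] that by blast
  note f = manifold_transition_smooth[OF N j l]
  have fg: "smooth s ?E ?E ?W (\<lambda>y. transition N j l (transition N i j y))"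
    by (rule smooth_comp[OF E E g gW f])
  have xW: "x \<in> ?W" using x by blast
  have "dtrans i l x v = diff s ?E ?E ?W (transition N i l) x v"
    by (rule diff_restrict[symmetric, OF E W openin_overlap[OF i l] _ transition_C1[OF i l] xW v]) blast
  also have "\<dots> = diff s ?E ?E ?W (\<lambda>y. transition N j l (transition N i j y)) x v"
    by (rule arg_cong[of _ _ "\<lambda>h. h x v"], rule diff_cong) (use transition_cocycle[OF i j] in auto)
  also have "\<dots> = dtrans j l (transition N i j x) (diff s ?E ?E ?W (transition N i j) x v)"
    by (rule diff_comp[OF E E smooth_C1[OF g] smooth_C1[OF f] W openin_overlap[OF j l] gW
          smooth_C1[OF fg] xW v])
  also have "diff s ?E ?E ?W (transition N i j) x v = dtrans i j x v"
    by (rule diff_restrict[OF E W openin_overlap[OF i j] _ transition_C1[OF i j] xW v]) blast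
  finally show ?thesis by simp
qed

lemma mem_tclass_iff:
  assumes "i \<in> ind N" "x \<in> chart N i ` cdom N i"
  shows "(j, p) \<in> tclass s N i x v \<longleftrightarrow>
    j \<in> ind N \<and> x \<in> overlap N i j \<and> p = pair (transition N i j x) (dtrans i j x v)"
  unfolding tclass_def using overlap_iff[OF N assms] by auto

text \<open>The cocycle property makes the points of \<open>TM\<close> independent of the chart in which they are given;
  everything about the charts of \<open>TM\<close> follows from this.\<close>

lemma tclass_change:
  assumes i: "i \<in> ind N" and j: "j \<in> ind N" and x: "x \<in> overlap N i j" and v: "v \<in> model N"
  shows "tclass s N j (transition N i j x) (dtrans i j x v) = tclass s N i x v"
proof -
  have xi: "x \<in> chart N i ` cdom N i" using x unfolding overlap_def by blast
  have xj: "transition N i j x \<in> chart N j ` cdom N j"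
    using transition_mem_overlap[OF i x x] unfolding overlap_self .
  have ov: "transition N i j x \<in> overlap N j l \<longleftrightarrow> x \<in> overlap N i l" for l
    using overlap_iff[OF N j xj] overlap_iff[OF N i xi] cinv_transition[OF i j x] by simp
  have "(l, p) \<in> tclass s N j (transition N i j x) (dtrans i j x v) \<longleftrightarrow> (l, p) \<in> tclass s N i x v" for l p
    unfolding mem_tclass_iff[OF j xj] mem_tclass_iff[OF i xi] ov
    using transition_cocycle[OF i j x] dtrans_cocycle[OF i j _ x _ v] by auto
  then show ?thesis by auto
qed

lemma tchart_tclass:
  assumes "i \<in> ind N" "j \<in> ind N" "x \<in> overlap N i j"
  shows "tchart j (tclass s N i x v) = pair (transition N i j x) (dtrans i j x v)"
proof -
  have xi: "x \<in> chart N i ` cdom N i" using assms unfolding overlap_def by blast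
  show ?thesis unfolding tchart_def mem_tclass_iff[OF assms(1) xi] using assms by simp
qed

lemma tchart_tclass_self:
  assumes "i \<in> ind N" "x \<in> chart N i ` cdom N i" "v \<in> model N"
  shows "tchart i (tclass s N i x v) = pair x v"
  using tchart_tclass[OF assms(1,1)] assms transition_self dtrans_self by (simp add: overlap_self)

lemma tclass_mem_tdom_iff:
  assumes i: "i \<in> ind N" and j: "j \<in> ind N" and x: "x \<in> chart N i ` cdom N i" and v: "v \<in> model N"
  shows "tclass s N i x v \<in> tdom s N j \<longleftrightarrow> x \<in> overlap N i j"
proof
  assume "tclass s N i x v \<in> tdom s N j"
  then obtain y w where y: "tclass s N i x v = tclass s N j y w" "y \<in> chart N j ` cdom N j" "w \<in> model N"
    unfolding tdom_def by auto
  then have "(j, pair y w) \<in> tclass s N j y w"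
    using mem_tclass_iff[OF j y(2)] transition_self[OF j y(2)] dtrans_self[OF j y(2,3)] j
    by (simp add: overlap_self)
  then show "x \<in> overlap N i j" using y(1) mem_tclass_iff[OF i x] by metis
next
  assume xo: "x \<in> overlap N i j"
  then have "transition N i j x \<in> chart N j ` cdom N j"
    using transition_mem_overlap[OF i xo xo] unfolding overlap_self by simp
  then show "tclass s N i x v \<in> tdom s N j"
    using tclass_change[OF i j xo v] dtrans_mem[OF i j xo v] unfolding tdom_def by force
qed

lemma tdomE:
  assumes "c \<in> tdom s N i"
  obtains x v where "c = tclass s N i x v" "x \<in> chart N i ` cdom N i" "v \<in> model N"
  using assms unfolding tdom_def by auto

lemma tclass_mem_tdom:
  "x \<in> chart N i ` cdom N i \<Longrightarrow> v \<in> model N \<Longrightarrow> tclass s N i x v \<in> tdom s N i"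
  unfolding tdom_def by blast

lemma tchart_inj: "i \<in> ind N \<Longrightarrow> inj_on tchart' (tdom s N i)" if "tchart' = tchart i" for tchart'
  unfolding that by (auto intro!: inj_onI elim!: tdomE simp: tchart_tclass_self)

lemma tchart_image:
  assumes "i \<in> ind N" "j \<in> ind N"
  shows "tchart i ` (tdom s N i \<inter> tdom s N j) = prd (overlap N i j) (model N)"
proof (intro equalityI subsetI)
  fix z assume "z \<in> tchart i ` (tdom s N i \<inter> tdom s N j)"
  then obtain x v where "z = tchart i (tclass s N i x v)" "x \<in> chart N i ` cdom N i" "v \<in> model N"
    "tclass s N i x v \<in> tdom s N j"
    by (auto elim: tdomE)
  then show "z \<in> prd (overlap N i j) (model N)"
    using tclass_mem_tdom_iff[OF assms] assms by (simp add: tchart_tclass_self)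
next
  fix z assume "z \<in> prd (overlap N i j) (model N)"
  then obtain x v where z: "z = pair x v" "x \<in> overlap N i j" "v \<in> model N" by (auto elim: prdE)
  then have x: "x \<in> chart N i ` cdom N i" unfolding overlap_def by blast
  show "z \<in> tchart i ` (tdom s N i \<inter> tdom s N j)"
    using z x assms tclass_mem_tdom_iff[OF assms x z(3)] tclass_mem_tdom[OF x z(3)]
    by (intro image_eqI[of _ _ "tclass s N i x v"]) (auto simp: tchart_tclass_self)
qed

lemma tchart_inv:
  assumes "i \<in> ind N" "x \<in> chart N i ` cdom N i" "v \<in> model N"
  shows "inv_into (tdom s N i) (tchart i) (pair x v) = tclass s N i x v"
  using inv_into_f_f[OF tchart_inj[OF refl assms(1)] tclass_mem_tdom[OF assms(2,3)]]
  by (simp add: tchart_tclass_self assms)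

lemma manifold_Tan: "manifold s (Tan s N)"
  and pts_Tan: "pts (Tan s N) = (\<Union>i\<in>ind N. tdom s N i)"
proof -
  have tr: "smooth s (prd (model N) (model N)) (prd (model N) (model N))
      (tchart i ` (tdom s N i \<inter> tdom s N j)) (\<lambda>z. tchart j (inv_into (tdom s N i) (tchart i) z))"
    if i: "i \<in> ind N" and j: "j \<in> ind N" for i j
  proof -
    have eq: "pair (transition N i j (lpt z)) (dtrans i j (lpt z) (rpt z))
        = tchart j (inv_into (tdom s N i) (tchart i) z)" if "z \<in> prd (overlap N i j) (model N)" for z
    proof -
      from that obtain x v where z: "z = pair x v" "x \<in> overlap N i j" "v \<in> model N" by (auto elim: prdE)
      then have "x \<in> chart N i ` cdom N i" unfolding overlap_def by blast
      then show ?thesis using z by (simp add: tchart_inv[OF i] tchart_tclass[OF i j])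
    qed
    show ?thesis
      unfolding tchart_image[OF i j]
      by (rule smooth_eq[OF smooth_tangent[OF E E manifold_transition_smooth[OF N i j]]]) (rule eq)
  qed
  have ov: "openin (top_of_set (prd (model N) (model N))) (tchart i ` (tdom s N i \<inter> tdom s N j))"
    if "i \<in> ind N" "j \<in> ind N" for i j
    by (rule smooth_openin[OF tr[OF that]])
  show "manifold s (Tan s N)"
    by (rule manifold_atlas(1)[where c = tchart and D = "tdom s N" and I = "ind N"
          and E = "prd (model N) (model N)", OF tchart_inj[OF refl] ov tr Tan_def])
  show "pts (Tan s N) = (\<Union>i\<in>ind N. tdom s N i)"
    by (rule manifold_atlas(2)[where c = tchart and D = "tdom s N" and I = "ind N"
          and E = "prd (model N) (model N)", OF tchart_inj[OF refl] ov tr Tan_def])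
qed

lemma transition_Tan:
  assumes "i \<in> ind N" "j \<in> ind N" "x \<in> overlap N i j" "v \<in> model N"
  shows "transition (Tan s N) i j (pair x v) = pair (transition N i j x) (dtrans i j x v)"
proof -
  have "x \<in> chart N i ` cdom N i" using assms unfolding overlap_def by blast
  then have "cinv (Tan s N) i (pair x v) = tclass s N i x v"
    unfolding cinv_def Tan_simps using assms by (simp add: tchart_inv)
  then have "transition (Tan s N) i j (pair x v) = tchart j (tclass s N i x v)"
    unfolding transition_def[of "Tan s N"] by simp
  then show ?thesis using assms by (simp only: tchart_tclass)
qed

lemma tproj_tclass:
  assumes i: "i \<in> ind N" and x: "x \<in> chart N i ` cdom N i"
  shows "tproj N (tclass s N i x v) = cinv N i x"
  unfolding tproj_def
proof (rule the_equality)
  show "\<exists>(j, p)\<in>tclass s N i x v. cinv N i x = cinv N j (lpt p)"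
    using mem_tclass_iff[OF i x, of i] i x transition_self[OF i x]
    by (intro bexI[of _ "(i, pair (transition N i i x) (dtrans i i x v))"]) (auto simp: overlap_self)
  show "m = cinv N i x" if "\<exists>(j, p)\<in>tclass s N i x v. m = cinv N j (lpt p)" for m
    using that mem_tclass_iff[OF i x] cinv_transition[OF i] by auto
qed

lemma tproj_chart:
  assumes "i \<in> ind N" "c \<in> tdom s N i"
  shows "tproj N c \<in> cdom N i" "chart N i (tproj N c) = lpt (tchart i c)"
  using assms by (auto elim!: tdomE simp: tproj_tclass tchart_tclass_self cinv_mem chart_cinv
      simp del: image_iff intro: cinv_mem)

lemma tproj_mem_cdom_iff:
  assumes c: "c \<in> pts (Tan s N)" and j: "j \<in> ind N"
  shows "tproj N c \<in> cdom N j \<longleftrightarrow> c \<in> tdom s N j"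
proof -
  from c obtain i where i: "i \<in> ind N" "c \<in> tdom s N i" unfolding pts_Tan by blast
  then obtain x v where x: "c = tclass s N i x v" "x \<in> chart N i ` cdom N i" "v \<in> model N"
    by (auto elim: tdomE)
  then show ?thesis
    using tclass_mem_tdom_iff[OF i(1) j x(2,3)] tproj_tclass[OF i(1) x(2)] overlap_iff[OF N i(1) x(2)]
    by simp
qed

lemma tproj_mem: "c \<in> pts (Tan s N) \<Longrightarrow> tproj N c \<in> pts N"
  using tproj_chart(1) manifold_cdom_subset[OF N] unfolding pts_Tan by blast

end

end

section \<open>Coordinates of the iterated tangent model\<close>

lemma idxD: "\<alpha> \<in> idx n \<Longrightarrow> i < n \<Longrightarrow> \<alpha> i = 0 \<or> \<alpha> i = 1" "\<alpha> \<in> idx n \<Longrightarrow> n \<le> i \<Longrightarrow> \<alpha> i = 0"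
  unfolding idx_def by auto

lemma finite_idx: "finite (idx n)"
proof -
  have "idx n \<subseteq> {f. \<forall>i. (i \<in> {..<n} \<longrightarrow> f i \<in> {0, 1}) \<and> (i \<notin> {..<n} \<longrightarrow> f i = 0)}"
    unfolding idx_def by auto
  then show ?thesis by (rule finite_subset) (intro finite_set_of_finite_funs; simp)
qed

lemma finite_pos [simp]: "finite (pos n)"
  unfolding pos_def using finite_idx by blast

lemma zero_mem_idx [simp]: "0 \<in> idx n"
  unfolding idx_def by simp

lemma pos_subset_idx: "pos n \<subseteq> idx n"
  unfolding pos_def by blast

lemma idx_cases: "\<alpha> \<in> idx n \<Longrightarrow> \<alpha> = 0 \<or> \<alpha> \<in> pos n"
  unfolding pos_def by blast

lemma zero_notin_pos [simp]: "0 \<notin> pos n"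
  unfolding pos_def by blast

lemma length_addr [simp]: "length (addr k \<alpha>) = k"
  unfolding addr_def by simp

lemma addr_0 [simp]: "addr 0 \<alpha> = []"
  unfolding addr_def by simp

lemma addr_Suc: "addr (Suc k) \<alpha> = (\<alpha> (Suc k) = 1) # addr k \<alpha>"
  unfolding addr_def by simp

lemma addr_eqD:
  assumes "addr k \<alpha> = addr k \<beta>" "1 \<le> i" "i \<le> k"
  shows "\<alpha> i = 1 \<longleftrightarrow> \<beta> i = 1"
  using assms(1,3)
proof (induction k)
  case (Suc k)
  then show ?case by (cases "i = Suc k") (auto simp: addr_Suc)
qed (use assms in simp)

lemma idx_eqI:
  assumes "\<alpha> \<in> idx (Suc k)" "\<beta> \<in> idx (Suc k)" "addr k \<alpha> = addr k \<beta>" "\<alpha> 0 = \<beta> 0"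
  shows "\<alpha> = \<beta>"
proof (rule ext)
  fix i
  consider "i = 0" | "1 \<le> i" "i \<le> k" | "Suc k \<le> i" by linarith
  then show "\<alpha> i = \<beta> i"
  proof cases
    case 2
    then show ?thesis
      using addr_eqD[OF assms(3) 2] idxD(1)[OF assms(1), of i] idxD(1)[OF assms(2), of i] by auto
  qed (use assms idxD(2)[OF assms(1)] idxD(2)[OF assms(2)] in auto)
qed

text \<open>Every leaf is addressed by two indices, one for each of its components.\<close>

lemma addr_surj: "\<exists>\<alpha>\<in>idx (Suc (length w)). addr (length w) \<alpha> = w \<and> \<alpha> 0 = of_bool b"
proof (induction w)
  case Nil
  show ?case by (intro bexI[of _ "(\<lambda>_. 0)(0 := of_bool b)"]) (auto simp: idx_def)
next
  case (Cons c w)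
  then obtain \<alpha> where \<alpha>: "\<alpha> \<in> idx (Suc (length w))" "addr (length w) \<alpha> = w" "\<alpha> 0 = of_bool b" by blast
  let ?\<beta> = "\<alpha>(Suc (length w) := of_bool c)"
  have "addr (length w) ?\<beta> = addr (length w) \<alpha>" unfolding addr_def by (simp cong: map_cong)
  moreover have "?\<beta> \<in> idx (Suc (Suc (length w)))" using \<alpha>(1) unfolding idx_def by auto
  ultimately show ?case
    using \<alpha> by (intro bexI[of _ ?\<beta>]) (simp_all add: addr_Suc del: fun_upd_apply, simp add: fun_upd_apply)
qed

lemma addr_upd [simp]: "addr k (\<alpha>(Suc k := a)) = addr k \<alpha>"
  unfolding addr_def by (simp cong: map_cong)

text \<open>Dropping the last unit; \<open>addr k\<close>, \<open>eps k\<close> and \<open>Valpha\<close> do not see it.\<close>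

lemma idx_upd: "\<alpha> \<in> idx (Suc (Suc k)) \<Longrightarrow> \<alpha>(Suc k := 0) \<in> idx (Suc k)"
  unfolding idx_def by (auto simp: less_Suc_eq le_Suc_eq)

text \<open>\<open>cmp k \<alpha> p\<close> is the coefficient of \<open>\<epsilon>\<^sup>\<alpha>\<close> in \<open>p\<close>; the base point is the coefficient of
  \<open>\<epsilon>\<^sup>0 = 1\<close>.\<close>

definition cmp :: "nat \<Rightarrow> index \<Rightarrow> ('v::zero \<times> 'w::zero, 'k::zero) pt \<Rightarrow> ('v \<times> 'w, 'k) pt" where
  "cmp k \<alpha> p = (if \<alpha> 0 = 0 then vpt (fst (fst (p (addr k \<alpha>))), 0) else vpt (0, snd (fst (p (addr k \<alpha>)))))"

lemma base_pt_cmp: "base_pt k p = cmp k 0 p"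
  unfolding base_pt_def cmp_def by simp

text \<open>The model of the \<open>k\<close>-th iterated tangent bundle: the binary trees of depth \<open>k\<close> with leaves in
  \<open>V \<times> W\<close>. For \<open>k = 0\<close> it is the model of \<open>F\<close> itself.\<close>

definition tmodel :: "nat \<Rightarrow> ('v::zero \<times> 'w::zero, 'k::zero) pt set" where
  "tmodel k = {p. \<forall>w. snd (p w) = 0 \<and> (length w \<noteq> k \<longrightarrow> p w = 0)}"

lemma tmodel_0: "tmodel 0 = range vpt"
proof (intro Set.set_eqI iffI)
  fix p :: "('v::zero \<times> 'w::zero, 'k::zero) pt"
  assume "p \<in> tmodel 0"
  then have "p = vpt (fst (p []))"
    by (intro ext) (auto simp: tmodel_def vpt_def prod_eq_iff)
  then show "p \<in> range vpt" by blast
qed (auto simp: tmodel_def vpt_def)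

lemma tmodel_Suc: "tmodel (Suc k) = prd (tmodel k) (tmodel k)"
proof (intro Set.set_eqI iffI)
  fix p :: "('v::zero \<times> 'w::zero, 'k::zero) pt"
  show "p \<in> prd (tmodel k) (tmodel k)" if "p \<in> tmodel (Suc k)"
    using that by (auto simp: tmodel_def mem_prd_iff lpt_def rpt_def)
  assume p: "p \<in> prd (tmodel k) (tmodel k)"
  have "snd (p w) = 0 \<and> (length w \<noteq> Suc k \<longrightarrow> p w = 0)" for w
  proof (cases w)
    case (Cons b w')
    then show ?thesis using p by (cases b) (auto simp: tmodel_def mem_prd_iff lpt_def rpt_def)
  qed (use p in \<open>auto simp: mem_prd_iff\<close>)
  then show "p \<in> tmodel (Suc k)" by (simp add: tmodel_def)
qed

lemma zero_mem_Valpha [simp]: "0 \<in> Valpha \<alpha>"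
  unfolding Valpha_def by (auto intro: image_eqI[of _ _ 0] simp flip: zero_prod_def)

lemma Valpha_upd [simp]: "Valpha (\<alpha>(Suc k := a)) = Valpha \<alpha>"
  unfolding Valpha_def by simp

lemma cmp_mem_Valpha [simp]: "cmp k \<alpha> p \<in> Valpha \<alpha>"
  unfolding cmp_def Valpha_def by auto

text \<open>Two indices with the same address differ in \<open>\<alpha>\<^sub>0\<close>, hence belong to different components of a
  leaf.\<close>

lemma cmp_eps:
  assumes "\<alpha> \<in> idx (Suc k)" "\<beta> \<in> idx (Suc k)" "u \<in> Valpha \<alpha>"
  shows "cmp k \<beta> (eps k \<alpha> u) = (if \<beta> = \<alpha> then u else 0)"
proof (cases "\<beta> = \<alpha>")
  case True
  then show ?thesis using assms(3) by (auto simp: cmp_def eps_def Valpha_def split: if_splits)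
next
  case False
  show ?thesis
  proof (cases "addr k \<beta> = addr k \<alpha>")
    case True
    then have "\<beta> 0 \<noteq> \<alpha> 0" using idx_eqI[OF assms(2,1)] False by blast
    then show ?thesis
      using False True assms idxD(1)[OF assms(1), of 0] idxD(1)[OF assms(2), of 0]
      by (auto simp: cmp_def eps_def Valpha_def simp flip: zero_prod_def)
  qed (use False in \<open>auto simp: cmp_def eps_def simp flip: zero_prod_def\<close>)
qed

lemma tmodel_eqI:
  assumes "p \<in> tmodel k" "q \<in> tmodel k" "\<And>\<alpha>. \<alpha> \<in> idx (Suc k) \<Longrightarrow> cmp k \<alpha> p = cmp k \<alpha> q"
  shows "p = q"
proof (rule ext)
  fix w
  show "p w = q w"
  proof (cases "length w = k")
    case True
    obtain \<alpha> \<beta> where "\<alpha> \<in> idx (Suc k)" "addr k \<alpha> = w" "\<alpha> 0 = 0"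
      and "\<beta> \<in> idx (Suc k)" "addr k \<beta> = w" "\<beta> 0 = 1"
      using addr_surj[of w False] addr_surj[of w True] True by auto
    then have "fst (p w) = fst (q w)"
      using assms(3)[of \<alpha>] assms(3)[of \<beta>] by (auto simp: cmp_def prod_eq_iff)
    then show ?thesis using assms(1,2) by (auto simp: tmodel_def prod_eq_iff)
  qed (use assms(1,2) in \<open>auto simp: tmodel_def\<close>)
qed

lemma eps_upd [simp]: "eps k (\<alpha>(Suc k := a)) = eps k \<alpha>"
  unfolding eps_def by (simp add: fun_eq_iff)

lemma eps_Suc: "eps (Suc k) \<alpha> u = (if \<alpha> (Suc k) = 1 then pair 0 (eps k \<alpha> u) else pair (eps k \<alpha> u) 0)"
  by (rule ext) (auto simp: eps_def addr_Suc pair_def split: list.split)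

lemma cmp_Suc_0: "cmp (Suc k) 0 p = cmp k 0 (lpt p)"
  unfolding cmp_def by (simp add: addr_Suc lpt_def)

lemma eps_mem_tmodel: "u \<in> Valpha \<alpha> \<Longrightarrow> eps k \<alpha> u \<in> tmodel k"
  unfolding tmodel_def eps_def by (auto simp: Valpha_def vpt_def split: if_splits)

lemma eps_0_Valpha: "u \<in> range vpt \<Longrightarrow> eps 0 \<alpha> u = u"
  unfolding eps_def by (auto simp: vpt_def fun_eq_iff)

lemma Valpha_subset: "Valpha \<alpha> \<subseteq> range vpt"
  unfolding Valpha_def by auto

lemma eps_add: "eps k \<alpha> (u + v) = eps k \<alpha> u + eps k \<alpha> (v :: ('a::ab_group_add, 'k::ab_group_add) pt)"
  unfolding eps_def by (auto simp: fun_eq_iff plus_fun_apply)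

lemma eps_zero [simp]: "eps k \<alpha> 0 = 0"
  unfolding eps_def by (auto simp: fun_eq_iff)

lemma cmp_add:
  "cmp k \<alpha> (p + q) = cmp k \<alpha> p + cmp k \<alpha> (q :: ('v::ab_group_add \<times> 'w::ab_group_add, 'k::ab_group_add) pt)"
  unfolding cmp_def by (simp add: vpt_add plus_fun_apply)

lemma cmp_zero [simp]: "cmp k \<alpha> 0 = 0"
  unfolding cmp_def by (simp flip: zero_prod_def)

lemma cmp_sum:
  "cmp k \<alpha> (\<Sum>a\<in>A. f a) = (\<Sum>a\<in>A. cmp k \<alpha> (f a :: ('v::ab_group_add \<times> 'w::ab_group_add, 'k::ab_group_add) pt))"
  by (induction A rule: infinite_finite_induct) (simp_all add: cmp_add del: zero_fun_apply)

lemma cmp_minus: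
  "cmp k \<alpha> (- p) = - cmp k \<alpha> (p :: ('v::ab_group_add \<times> 'w::ab_group_add, 'k::ab_group_add) pt)"
  using cmp_add[of k \<alpha> p "- p"] by (simp add: eq_neg_iff_add_eq_0 add.commute)

lemma cmp_diff:
  "cmp k \<alpha> (p - q) = cmp k \<alpha> p - cmp k \<alpha> (q :: ('v::ab_group_add \<times> 'w::ab_group_add, 'k::ab_group_add) pt)"
  using cmp_add[of k \<alpha> p "- q"] by (simp add: cmp_minus)

lemma cmp_pnt:
  fixes x :: "('v::ab_group_add \<times> 'w::ab_group_add, 'k::ab_group_add) pt"
  assumes x: "x \<in> Valpha 0" and v: "\<And>\<alpha>. \<alpha> \<in> pos (Suc k) \<Longrightarrow> v \<alpha> \<in> Valpha \<alpha>"
  shows "\<beta> \<in> pos (Suc k) \<Longrightarrow> cmp k \<beta> (pnt k x v) = v \<beta>" "cmp k 0 (pnt k x v) = x"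
proof -
  have I: "\<alpha> \<in> idx (Suc k)" if "\<alpha> \<in> pos (Suc k)" for \<alpha> using that pos_subset_idx by blast
  have e: "cmp k \<beta> (\<Sum>\<alpha>\<in>pos (Suc k). eps k \<alpha> (v \<alpha>)) = (\<Sum>\<alpha>\<in>pos (Suc k). if \<beta> = \<alpha> then v \<alpha> else 0)"
    if "\<beta> \<in> idx (Suc k)" for \<beta>
    unfolding cmp_sum using v I that by (intro sum.cong) (simp_all add: cmp_eps)
  show "cmp k \<beta> (pnt k x v) = v \<beta>" if b: "\<beta> \<in> pos (Suc k)"
  proof -
    have "\<beta> \<noteq> 0" using b by auto
    then show ?thesis
      unfolding pnt_def cmp_add e[OF I[OF b]] using cmp_eps[OF zero_mem_idx I[OF b] x] b
      by (simp add: sum.delta')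
  qed
  show "cmp k 0 (pnt k x v) = x"
    unfolding pnt_def cmp_add e[OF zero_mem_idx] using cmp_eps[OF zero_mem_idx zero_mem_idx x]
    by (simp add: sum.delta')
qed

locale vbundle_setup =
  fixes sV :: "'k::topological_base_ring \<Rightarrow> 'v::{topological_ab_group_add,t2_space} \<Rightarrow> 'v"
    and sW :: "'k \<Rightarrow> 'w::{topological_ab_group_add,t2_space} \<Rightarrow> 'w"
    and F :: "('m, 'f, 'i, 'v, 'w, 'k) vbundle"
  assumes sV: "topological_module sV" and sW: "topological_module sW"
    and F: "vector_bundle sV sW F"
begin

abbreviation "sc \<equiv> vscale sV sW"
abbreviation "B \<equiv> base F"
abbreviation "I \<equiv> ind (base F)"

sublocale MV: base_module sV by (rule base_module.intro[OF sV])
sublocale MW: base_module sW by (rule base_module.intro[OF sW])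

lemma topological_module_vscale: "topological_module sc"
  unfolding topological_module_def
proof
  show "Modules.module sc"
    by standard (auto simp: vscale_def MV.M.scale_right_distrib MV.M.scale_left_distrib
        MW.M.scale_right_distrib MW.M.scale_left_distrib)
  have c1: "continuous_on UNIV (\<lambda>z::'k \<times> 'v \<times> 'w. (fst z, fst (snd z)))"
    and c2: "continuous_on UNIV (\<lambda>z::'k \<times> 'v \<times> 'w. (fst z, snd (snd z)))"
    by (intro continuous_on_Pair continuous_on_fst continuous_on_snd continuous_on_id)+
  have "continuous_on UNIV (\<lambda>z::'k \<times> 'v \<times> 'w. (sV (fst z) (fst (snd z)), sW (fst z) (snd (snd z))))"
    using continuous_on_compose2[OF MV.s_continuous c1] continuous_on_compose2[OF MW.s_continuous c2]
    by (intro continuous_on_Pair) auto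
  then show "continuous_on UNIV (\<lambda>(t, z). sc t z)"
    by (simp add: vscale_def case_prod_beta)
qed

sublocale base_module sc by (rule base_module.intro[OF topological_module_vscale])

abbreviation scale_tk (infixr "*\<^sub>p" 75) where
  "t *\<^sub>p p \<equiv> pscale sc t p"

lemma pscale_vpt_V: "t *\<^sub>p vpt (v, 0) = vpt (sV t v, 0)"
  and pscale_vpt_W: "t *\<^sub>p vpt (0, w) = vpt (0, sW t w)"
  by (simp_all add: pscale_vpt vscale_def MV.M.scale_zero_right MW.M.scale_zero_right)

lemma subspace_Valpha: "P.subspace (Valpha \<alpha>)"
  unfolding P.subspace_def
  by (auto simp: Valpha_def vpt_add pscale_vpt_V pscale_vpt_W)
    (auto intro: image_eqI[of _ _ 0] simp flip: zero_prod_def)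

lemma subspace_tmodel: "P.subspace (tmodel k)"
  unfolding P.subspace_def
  by (auto simp: tmodel_def plus_fun_apply pscale_def vscale_def zero_prod_def
      MV.M.scale_zero_right MW.M.scale_zero_right)

lemma cmp_pscale: "cmp k \<alpha> (t *\<^sub>p p) = t *\<^sub>p cmp k \<alpha> p"
  by (simp add: cmp_def pscale_vpt_V pscale_vpt_W) (simp add: pscale_def vscale_def case_prod_beta)

lemma eps_pscale: "eps k \<alpha> (t *\<^sub>p u) = t *\<^sub>p eps k \<alpha> u"
  by (rule ext) (simp add: eps_def pscale_def zero_prod_def vscale_def
      MV.M.scale_zero_right MW.M.scale_zero_right)

lemma continuous_on_cmp: "continuous_on A f \<Longrightarrow> continuous_on A (\<lambda>x. cmp k \<alpha> (f x))"
  unfolding cmp_def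
  by (cases "\<alpha> 0 = 0")
    (auto intro!: continuous_on_vpt continuous_on_Pair continuous_on_fst continuous_on_snd
      dest: continuous_on_product_then_coordinatewise)

lemma continuous_on_eps:
  assumes "continuous_on A f" shows "continuous_on A (\<lambda>x. eps k \<alpha> (f x))"
proof (rule continuous_on_coordinatewise_then_product)
  fix w :: "bool list"
  show "continuous_on A (\<lambda>x. eps k \<alpha> (f x) w)"
    using continuous_on_product_then_coordinatewise[OF assms]
    by (cases "w = addr k \<alpha>") (auto simp: eps_def)
qed

lemma lin_on_cmp: "lin_on E (Valpha \<alpha>) (cmp k \<alpha>)"
  unfolding lin_on_def by (auto simp: cmp_add cmp_pscale intro!: continuous_on_cmp continuous_on_id)

lemma lin_on_eps: "lin_on (Valpha \<alpha>) (tmodel k) (eps k \<alpha>)"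
  unfolding lin_on_def
  by (auto simp: eps_add eps_pscale eps_mem_tmodel intro!: continuous_on_eps continuous_on_id)

lemma pnt_mem_tmodel:
  fixes x :: "('v \<times> 'w, 'k) pt"
  assumes "x \<in> Valpha 0" "\<And>\<alpha>. \<alpha> \<in> pos (Suc k) \<Longrightarrow> v \<alpha> \<in> Valpha \<alpha>"
  shows "pnt k x v \<in> tmodel k"
  unfolding pnt_def using assms
  by (intro P.subspace_add[OF subspace_tmodel] P.subspace_sum[OF subspace_tmodel] eps_mem_tmodel)

lemma pnt_cmp:
  fixes p :: "('v \<times> 'w, 'k) pt"
  assumes "p \<in> tmodel k" shows "pnt k (cmp k 0 p) (\<lambda>\<alpha>. cmp k \<alpha> p) = p"
proof (rule tmodel_eqI[OF pnt_mem_tmodel assms])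
  fix \<alpha> :: index assume "\<alpha> \<in> idx (Suc k)"
  then show "cmp k \<alpha> (pnt k (cmp k 0 p) (\<lambda>\<alpha>. cmp k \<alpha> p)) = cmp k \<alpha> p"
    by (auto dest!: idx_cases simp: cmp_pnt)
qed auto

section \<open>The bundle charts of the iterated tangent bundles\<close>

lemma vbD:
  shows base_manifold: "manifold sc B" and total_manifold: "manifold sc (total F)"
    and base_model: "model B = Valpha 0" and total_model: "model (total F) = range vpt"
    and total_ind: "ind (total F) = I" and proj_mem: "proj F \<in> pts (total F) \<rightarrow> pts B"
  using F unfolding vector_bundle_def Valpha_def by auto

lemma vbundle_chart:
  assumes "i \<in> I"
  shows total_cdom: "cdom (total F) i = {f \<in> pts (total F). proj F f \<in> cdom B i}"
    and total_image: "chart (total F) i ` cdom (total F) i =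
          {vpt (x, w) | x w. vpt (x, 0) \<in> chart B i ` cdom B i}"
    and total_proj: "\<And>f x w. f \<in> cdom (total F) i \<Longrightarrow> chart (total F) i f = vpt (x, w) \<Longrightarrow>
            chart B i (proj F f) = vpt (x, 0)"
  using F assms unfolding vector_bundle_def by blast+

lemma total_transition_hom:
  assumes "i \<in> I" "j \<in> I" "vpt (x, 0) \<in> overlap B i j"
  shows "module_hom sW sW (\<lambda>w. snd (fst (transition (total F) i j (vpt (x, w)) [])))"
proof -
  have "\<forall>i\<in>I. \<forall>j\<in>I. \<forall>x. vpt (x, 0) \<in> overlap B i j \<longrightarrow>
      module_hom sW sW (\<lambda>w. snd (fst (transition (total F) i j (vpt (x, w)) [])))"
    using F unfolding vector_bundle_def by (elim conjE) assumption
  then show ?thesis using assms by blast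
qed

text \<open>The transition maps of the axes \<open>F\<^sup>\<alpha>\<close>: those of \<open>TM\<close> and of \<open>F\<close>.\<close>

definition atrans :: "'i \<Rightarrow> 'i \<Rightarrow> index \<Rightarrow> ('v \<times> 'w, 'k) pt \<Rightarrow> ('v \<times> 'w, 'k) pt \<Rightarrow> ('v \<times> 'w, 'k) pt" where
  "atrans i j \<alpha> x v = (if \<alpha> 0 = 0
     then diff sc (model B) (model B) (overlap B i j) (transition B i j) x v
     else vpt (0, snd (fst (transition (total F) i j (x + v) []))))"

lemma overlap_base_subset: "i \<in> I \<Longrightarrow> overlap B i j \<subseteq> Valpha 0"
  using openin_imp_subset[OF manifold_openin_image[OF base_manifold]] unfolding overlap_def base_model
  by blast

lemma base_image_subset: "i \<in> I \<Longrightarrow> chart B i ` cdom B i \<subseteq> Valpha 0"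
  using openin_imp_subset[OF manifold_openin_image[OF base_manifold]] unfolding base_model by blast

lemma base_subspace: "P.subspace (model B)"
  unfolding base_model by (rule subspace_Valpha)

lemma Valpha_V: "\<alpha> 0 = 0 \<Longrightarrow> (Valpha \<alpha> :: ('v \<times> 'w, 'k) pt set) = Valpha 0"
  unfolding Valpha_def by simp

lemma ValphaE:
  assumes "u \<in> Valpha \<alpha>" "\<alpha> 0 \<noteq> 0" obtains w where "u = vpt (0, w)"
  using assms unfolding Valpha_def by auto

lemma Valpha0E:
  assumes "u \<in> Valpha 0" obtains w where "u = vpt (w, 0)"
  using assms unfolding Valpha_def by auto

text \<open>Linearity holds for \<open>TM\<close> by the properties of \<open>d\<phi>(x)\<close>, and for \<open>F\<close> by the definition of a
  vector bundle.\<close>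

lemma atrans_lin:
  assumes ij: "i \<in> I" "j \<in> I" and x: "x \<in> overlap B i j" and u: "u \<in> Valpha \<alpha>"
  shows atrans_mem: "atrans i j \<alpha> x u \<in> Valpha \<alpha>"
    and atrans_add: "v \<in> Valpha \<alpha> \<Longrightarrow> atrans i j \<alpha> x (u + v) = atrans i j \<alpha> x u + atrans i j \<alpha> x v"
    and atrans_scale: "atrans i j \<alpha> x (t *\<^sub>p u) = t *\<^sub>p atrans i j \<alpha> x u"
proof -
  note S = base_subspace
  note C = transition_C1[OF base_manifold S ij] and ov = openin_overlap[OF base_manifold S ij]
  have "atrans i j \<alpha> x u \<in> Valpha \<alpha> \<and>
    (v \<in> Valpha \<alpha> \<longrightarrow> atrans i j \<alpha> x (u + v) = atrans i j \<alpha> x u + atrans i j \<alpha> x v) \<and>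
    atrans i j \<alpha> x (t *\<^sub>p u) = t *\<^sub>p atrans i j \<alpha> x u"
  proof (cases "\<alpha> 0 = 0")
    case True
    note [simp] = Valpha_V[of \<alpha>, OF True, folded base_model]
    show ?thesis
      using True u diff_mem[OF C x] diff_add[OF S ov C x] diff_scale[OF S ov C x]
      by (auto simp: atrans_def)
  next
    case False
    obtain y where y: "x = vpt (y, 0)" using x overlap_base_subset[OF ij(1), of j] by (meson Valpha0E subsetD)
    interpret h: module_hom sW sW "\<lambda>w. snd (fst (transition (total F) i j (vpt (y, w)) []))"
      using total_transition_hom[OF ij] x y by blast
    obtain w where w: "u = vpt (0, w)" using u False by (rule ValphaE)
    show ?thesis
      using False w
      by (auto simp: atrans_def y vpt_add pscale_vpt_W h.add h.scale elim!: ValphaE) (simp add: Valpha_def)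
  qed
  then show "atrans i j \<alpha> x u \<in> Valpha \<alpha>"
    "v \<in> Valpha \<alpha> \<Longrightarrow> atrans i j \<alpha> x (u + v) = atrans i j \<alpha> x u + atrans i j \<alpha> x v"
    "atrans i j \<alpha> x (t *\<^sub>p u) = t *\<^sub>p atrans i j \<alpha> x u" by blast+
qed

text \<open>\<open>N\<close> is a bundle with projection \<open>\<pi>\<close>, whose \<open>i\<close>-th chart is defined over the whole domain of the
  \<open>i\<close>-th chart of the base and has full fibers. Both \<open>T\<^sup>kF\<close> and \<open>A\<^sup>kF\<close> are of this form.\<close>

definition fibred :: "nat \<Rightarrow> ('p, 'i, ('v \<times> 'w, 'k) pt) mfd \<Rightarrow> ('p \<Rightarrow> 'm) \<Rightarrow> bool" where
  "fibred k N \<pi> \<longleftrightarrow>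
     manifold sc N \<and> ind N = I \<and> model N = tmodel k \<and> \<pi> \<in> pts N \<rightarrow> pts B \<and>
     (\<forall>i\<in>I. cdom N i = {c \<in> pts N. \<pi> c \<in> cdom B i} \<and>
        chart N i ` cdom N i = {p \<in> tmodel k. cmp k 0 p \<in> chart B i ` cdom B i} \<and>
        (\<forall>c\<in>cdom N i. chart B i (\<pi> c) = cmp k 0 (chart N i c)))"

text \<open>What is needed of the transition maps of the \<open>k\<close>-th iterated tangent bundle: they preserve the
  zero section and each axis, on which they act by the transition maps of \<open>TM\<close> or \<open>F\<close>. The type of
  the points of \<open>N\<close> is arbitrary, because it changes from \<open>F\<close> to \<open>TF\<close>.\<close>

definition prolongation :: "nat \<Rightarrow> ('p, 'i, ('v \<times> 'w, 'k) pt) mfd \<Rightarrow> ('p \<Rightarrow> 'm) \<Rightarrow> bool" where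
  "prolongation k N \<pi> \<longleftrightarrow> fibred k N \<pi> \<and>
     (\<forall>i\<in>I. \<forall>j\<in>I. \<forall>x\<in>overlap B i j.
        transition N i j (eps k 0 x) = eps k 0 (transition B i j x) \<and>
        (\<forall>\<alpha>\<in>pos (Suc k). \<forall>v\<in>Valpha \<alpha>.
           transition N i j (eps k 0 x + eps k \<alpha> v) = eps k 0 (transition B i j x) + eps k \<alpha> (atrans i j \<alpha> x v)))"

lemma fibredD:
  assumes "fibred k N \<pi>"
  shows "manifold sc N" "ind N = I" "model N = tmodel k" "c \<in> pts N \<Longrightarrow> \<pi> c \<in> pts B"
    and "i \<in> I \<Longrightarrow> cdom N i = {c \<in> pts N. \<pi> c \<in> cdom B i}"
    and "i \<in> I \<Longrightarrow> chart N i ` cdom N i = {p \<in> tmodel k. cmp k 0 p \<in> chart B i ` cdom B i}"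
    and "i \<in> I \<Longrightarrow> c \<in> cdom N i \<Longrightarrow> chart B i (\<pi> c) = cmp k 0 (chart N i c)"
  using assms unfolding fibred_def by blast+

lemma prolongation_fibred: "prolongation k N \<pi> \<Longrightarrow> fibred k N \<pi>"
  unfolding prolongation_def by blast

lemma prolongationD:
  assumes "prolongation k N \<pi>"
  shows "i \<in> I \<Longrightarrow> j \<in> I \<Longrightarrow> x \<in> overlap B i j \<Longrightarrow> transition N i j (eps k 0 x) = eps k 0 (transition B i j x)"
    and "i \<in> I \<Longrightarrow> j \<in> I \<Longrightarrow> x \<in> overlap B i j \<Longrightarrow> \<alpha> \<in> pos (Suc k) \<Longrightarrow> v \<in> Valpha \<alpha> \<Longrightarrow>
      transition N i j (eps k 0 x + eps k \<alpha> v) = eps k 0 (transition B i j x) + eps k \<alpha> (atrans i j \<alpha> x v)"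
  using assms unfolding prolongation_def by blast+

text \<open>Two points of \<open>M\<close> in the domain of the \<open>i\<close>-th chart with the same coordinate are equal, so whether
  a point of \<open>N\<close> lies over the \<open>j\<close>-th chart can be read off its base coordinate.\<close>

lemma fibred_overlap:
  assumes N: "fibred k N \<pi>" and i: "i \<in> I" and j: "j \<in> I"
  shows "overlap N i j = {p \<in> tmodel k. cmp k 0 p \<in> overlap B i j}"
proof -
  note D = fibredD[OF N]
  have "p \<in> overlap N i j \<longleftrightarrow> p \<in> tmodel k \<and> cmp k 0 p \<in> overlap B i j" for p
  proof
    assume "p \<in> overlap N i j"
    then obtain c where c: "p = chart N i c" "c \<in> cdom N i" "c \<in> cdom N j" unfolding overlap_def by blast
    then have "cmp k 0 p = chart B i (\<pi> c)" "\<pi> c \<in> cdom B i" "\<pi> c \<in> cdom B j"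
      using D(5,7) i j by auto
    moreover have "p \<in> chart N i ` cdom N i" using c by blast
    then have "p \<in> tmodel k" unfolding D(6)[OF i] by blast
    ultimately show "p \<in> tmodel k \<and> cmp k 0 p \<in> overlap B i j" unfolding overlap_def by blast
  next
    assume p: "p \<in> tmodel k \<and> cmp k 0 p \<in> overlap B i j"
    then obtain b where b: "cmp k 0 p = chart B i b" "b \<in> cdom B i" "b \<in> cdom B j" unfolding overlap_def by blast
    then have "p \<in> chart N i ` cdom N i" using p D(6)[OF i] by auto
    then obtain c where c: "p = chart N i c" "c \<in> cdom N i" by blast
    then have "\<pi> c = b"
      using D(5,7)[OF i] b by (intro inj_onD[OF manifold_inj[OF base_manifold i]]) auto
    then show "p \<in> overlap N i j" using c b D(5)[OF i] D(5)[OF j] unfolding overlap_def by auto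
  qed
  then show ?thesis by blast
qed

lemma total_transition:
  assumes ij: "i \<in> I" "j \<in> I" and x: "vpt (x, 0) \<in> overlap B i j"
  shows "transition (total F) i j (vpt (x, w)) =
    transition B i j (vpt (x, 0)) + vpt (0, snd (fst (transition (total F) i j (vpt (x, w)) [])))"
proof -
  have "vpt (x, w) \<in> chart (total F) i ` cdom (total F) i"
    using x unfolding total_image[OF ij(1)] overlap_def by blast
  then obtain f where f: "vpt (x, w) = chart (total F) i f" "f \<in> cdom (total F) i" by blast
  from x obtain b where b: "vpt (x, 0) = chart B i b" "b \<in> cdom B i" "b \<in> cdom B j" unfolding overlap_def by blast
  have pb: "proj F f = b"
    using total_proj[OF ij(1) f(2) f(1)[symmetric]] b f(2) total_cdom[OF ij(1)]
    by (intro inj_onD[OF manifold_inj[OF base_manifold ij(1)]]) auto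
  have fj: "f \<in> cdom (total F) j" using f(2) pb b(3) total_cdom[OF ij(1)] total_cdom[OF ij(2)] by auto
  have tf: "transition (total F) i j (vpt (x, w)) = chart (total F) j f"
    using transition_chart[OF total_manifold _ f(2)] f(1) total_ind ij by simp
  have "chart (total F) j f \<in> chart (total F) j ` cdom (total F) j" using fj by blast
  then obtain y u where y: "chart (total F) j f = vpt (y, u)" unfolding total_image[OF ij(2)] by blast
  have "transition B i j (vpt (x, 0)) = vpt (y, 0)"
    using transition_chart[OF base_manifold ij(1) b(2)] b(1) total_proj[OF ij(2) fj y] pb by simp
  then show ?thesis unfolding tf y by (simp add: vpt_add)
qed

lemma prolongation_0: "prolongation 0 (total F) (proj F)"
  unfolding prolongation_def fibred_def
proof (intro conjI ballI)
  have cmp0: "cmp 0 0 (vpt (x, w)) = vpt (x, 0)" for x :: 'v and w :: 'w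
    by (simp add: cmp_def)
  fix i assume i: "i \<in> I"
  show "cdom (total F) i = {c \<in> pts (total F). proj F c \<in> cdom B i}" by (rule total_cdom[OF i])
  show im: "chart (total F) i ` cdom (total F) i = {p \<in> tmodel 0. cmp 0 0 p \<in> chart B i ` cdom B i}"
    unfolding total_image[OF i] tmodel_0 by (auto simp: cmp0)
  show "chart B i (proj F c) = cmp 0 0 (chart (total F) i c)" if c: "c \<in> cdom (total F) i" for c
  proof -
    from c have "chart (total F) i c \<in> {vpt (x, w) | x w. vpt (x, 0) \<in> chart B i ` cdom B i}"
      unfolding total_image[OF i, symmetric] by blast
    then obtain x w where xw: "chart (total F) i c = vpt (x, w)" by blast
    then show ?thesis using total_proj[OF i c xw] by (simp add: cmp0)
  qed
  fix j x assume j: "j \<in> I" and x: "x \<in> overlap B i j"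
  then obtain y where y: "x = vpt (y, 0)"
    using overlap_base_subset[OF i, of j] by (meson Valpha0E subsetD)
  interpret h: module_hom sW sW "\<lambda>w. snd (fst (transition (total F) i j (vpt (y, w)) []))"
    using total_transition_hom[OF i j] x y by blast
  note tt = total_transition[OF i j x[unfolded y]]
  have tx: "transition B i j x \<in> range vpt"
    using smooth_mem[OF manifold_transition_smooth[OF base_manifold i j] x] Valpha_subset
    unfolding base_model by blast
  have xr: "x \<in> range vpt" unfolding y by blast
  have h0: "vpt (0, snd (fst (transition (total F) i j (vpt (y, 0)) []))) = 0"
    using h.zero by (simp flip: zero_prod_def)
  show "transition (total F) i j (eps 0 0 x) = eps 0 0 (transition B i j x)"
    unfolding eps_0_Valpha[OF tx] eps_0_Valpha[OF xr] using tt[of 0, unfolded h0] y by simp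
  fix \<alpha> :: index and v :: "('v \<times> 'w, 'k) pt" assume a: "\<alpha> \<in> pos (Suc 0)" and v: "v \<in> Valpha \<alpha>"
  have a0: "\<alpha> 0 \<noteq> 0"
  proof
    assume "\<alpha> 0 = 0"
    then have "\<alpha> = 0" using a idxD(2)[of \<alpha> "Suc 0"] unfolding pos_def
      by (intro ext) (metis DiffD1 Suc_leI gr0I zero_fun_apply)
    then show False using a by simp
  qed
  obtain w where w: "v = vpt (0, w)" using v a0 by (rule ValphaE)
  have av: "atrans i j \<alpha> x v \<in> range vpt" using atrans_mem[OF i j x v] Valpha_subset by blast
  have vr: "v \<in> range vpt" using w by blast
  show "transition (total F) i j (eps 0 0 x + eps 0 \<alpha> v) = eps 0 0 (transition B i j x) + eps 0 \<alpha> (atrans i j \<alpha> x v)"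
    unfolding eps_0_Valpha[OF tx] eps_0_Valpha[OF xr] eps_0_Valpha[OF av] eps_0_Valpha[OF vr]
    using tt[of w] a0 by (simp add: y w vpt_add atrans_def)
qed (use vbD tmodel_0 in auto)

text \<open>The transition maps of \<open>TN\<close> are \<open>(p, q) \<mapsto> (f(p), df(p)q)\<close>, and an index either contains the new
  unit or not. If not, the point of the axis has \<open>q = 0\<close>, and \<open>df(p)0 = 0\<close>. If so, \<open>p\<close> is in the zero
  section and \<open>q\<close> on the axis of the index without the new unit; the derivative is found from the
  difference quotient, because \<open>f\<close> is known on the line \<open>p + tq\<close>.\<close>

lemma prolongation_Suc:
  fixes N :: "('p, 'i, ('v \<times> 'w, 'k) pt) mfd"
  assumes P: "prolongation k N \<pi>"
  shows "prolongation (Suc k) (Tan sc N) (\<pi> \<circ> tproj N)"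
  unfolding prolongation_def fibred_def
proof (intro conjI ballI)
  note D = fibredD[OF prolongation_fibred[OF P]] prolongationD[OF P]
  have E: "P.subspace (model N)" unfolding D(3) by (rule subspace_tmodel)
  show "manifold sc (Tan sc N)" by (rule manifold_Tan[OF D(1) E])
  show "ind (Tan sc N) = I" using D(2) by simp
  show "model (Tan sc N) = tmodel (Suc k)" using D(3) by (simp add: tmodel_Suc)
  show "\<pi> \<circ> tproj N \<in> pts (Tan sc N) \<rightarrow> pts B"
    using tproj_mem[OF D(1) E] D(4) by auto
  fix i assume i: "i \<in> I"
  then have iN: "i \<in> ind N" using D(2) by simp
  show "cdom (Tan sc N) i = {c \<in> pts (Tan sc N). (\<pi> \<circ> tproj N) c \<in> cdom B i}"
    using tproj_mem_cdom_iff[OF D(1) E _ iN] tproj_mem[OF D(1) E] D(5)[OF i] pts_Tan[OF D(1) E] iN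
    by auto
  show "chart (Tan sc N) i ` cdom (Tan sc N) i = {p \<in> tmodel (Suc k). cmp (Suc k) 0 p \<in> chart B i ` cdom B i}"
  proof -
    have "chart (Tan sc N) i ` cdom (Tan sc N) i = prd (chart N i ` cdom N i) (tmodel k)"
      using tchart_image[OF D(1) E iN iN] by (simp add: overlap_self D(3))
    then show ?thesis unfolding D(6)[OF i] tmodel_Suc by (auto simp: mem_prd_iff cmp_Suc_0)
  qed
  show "chart B i ((\<pi> \<circ> tproj N) c) = cmp (Suc k) 0 (chart (Tan sc N) i c)"
    if "c \<in> cdom (Tan sc N) i" for c
    using tproj_chart[OF D(1) E iN, of c] that D(7)[OF i] by (simp add: cmp_Suc_0)
  fix j x assume j: "j \<in> I" and x: "x \<in> overlap B i j"
  then have jN: "j \<in> ind N" using D(2) by simp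
  let ?\<phi> = "transition B i j" and ?f = "transition N i j"
  let ?d = "diff sc (model N) (model N) (overlap N i j) ?f"
  note ov = fibred_overlap[OF prolongation_fibred[OF P] i j]
  note oN = openin_overlap[OF D(1) E iN jN] and CN = transition_C1[OF D(1) E iN jN]
  have xV: "x \<in> Valpha 0" using overlap_base_subset[OF i] x by blast
  have idx: "\<beta> \<in> idx (Suc k)" if "\<beta> \<in> pos (Suc k)" for \<beta> using that pos_subset_idx by blast
  have c0: "cmp k 0 (eps k 0 y) = y" if "y \<in> Valpha 0" for y :: "('v \<times> 'w, 'k) pt"
    using cmp_eps[OF zero_mem_idx zero_mem_idx that] by simp
  have m0: "eps k 0 y \<in> overlap N i j" if "y \<in> overlap B i j" for y
  proof -
    have "y \<in> Valpha 0" using overlap_base_subset[OF i] that by blast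
    then show ?thesis unfolding ov using that by (simp add: c0 eps_mem_tmodel)
  qed
  have m1: "eps k 0 x + eps k \<alpha> v \<in> overlap N i j" if "\<alpha> \<in> pos (Suc k)" "v \<in> Valpha \<alpha>" for \<alpha> v
    unfolding ov
    using x xV that cmp_eps[OF idx[OF that(1)] zero_mem_idx that(2)]
    by (auto simp: cmp_add c0 eps_mem_tmodel P.subspace_add[OF subspace_tmodel])
  have d0: "?d p 0 = 0" if "p \<in> overlap N i j" for p
    by (rule diff_zero[OF E oN CN that])
  have T: "transition (Tan sc N) i j (pair p q) = pair (?f p) (?d p q)"
    if "p \<in> overlap N i j" "q \<in> tmodel k" for p q
    using transition_Tan[OF D(1) E iN jN that(1)] that(2) D(3) by simp
  have zt: "(0 :: ('v \<times> 'w, 'k) pt) \<in> tmodel k" by (rule P.subspace_0[OF subspace_tmodel])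
  show "transition (Tan sc N) i j (eps (Suc k) 0 x) = eps (Suc k) 0 (?\<phi> x)"
    using T[OF m0[OF x] zt] d0[OF m0[OF x]] D(8)[OF i j x] by (simp add: eps_Suc)
  fix \<alpha> :: index and v :: "('v \<times> 'w, 'k) pt"
  assume a: "\<alpha> \<in> pos (Suc (Suc k))" and v: "v \<in> Valpha \<alpha>"
  define \<alpha>' where "\<alpha>' = \<alpha>(Suc k := 0)"
  have a': "\<alpha>' \<in> idx (Suc k)" using a unfolding \<alpha>'_def pos_def by (auto intro: idx_upd)
  have ea: "eps k \<alpha>' = (eps k \<alpha> :: ('v \<times> 'w, 'k) pt \<Rightarrow> _)"
    "Valpha \<alpha>' = (Valpha \<alpha> :: ('v \<times> 'w, 'k) pt set)" "atrans i j \<alpha>' x v = atrans i j \<alpha> x v"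
    unfolding \<alpha>'_def atrans_def by auto
  \<comment> \<open>\<open>\<alpha>'\<close> is \<open>\<alpha>\<close> without the new unit.\<close>
  show "transition (Tan sc N) i j (eps (Suc k) 0 x + eps (Suc k) \<alpha> v) =
      eps (Suc k) 0 (?\<phi> x) + eps (Suc k) \<alpha> (atrans i j \<alpha> x v)"
  proof (cases "\<alpha> (Suc k) = 1")
    case False
    then have "\<alpha> (Suc k) = 0" using a idxD(1)[of \<alpha> "Suc (Suc k)" "Suc k"] unfolding pos_def by auto
    then have "\<alpha>' = \<alpha>" unfolding \<alpha>'_def by auto
    then have ap: "\<alpha> \<in> pos (Suc k)" using a a' unfolding pos_def by auto
    show ?thesis
      using T[OF m1[OF ap v] zt] d0[OF m1[OF ap v]] D(9)[OF i j x ap v] False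
      by (simp add: eps_Suc pair_add)
  next
    case True
    have q: "eps k \<alpha> v \<in> tmodel k" by (rule eps_mem_tmodel[OF v])
    have "?d (eps k 0 x) (eps k \<alpha> v) = eps k \<alpha> (atrans i j \<alpha> x v)"
    proof (cases "\<alpha>' = 0")
      case False
      \<comment> \<open>On this line \<open>f\<close> is affine, by the assumption on \<open>N\<close> and homogeneity.\<close>
      then have ap: "\<alpha>' \<in> pos (Suc k)" using a' unfolding pos_def by auto
      show ?thesis
      proof (rule diff_eqI[OF E oN CN m0[OF x], where N = UNIV and h = "\<lambda>_. eps k \<alpha> (atrans i j \<alpha> x v)"])
        fix t :: 'k
        have tv: "t *\<^sub>p v \<in> Valpha \<alpha>'" using P.subspace_scale[OF subspace_Valpha v] ea by simp
        have "?f (eps k 0 x + t *\<^sub>p eps k \<alpha> v) = eps k 0 (?\<phi> x) + t *\<^sub>p eps k \<alpha> (atrans i j \<alpha> x v)"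
          using D(9)[OF i j x ap tv] atrans_scale[OF i j x v] ea
          by (simp add: eps_pscale atrans_def \<alpha>'_def)
        then show "eps k 0 x + t *\<^sub>p eps k \<alpha> v \<in> overlap N i j \<and>
            ?f (eps k 0 x + t *\<^sub>p eps k \<alpha> v) - ?f (eps k 0 x) = t *\<^sub>p eps k \<alpha> (atrans i j \<alpha> x v)"
          using m1[OF ap tv] D(8)[OF i j x] ea by (simp add: eps_pscale)
      qed (use q D(3) in auto)
    next
      case True
      \<comment> \<open>The line stays in the zero section, where \<open>f\<close> is the transition map of the base.\<close>
      have e0: "eps k \<alpha> = (eps k 0 :: ('v \<times> 'w, 'k) pt \<Rightarrow> _)" using ea(1) True by simp
      have \<alpha>0: "\<alpha> 0 = 0" using True unfolding \<alpha>'_def by (metis fun_upd_apply nat.distinct(1) zero_fun_apply)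
      have v0: "v \<in> model B" using v \<alpha>0 Valpha_V base_model by blast
      have xB: "x \<in> model B" using xV base_model by simp
      note CB = transition_C1[OF base_manifold base_subspace i j]
      note oB = openin_overlap[OF base_manifold base_subspace i j]
      note Q = is_quot_quot[OF CB]
      let ?q = "quot sc (model B) (model B) (overlap B i j) ?\<phi>"
      let ?N = "{t. x + t *\<^sub>p v \<in> overlap B i j}"
      have "?d (eps k 0 x) (eps k 0 v) = eps k 0 (?q (pair x (pair v (spt 0))))"
      proof (rule diff_eqI[OF E oN CN m0[OF x], where N = ?N])
        show "open ?N" by (rule open_line[OF oB base_subspace xB v0])
        show "continuous_on ?N (\<lambda>t. eps k 0 (?q (pair x (pair v (spt t)))))"
          by (intro continuous_on_eps continuous_on_quot_line[OF Q x v0])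
        show "eps k 0 x + t *\<^sub>p eps k 0 v \<in> overlap N i j \<and>
            ?f (eps k 0 x + t *\<^sub>p eps k 0 v) - ?f (eps k 0 x) = t *\<^sub>p eps k 0 (?q (pair x (pair v (spt t))))"
          if t: "t \<in> ?N" for t
        proof -
          have e: "eps k 0 x + t *\<^sub>p eps k 0 v = eps k 0 (x + t *\<^sub>p v)"
            by (simp add: eps_add eps_pscale)
          show ?thesis
            unfolding e using t m0[of "x + t *\<^sub>p v"] D(8)[OF i j x] D(8)[OF i j, of "x + t *\<^sub>p v"] is_quotD(2)[OF Q x v0, of t]
            by (simp add: eps_add eps_pscale)
        qed
        show "eps k 0 v \<in> model N" unfolding D(3) e0[symmetric] by (rule q)
        show "0 \<in> ?N" using x by simp
      qed
      then show ?thesis unfolding e0 by (simp add: atrans_def \<alpha>0 diff_def)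
    qed
    then show ?thesis
      using T[OF m0[OF x] q] D(8)[OF i j x] True by (simp add: eps_Suc pair_add)
  qed
qed

lemma prolongation_Tpow:
  "prolongation (Suc n) (Tpow sc (Suc n) (total F)) (proj F \<circ> Tpow_proj sc n (total F))"
proof (induction n)
  case 0
  show ?case using prolongation_Suc[OF prolongation_0] by (simp add: Tpow_def comp_def)
next
  case (Suc n)
  have "Tpow sc (Suc (Suc n)) (total F) = Tan sc (Tpow sc (Suc n) (total F))"
    by (simp add: Tpow_def)
  then show ?case
    unfolding Tpow_proj.simps comp_assoc[symmetric] using prolongation_Suc[OF Suc.IH] by (simp only:)
qed

lemma prolongation_TkF:
  assumes "k \<ge> 1"
  shows "prolongation k (TkF sV sW k F) (TkF_proj sV sW k F)"
  using prolongation_Tpow[of "k - 1"] assms by (simp add: TkF_def TkF_proj_def)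

end

section \<open>Points over a bundle chart\<close>

lemma pnt_cong: "(\<And>\<alpha>. \<alpha> \<in> pos (Suc k) \<Longrightarrow> v \<alpha> = w \<alpha>) \<Longrightarrow> pnt k x v = pnt k x w"
  unfolding pnt_def by (simp cong: sum.cong)

lemma EfibD: "v \<in> Efib k \<Longrightarrow> \<alpha> \<in> pos (Suc k) \<Longrightarrow> v \<alpha> \<in> Valpha \<alpha>"
  using PiE_mem[of v "pos (Suc k)" Valpha \<alpha>] by blast

lemma Efib_eqI:
  "v \<in> Efib k \<Longrightarrow> w \<in> Efib k \<Longrightarrow> (\<And>\<alpha>. \<alpha> \<in> pos (Suc k) \<Longrightarrow> v \<alpha> = w \<alpha>) \<Longrightarrow> v = w"
  by (rule PiE_ext)

text \<open>The element of \<open>E\<close> that lies on the axis \<open>\<alpha>\<close>.\<close>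

definition single :: "nat \<Rightarrow> index \<Rightarrow> ('v::zero \<times> 'w::zero, 'k::zero) pt \<Rightarrow> index \<Rightarrow> ('v \<times> 'w, 'k) pt" where
  "single k \<alpha> u = (\<lambda>\<beta>\<in>pos (Suc k). if \<beta> = \<alpha> then u else 0)"

lemma single_mem: "u \<in> Valpha \<alpha> \<Longrightarrow> single k \<alpha> u \<in> Efib k"
  unfolding single_def by auto

lemma pnt_single:
  "\<alpha> \<in> pos (Suc k) \<Longrightarrow> pnt k x (single k \<alpha> u) = eps k 0 x + eps k \<alpha> u"
proof -
  assume a: "\<alpha> \<in> pos (Suc k)"
  have "(\<Sum>\<beta>\<in>pos (Suc k). eps k \<beta> (single k \<alpha> u \<beta>)) = (\<Sum>\<beta>\<in>pos (Suc k). if \<alpha> = \<beta> then eps k \<alpha> u else 0)"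
    by (rule sum.cong) (auto simp: single_def)
  then show ?thesis using a unfolding pnt_def by (simp add: sum.delta')
qed

text \<open>The point over \<open>x\<close> with fiber coordinates \<open>v\<close> in the \<open>i\<close>-th chart of a bundle, and conversely the
  fiber coordinates of a point.\<close>

definition fpt where
  "fpt k F N i x v = cinv N i (pnt k (chart (base F) i x) v)"

definition fcoord where
  "fcoord k N i c = (\<lambda>\<alpha>\<in>pos (Suc k). cmp k \<alpha> (chart N i c))"

lemma fcoord_mem: "fcoord k N i c \<in> Efib k"
  unfolding fcoord_def by auto

context vbundle_setup begin

lemma fibred_point:
  assumes N: "fibred k N \<pi>" and i: "i \<in> I" and x: "x \<in> cdom B i" and v: "v \<in> Efib k"
  shows fpt_chart: "chart N i (fpt k F N i x v) = pnt k (chart B i x) v"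
    and fpt_cdom: "fpt k F N i x v \<in> cdom N i"
    and fpt_pts: "fpt k F N i x v \<in> pts N"
    and fpt_proj: "\<pi> (fpt k F N i x v) = x"
    and fcoord_fpt: "fcoord k N i (fpt k F N i x v) = v"
proof -
  note D = fibredD[OF N]
  have xV: "chart B i x \<in> Valpha 0" using base_image_subset[OF i] x by blast
  note cp = cmp_pnt[OF xV EfibD[OF v]]
  have "pnt k (chart B i x) v \<in> chart N i ` cdom N i"
    unfolding D(6)[OF i] using x cp(2) pnt_mem_tmodel[OF xV EfibD[OF v]] by simp
  then show ch: "chart N i (fpt k F N i x v) = pnt k (chart B i x) v"
    and cd: "fpt k F N i x v \<in> cdom N i"
    unfolding fpt_def by (rule chart_cinv cinv_mem)+
  then show "fpt k F N i x v \<in> pts N" using D(5)[OF i] by blast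
  have "chart B i (\<pi> (fpt k F N i x v)) = chart B i x" using D(7)[OF i cd] ch cp(2) by simp
  then show "\<pi> (fpt k F N i x v) = x"
    using inj_onD[OF manifold_inj[OF base_manifold i]] cd x D(5)[OF i] by blast
  show "fcoord k N i (fpt k F N i x v) = v"
    unfolding fcoord_def ch using v cp(1) by (intro Efib_eqI[OF _ v]) auto
qed

lemma fpt_fcoord:
  assumes N: "fibred k N \<pi>" and i: "i \<in> I" and c: "c \<in> pts N" "\<pi> c \<in> cdom B i"
  shows "fpt k F N i (\<pi> c) (fcoord k N i c) = c"
proof -
  note D = fibredD[OF N]
  have cd: "c \<in> cdom N i" using c D(5)[OF i] by blast
  have "chart N i c \<in> tmodel k" using D(6)[OF i] cd by blast
  have "pnt k (chart B i (\<pi> c)) (fcoord k N i c) = pnt k (cmp k 0 (chart N i c)) (\<lambda>\<alpha>. cmp k \<alpha> (chart N i c))"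
    unfolding D(7)[OF i cd] by (rule pnt_cong) (simp add: fcoord_def)
  also have "\<dots> = chart N i c" by (rule pnt_cmp) fact
  finally show ?thesis unfolding fpt_def using cinv_chart[OF D(1) _ cd] D(2) i by simp
qed

lemma fpt_inj:
  assumes "fibred k N \<pi>" "i \<in> I" "x \<in> cdom B i" "v \<in> Efib k" "w \<in> Efib k"
    "fpt k F N i x v = fpt k F N i x w"
  shows "v = w"
proof -
  have "v = fcoord k N i (fpt k F N i x v)" by (rule fcoord_fpt[OF assms(1-4), symmetric])
  also have "\<dots> = fcoord k N i (fpt k F N i x w)" by (rule arg_cong[OF assms(6)])
  also have "\<dots> = w" by (rule fcoord_fpt[OF assms(1-3,5)])
  finally show ?thesis .
qed

lemma fibred_mem_cdom_iff:
  "fibred k N \<pi> \<Longrightarrow> i \<in> I \<Longrightarrow> c \<in> pts N \<Longrightarrow> c \<in> cdom N i \<longleftrightarrow> \<pi> c \<in> cdom B i"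
  using fibredD(5) by blast

lemma base_cover: "x \<in> pts B \<Longrightarrow> \<exists>i\<in>I. x \<in> cdom B i"
  using manifold_cover[OF base_manifold] by blast

lemma base_cdom_subset: "i \<in> I \<Longrightarrow> cdom B i \<subseteq> pts B"
  by (rule manifold_cdom_subset[OF base_manifold])

section \<open>The axes\<close>

text \<open>The fiber coordinates of an element of \<open>F\<^sup>\<alpha>\<close> form a vector of \<open>V\<^sub>\<alpha>\<close> and change by \<open>atrans\<close>: for
  \<open>TM\<close> by construction of the tangent bundle, for \<open>F\<close> because the second component of its transition
  maps is what \<open>atrans\<close> picks out.\<close>

lemma Fcoord_change:
  assumes i: "i \<in> I" and j: "j \<in> I" and x: "x \<in> cdom B i" "x \<in> cdom B j"
    and u: "u \<in> Falpha sV sW F \<alpha> x"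
  shows Fcoord_mem: "Fcoord F i u \<in> Valpha \<alpha>"
    and Fcoord_trans: "Fcoord F j u = atrans i j \<alpha> (chart B i x) (Fcoord F i u)"
proof -
  have xo: "chart B i x \<in> overlap B i j" using x unfolding overlap_def by blast
  have "Fcoord F i u \<in> Valpha \<alpha> \<and> Fcoord F j u = atrans i j \<alpha> (chart B i x) (Fcoord F i u)"
  proof (cases "\<alpha> 0 = 0")
    case True
    then obtain c where c: "u = Inl c" "c \<in> pts (Tan sc B)" "tproj B c = x"
      using u unfolding Falpha_def by auto
    have "c \<in> tdom sc B i" using tproj_mem_cdom_iff[OF base_manifold base_subspace c(2) i] c x by simp
    then obtain y v where y: "c = tclass sc B i y v" "y \<in> chart B i ` cdom B i" "v \<in> model B"
      by (auto elim: tdomE[OF base_manifold base_subspace])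
    have "cinv B i y = x" using tproj_tclass[OF base_manifold base_subspace i y(2)] c y by simp
    then have "y = chart B i x" using chart_cinv[OF y(2)] by simp
    then show ?thesis
      using True y c xo tchart_tclass[OF base_manifold base_subspace i j, of "chart B i x" v]
        tchart_tclass_self[OF base_manifold base_subspace i, of "chart B i x" v] Valpha_V[of \<alpha>, OF True] base_model
      by (simp add: Fcoord_def atrans_def)
  next
    case False
    then obtain f where f: "u = Inr f" "f \<in> pts (total F)" "proj F f = x"
      using u unfolding Falpha_def by auto
    then have fc: "f \<in> cdom (total F) i" "f \<in> cdom (total F) j"
      using total_cdom[OF i] total_cdom[OF j] x by auto
    then have "chart (total F) i f \<in> {vpt (x, w) | x w. vpt (x, 0) \<in> chart B i ` cdom B i}"
      using total_image[OF i] by blast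
    then obtain y w where yw: "chart (total F) i f = vpt (y, w)" by blast
    have y: "chart B i x = vpt (y, 0)" using total_proj[OF i fc(1) yw] f by simp
    have t: "transition (total F) i j (chart B i x + vpt (0, w)) = chart (total F) j f"
      using transition_chart[OF total_manifold _ fc(1)] i total_ind by (simp add: y vpt_add yw)
    show ?thesis using False f yw t by (simp add: Fcoord_def atrans_def Valpha_def)
  qed
  then show "Fcoord F i u \<in> Valpha \<alpha>" "Fcoord F j u = atrans i j \<alpha> (chart B i x) (Fcoord F i u)" by auto
qed

lemma Fcoord_bij:
  assumes i: "i \<in> I" and x: "x \<in> cdom B i"
  shows Fcoord_surj: "v \<in> Valpha \<alpha> \<Longrightarrow> \<exists>u\<in>Falpha sV sW F \<alpha> x. Fcoord F i u = v"
    and Fcoord_inj: "u \<in> Falpha sV sW F \<alpha> x \<Longrightarrow> u' \<in> Falpha sV sW F \<alpha> x \<Longrightarrow> Fcoord F i u = Fcoord F i u' \<Longrightarrow> u = u'"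
proof -
  have xi: "chart B i x \<in> chart B i ` cdom B i" using x by blast
  note bm = base_manifold base_subspace
  show "\<exists>u\<in>Falpha sV sW F \<alpha> x. Fcoord F i u = v" if v: "v \<in> Valpha \<alpha>"
  proof (cases "\<alpha> 0 = 0")
    case True
    then have vm: "v \<in> model B" using v Valpha_V base_model by blast
    have "tclass sc B i (chart B i x) v \<in> pts (Tan sc B)"
      unfolding pts_Tan[OF bm] using tclass_mem_tdom[OF bm xi vm] i by blast
    moreover have "tproj B (tclass sc B i (chart B i x) v) = x"
      using tproj_tclass[OF bm i xi] cinv_chart[OF base_manifold i x] by simp
    ultimately show ?thesis
      using True tchart_tclass_self[OF bm i xi vm]
      by (intro bexI[of _ "Inl (tclass sc B i (chart B i x) v)"]) (auto simp: Falpha_def Fcoord_def)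
  next
    case False
    obtain w where w: "v = vpt (0, w)" using v False by (rule ValphaE)
    obtain y where y: "chart B i x = vpt (y, 0)" using base_image_subset[OF i] xi by (meson Valpha0E subsetD)
    have "vpt (y, w) \<in> chart (total F) i ` cdom (total F) i"
      unfolding total_image[OF i] using y xi by (metis (mono_tags, lifting) mem_Collect_eq)
    then obtain f where f: "chart (total F) i f = vpt (y, w)" "f \<in> cdom (total F) i" by force
    have "proj F f = x"
      using total_proj[OF i f(2,1)] y f(2) x total_cdom[OF i]
      by (intro inj_onD[OF manifold_inj[OF base_manifold i]]) auto
    then show ?thesis
      using False f w total_cdom[OF i] by (intro bexI[of _ "Inr f"]) (auto simp: Falpha_def Fcoord_def)
  qed
  show "u = u'" if u: "u \<in> Falpha sV sW F \<alpha> x" "u' \<in> Falpha sV sW F \<alpha> x" "Fcoord F i u = Fcoord F i u'"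
  proof (cases "\<alpha> 0 = 0")
    case True
    have *: "\<exists>v\<in>model B. u = Inl (tclass sc B i (chart B i x) v) \<and> Fcoord F i u = v"
      if um: "u \<in> Falpha sV sW F \<alpha> x" for u
    proof -
      obtain c where c: "u = Inl c" "c \<in> pts (Tan sc B)" "tproj B c = x"
        using um True unfolding Falpha_def by auto
      have "c \<in> tdom sc B i" using tproj_mem_cdom_iff[OF bm c(2) i] c x by simp
      then obtain y v where y: "c = tclass sc B i y v" "y \<in> chart B i ` cdom B i" "v \<in> model B"
        by (auto elim: tdomE[OF bm])
      have "cinv B i y = x" using tproj_tclass[OF bm i y(2)] c y by simp
      then have "y = chart B i x" using chart_cinv[OF y(2)] by simp
      then show ?thesis using y c tchart_tclass_self[OF bm i xi y(3)] by (auto simp: Fcoord_def)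
    qed
    show ?thesis using *[OF u(1)] *[OF u(2)] u(3) by auto
  next
    case False
    have *: "\<exists>f\<in>cdom (total F) i. u = Inr f \<and> chart (total F) i f = chart B i x + Fcoord F i u"
      if um: "u \<in> Falpha sV sW F \<alpha> x" for u
    proof -
      obtain f where f: "u = Inr f" "f \<in> pts (total F)" "proj F f = x"
        using um False unfolding Falpha_def by auto
      then have fc: "f \<in> cdom (total F) i" using total_cdom[OF i] x by auto
      then have "chart (total F) i f \<in> {vpt (x, w) | x w. vpt (x, 0) \<in> chart B i ` cdom B i}"
        using total_image[OF i] by blast
      then obtain y w where yw: "chart (total F) i f = vpt (y, w)" by blast
      then show ?thesis using total_proj[OF i fc yw] f fc by (auto simp: Fcoord_def vpt_add)
    qed
    show ?thesis
      using *[OF u(1)] *[OF u(2)] u(3) inj_onD[OF manifold_inj[OF total_manifold], of i] total_ind i by auto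
  qed
qed

text \<open>An element of an axis may be prescribed by its coordinates in all bundle charts, provided that
  they are related by the transition maps.\<close>

lemma axis_the:
  assumes x: "x \<in> pts B"
    and val: "\<And>i. i \<in> I \<Longrightarrow> x \<in> cdom B i \<Longrightarrow> val i \<in> Valpha \<alpha>"
    and trans: "\<And>i j. i \<in> I \<Longrightarrow> j \<in> I \<Longrightarrow> x \<in> cdom B i \<Longrightarrow> x \<in> cdom B j \<Longrightarrow>
      val j = atrans i j \<alpha> (chart B i x) (val i)"
    and c: "c = (THE c. c \<in> Falpha sV sW F \<alpha> x \<and> (\<forall>i\<in>I. x \<in> cdom B i \<longrightarrow> Fcoord F i c = val i))"
  shows "c \<in> Falpha sV sW F \<alpha> x" "i \<in> I \<Longrightarrow> x \<in> cdom B i \<Longrightarrow> Fcoord F i c = val i"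
proof -
  obtain i where i: "i \<in> I" "x \<in> cdom B i" using base_cover[OF x] by blast
  obtain u where u: "u \<in> Falpha sV sW F \<alpha> x" "Fcoord F i u = val i" using Fcoord_surj[OF i val[OF i]] by blast
  have "c \<in> Falpha sV sW F \<alpha> x \<and> (\<forall>i\<in>I. x \<in> cdom B i \<longrightarrow> Fcoord F i c = val i)"
    unfolding c
  proof (rule theI)
    show "u \<in> Falpha sV sW F \<alpha> x \<and> (\<forall>j\<in>I. x \<in> cdom B j \<longrightarrow> Fcoord F j u = val j)"
      using u Fcoord_trans[OF i(1) _ i(2) _ u(1)] trans[OF i(1) _ i(2)] by auto
    show "c = u" if "c \<in> Falpha sV sW F \<alpha> x \<and> (\<forall>j\<in>I. x \<in> cdom B j \<longrightarrow> Fcoord F j c = val j)" for c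
      using that i u by (intro Fcoord_inj[OF i]) auto
  qed
  then show "c \<in> Falpha sV sW F \<alpha> x" "i \<in> I \<Longrightarrow> x \<in> cdom B i \<Longrightarrow> Fcoord F i c = val i" for i by blast+
qed

lemma chart_mem_overlap: "x \<in> cdom B i \<Longrightarrow> x \<in> cdom B j \<Longrightarrow> chart B i x \<in> overlap B i j"
  unfolding overlap_def by blast

lemma axis_add:
  fixes \<alpha> :: index
  assumes x: "x \<in> pts B" and a: "a \<in> Falpha sV sW F \<alpha> x" and b: "b \<in> Falpha sV sW F \<alpha> x"
  shows Fadd_mem: "Fadd sV sW F \<alpha> x a b \<in> Falpha sV sW F \<alpha> x"
    and Fcoord_Fadd: "i \<in> I \<Longrightarrow> x \<in> cdom B i \<Longrightarrow> Fcoord F i (Fadd sV sW F \<alpha> x a b) = Fcoord F i a + Fcoord F i b"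
proof -
  have v: "Fcoord F i a + Fcoord F i b \<in> Valpha \<alpha>" if "i \<in> I" "x \<in> cdom B i" for i
    using that a b by (intro P.subspace_add[OF subspace_Valpha] Fcoord_mem[OF that(1,1,2,2)])
  have t: "Fcoord F j a + Fcoord F j b = atrans i j \<alpha> (chart B i x) (Fcoord F i a + Fcoord F i b)"
    if "i \<in> I" "j \<in> I" "x \<in> cdom B i" "x \<in> cdom B j" for i j
    using Fcoord_trans[OF that a] Fcoord_trans[OF that b]
      atrans_add[OF that(1,2) chart_mem_overlap[OF that(3,4)] Fcoord_mem[OF that a] Fcoord_mem[OF that b]]
    by simp
  show "Fadd sV sW F \<alpha> x a b \<in> Falpha sV sW F \<alpha> x" unfolding Fadd_def by (rule axis_the(1)[where val = "\<lambda>i. Fcoord F i a + Fcoord F i b", OF x v t refl])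
  show "i \<in> I \<Longrightarrow> x \<in> cdom B i \<Longrightarrow> Fcoord F i (Fadd sV sW F \<alpha> x a b) = Fcoord F i a + Fcoord F i b"
    unfolding Fadd_def by (rule axis_the(2)[where val = "\<lambda>i. Fcoord F i a + Fcoord F i b", OF x v t refl])
qed

lemma axis_scale:
  fixes \<alpha> :: index
  assumes x: "x \<in> pts B" and a: "a \<in> Falpha sV sW F \<alpha> x"
  shows Fscale_mem: "Fscale sV sW F \<alpha> x t a \<in> Falpha sV sW F \<alpha> x"
    and Fcoord_Fscale: "i \<in> I \<Longrightarrow> x \<in> cdom B i \<Longrightarrow> Fcoord F i (Fscale sV sW F \<alpha> x t a) = t *\<^sub>p Fcoord F i a"
proof -
  have v: "t *\<^sub>p Fcoord F i a \<in> Valpha \<alpha>" if "i \<in> I" "x \<in> cdom B i" for i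
    using that a by (intro P.subspace_scale[OF subspace_Valpha] Fcoord_mem[OF that(1,1,2,2)])
  have t: "t *\<^sub>p Fcoord F j a = atrans i j \<alpha> (chart B i x) (t *\<^sub>p Fcoord F i a)"
    if "i \<in> I" "j \<in> I" "x \<in> cdom B i" "x \<in> cdom B j" for i j
    using Fcoord_trans[OF that a]
      atrans_scale[OF that(1,2) chart_mem_overlap[OF that(3,4)] Fcoord_mem[OF that a]]
    by simp
  show "Fscale sV sW F \<alpha> x t a \<in> Falpha sV sW F \<alpha> x" unfolding Fscale_def by (rule axis_the(1)[where val = "\<lambda>i. t *\<^sub>p Fcoord F i a", OF x v t refl])
  show "i \<in> I \<Longrightarrow> x \<in> cdom B i \<Longrightarrow> Fcoord F i (Fscale sV sW F \<alpha> x t a) = t *\<^sub>p Fcoord F i a"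
    unfolding Fscale_def by (rule axis_the(2)[where val = "\<lambda>i. t *\<^sub>p Fcoord F i a", OF x v t refl])
qed

lemma axis_zero:
  fixes \<alpha> :: index
  assumes x: "x \<in> pts B"
  shows Fzero_mem: "Fzero sV sW F \<alpha> x \<in> Falpha sV sW F \<alpha> x"
    and Fcoord_Fzero: "i \<in> I \<Longrightarrow> x \<in> cdom B i \<Longrightarrow> Fcoord F i (Fzero sV sW F \<alpha> x) = 0"
proof -
  have t: "0 = atrans i j \<alpha> (chart B i x) 0"
    if "i \<in> I" "j \<in> I" "x \<in> cdom B i" "x \<in> cdom B j" for i j
    using atrans_scale[OF that(1,2) chart_mem_overlap[OF that(3,4)] zero_mem_Valpha, where t = 0] by simp
  show "Fzero sV sW F \<alpha> x \<in> Falpha sV sW F \<alpha> x" unfolding Fzero_def by (rule axis_the(1)[where val = "\<lambda>i. 0", OF x zero_mem_Valpha t refl])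
  show "i \<in> I \<Longrightarrow> x \<in> cdom B i \<Longrightarrow> Fcoord F i (Fzero sV sW F \<alpha> x) = 0"
    unfolding Fzero_def by (rule axis_the(2)[where val = "\<lambda>i. 0", OF x zero_mem_Valpha t refl])
qed

end

section \<open>The bundle \<open>A\<^sup>kF\<close>\<close>

locale vbundle_power = vbundle_setup sV sW F
  for sV :: "'k::topological_base_ring \<Rightarrow> 'v::{topological_ab_group_add,t2_space} \<Rightarrow> 'v"
    and sW :: "'k \<Rightarrow> 'w::{topological_ab_group_add,t2_space} \<Rightarrow> 'w"
    and F :: "('m, 'f, 'i, 'v, 'w, 'k) vbundle" +
  fixes k :: nat
  assumes k: "k \<ge> 1"
begin

abbreviation "T \<equiv> TkF sV sW k F"
abbreviation "\<pi> \<equiv> TkF_proj sV sW k F"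
abbreviation "A \<equiv> AkF sV sW k F"

lemma T_prolongation: "prolongation k T \<pi>"
  by (rule prolongation_TkF[OF k])

lemma T_fibred: "fibred k T \<pi>"
  using T_prolongation unfolding prolongation_def by blast

lemmas TD = fibredD[OF T_fibred]

abbreviation (input) "Adom \<equiv> AkF_dom sV sW k F"

lemma AdomD:
  assumes "i \<in> I" "(x, u) \<in> Adom i"
  shows "x \<in> cdom B i" "x \<in> pts B" "u \<in> Pi\<^sub>E (pos (Suc k)) (\<lambda>\<alpha>. Falpha sV sW F \<alpha> x)"
    "\<alpha> \<in> pos (Suc k) \<Longrightarrow> u \<alpha> \<in> Falpha sV sW F \<alpha> x" "\<alpha> \<in> pos (Suc k) \<Longrightarrow> Fcoord F i (u \<alpha>) \<in> Valpha \<alpha>"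
    "chart B i x \<in> Valpha 0"
proof -
  show x: "x \<in> cdom B i" and u: "u \<in> Pi\<^sub>E (pos (Suc k)) (\<lambda>\<alpha>. Falpha sV sW F \<alpha> x)"
    using assms(2) unfolding AkF_dom_def by auto
  show "x \<in> pts B" using x base_cdom_subset[OF assms(1)] by blast
  show *: "u \<alpha> \<in> Falpha sV sW F \<alpha> x" if "\<alpha> \<in> pos (Suc k)" for \<alpha> using u that by auto
  show "\<alpha> \<in> pos (Suc k) \<Longrightarrow> Fcoord F i (u \<alpha>) \<in> Valpha \<alpha>"
    using Fcoord_mem[OF assms(1,1) x x *] .
  show "chart B i x \<in> Valpha 0" using base_image_subset[OF assms(1)] x by blast
qed

lemma AkF_chart_simp: "AkF_chart k F i (x, u) = pnt k (chart B i x) (\<lambda>\<alpha>. Fcoord F i (u \<alpha>))"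
  unfolding AkF_chart_def by simp

lemma AkF_chart_cmp:
  assumes "i \<in> I" "(x, u) \<in> Adom i"
  shows "cmp k 0 (AkF_chart k F i (x, u)) = chart B i x"
    and "\<alpha> \<in> pos (Suc k) \<Longrightarrow> cmp k \<alpha> (AkF_chart k F i (x, u)) = Fcoord F i (u \<alpha>)"
    and "AkF_chart k F i (x, u) \<in> tmodel k"
  unfolding AkF_chart_simp using AdomD[OF assms] by (simp_all add: cmp_pnt pnt_mem_tmodel)

lemma AkF_chart_inj: "i \<in> I \<Longrightarrow> inj_on (AkF_chart k F i) (Adom i)"
proof (rule inj_onI)
  fix a b assume i: "i \<in> I" and a: "a \<in> Adom i" and b: "b \<in> Adom i"
    and eq: "AkF_chart k F i a = AkF_chart k F i b"
  obtain x u y w where ab: "a = (x, u)" "b = (y, w)" by (cases a; cases b)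
  note xu = a[unfolded ab(1)] and yw = b[unfolded ab(2)]
  note A1 = AdomD[OF i xu] and A2 = AdomD[OF i yw]
  have "chart B i x = chart B i y"
    using AkF_chart_cmp(1)[OF i xu] AkF_chart_cmp(1)[OF i yw] eq ab by simp
  then have xy: "x = y" using inj_onD[OF manifold_inj[OF base_manifold i]] A1(1) A2(1) by blast
  have "u \<alpha> = w \<alpha>" if al: "\<alpha> \<in> pos (Suc k)" for \<alpha>
  proof (rule Fcoord_inj[OF i A1(1) A1(4)[OF al]])
    show "w \<alpha> \<in> Falpha sV sW F \<alpha> x" using A2(4)[OF al] xy by simp
    show "Fcoord F i (u \<alpha>) = Fcoord F i (w \<alpha>)"
      using AkF_chart_cmp(2)[OF i xu al] AkF_chart_cmp(2)[OF i yw al] eq ab by simp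
  qed
  then have "u = w" using A1(3) A2(3) xy by (intro PiE_ext[of u _ _ w]) auto
  then show "a = b" using ab xy by simp
qed

lemma Adom_Int: "i \<in> I \<Longrightarrow> j \<in> I \<Longrightarrow> Adom i \<inter> Adom j = {(x, u) \<in> Adom i. x \<in> cdom B j}"
  unfolding AkF_dom_def by auto

text \<open>The charts of \<open>A\<^sup>kF\<close> have full fibers, because each \<open>F\<^sup>\<alpha>\<^sub>x\<close> is mapped onto \<open>V\<^sub>\<alpha>\<close>.\<close>

lemma AkF_chart_image:
  assumes i: "i \<in> I" and j: "j \<in> I"
  shows "AkF_chart k F i ` (Adom i \<inter> Adom j) = {p \<in> tmodel k. cmp k 0 p \<in> overlap B i j}"
proof (intro equalityI subsetI)
  fix p assume "p \<in> AkF_chart k F i ` (Adom i \<inter> Adom j)"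
  then obtain x u where "p = AkF_chart k F i (x, u)" "(x, u) \<in> Adom i" "x \<in> cdom B j"
    unfolding Adom_Int[OF i j] by auto
  then show "p \<in> {p \<in> tmodel k. cmp k 0 p \<in> overlap B i j}"
    using AkF_chart_cmp[OF i] AdomD(1)[OF i] chart_mem_overlap by simp
next
  fix p assume p: "p \<in> {p \<in> tmodel k. cmp k 0 p \<in> overlap B i j}"
  then obtain x where x: "cmp k 0 p = chart B i x" "x \<in> cdom B i" "x \<in> cdom B j"
    unfolding overlap_def by auto
  define u where "u = (\<lambda>\<alpha>\<in>pos (Suc k). SOME u. u \<in> Falpha sV sW F \<alpha> x \<and> Fcoord F i u = cmp k \<alpha> p)"
  have u: "u \<alpha> \<in> Falpha sV sW F \<alpha> x \<and> Fcoord F i (u \<alpha>) = cmp k \<alpha> p" if "\<alpha> \<in> pos (Suc k)" for \<alpha>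
    unfolding u_def restrict_apply'[OF that]
    by (rule someI_ex) (use Fcoord_surj[OF i x(2) cmp_mem_Valpha] in blast)
  have "(x, u) \<in> Adom i \<inter> Adom j"
    using u x unfolding AkF_dom_def by (auto simp: u_def PiE_def)
  moreover have "AkF_chart k F i (x, u) = p"
  proof -
    have "AkF_chart k F i (x, u) = pnt k (cmp k 0 p) (\<lambda>\<alpha>. cmp k \<alpha> p)"
      unfolding AkF_chart_simp x(1) using u by (intro pnt_cong) simp
    then show ?thesis using p by (simp add: pnt_cmp)
  qed
  ultimately show "p \<in> AkF_chart k F i ` (Adom i \<inter> Adom j)" by blast
qed

lemma openin_over:
  fixes U :: "('v \<times> 'w, 'k) pt set"
  assumes "openin (top_of_set (Valpha 0)) U"
  shows "openin (top_of_set (tmodel k)) {p \<in> tmodel k. cmp k 0 p \<in> U}"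
proof -
  have "openin (top_of_set (tmodel k)) (tmodel k \<inter> cmp k 0 -` U)"
    by (rule continuous_openin_preimage[OF continuous_on_cmp[OF continuous_on_id] _ assms]) auto
  then show ?thesis by (simp add: Int_def vimage_def)
qed

text \<open>For \<open>TM\<close> this is a component of the tangent map of a transition map of \<open>M\<close>, for \<open>F\<close> a component of
  a transition map of \<open>F\<close>.\<close>

lemma atrans_smooth:
  assumes i: "i \<in> I" and j: "j \<in> I"
  shows "smooth sc (tmodel k) (Valpha \<alpha>) {p \<in> tmodel k. cmp k 0 p \<in> overlap B i j}
    (\<lambda>p. atrans i j \<alpha> (cmp k 0 p) (cmp k \<alpha> p))"
proof -
  let ?O = "{p \<in> tmodel k. cmp k 0 p \<in> overlap B i j}"
  have O: "openin (top_of_set (tmodel k)) ?O"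
    using openin_over[OF openin_overlap[OF base_manifold base_subspace i j, unfolded base_model]] .
  note S = subspace_tmodel[of k] and VS = subspace_Valpha
  show ?thesis
  proof (cases "\<alpha> 0 = 0")
    case True
    note VV = Valpha_V[of \<alpha>, OF True]
    let ?d = "diff sc (Valpha 0) (Valpha 0) (overlap B i j) (transition B i j)"
    have st: "smooth sc (prd (Valpha 0) (Valpha 0)) (prd (Valpha 0) (Valpha 0)) (prd (overlap B i j) (Valpha 0))
        (\<lambda>z. pair (transition B i j (lpt z)) (?d (lpt z) (rpt z)))"
      using smooth_tangent[OF base_subspace base_subspace manifold_transition_smooth[OF base_manifold i j]]
      unfolding base_model .
    have l: "lin_on (tmodel k) (prd (Valpha 0) (Valpha 0)) (\<lambda>p. pair (cmp k 0 p) (cmp k \<alpha> p))"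
      using lin_on_pair[OF lin_on_cmp[of _ 0] lin_on_cmp[of _ \<alpha>]] unfolding VV .
    have lm: "pair (cmp k 0 p) (cmp k \<alpha> p) \<in> prd (overlap B i j) (Valpha 0)" if "p \<in> ?O" for p
      using that cmp_mem_Valpha[of k \<alpha> p] VV by simp
    have "smooth sc (tmodel k) (prd (Valpha 0) (Valpha 0)) ?O
        (\<lambda>p. (\<lambda>z. pair (transition B i j (lpt z)) (?d (lpt z) (rpt z))) (pair (cmp k 0 p) (cmp k \<alpha> p)))"
      by (rule smooth_comp_lin[OF S subspace_prd[OF VS VS] O l lm st])
    then have "smooth sc (tmodel k) (prd (Valpha 0) (Valpha 0)) ?O
        (\<lambda>p. pair (transition B i j (cmp k 0 p)) (?d (cmp k 0 p) (cmp k \<alpha> p)))" by simp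
    from smooth_comp[OF S subspace_prd[OF VS VS] this _
        smooth_lin[OF subspace_prd[OF VS VS] _ lin_on_rpt], OF smooth_mem[OF this]]
    show ?thesis using True by (simp add: atrans_def base_model VV)
  next
    case False
    have ot: "openin (top_of_set (range vpt)) (overlap (total F) i j)"
      and tt: "smooth sc (range vpt) (range vpt) (overlap (total F) i j) (transition (total F) i j)"
      using manifold_transition_smooth[OF total_manifold, of i j] i j total_ind total_model
      by (auto dest: smooth_openin)
    have R: "P.subspace (range vpt)" using subspace_tmodel[of 0] unfolding tmodel_0 .
    have sub: "cmp k 0 p + cmp k \<alpha> p \<in> range vpt" for p :: "('v \<times> 'w, 'k) pt"
      by (rule P.subspace_add[OF R]) (rule subsetD[OF Valpha_subset cmp_mem_Valpha])+
    have l: "lin_on (tmodel k) (range vpt) (\<lambda>p. cmp k 0 p + cmp k \<alpha> p)"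
      unfolding lin_on_def
    proof (intro conjI ballI allI)
      show "(\<lambda>p. cmp k 0 p + cmp k \<alpha> p) \<in> tmodel k \<rightarrow> (range vpt :: ('v \<times> 'w, 'k) pt set)" by (rule funcsetI) (rule sub)
      show "continuous_on (tmodel k :: ('v \<times> 'w, 'k) pt set) (\<lambda>p. cmp k 0 p + cmp k \<alpha> p)"
        by (intro continuous_on_add continuous_on_cmp continuous_on_id)
    qed (simp_all add: cmp_add cmp_pscale P.scale_right_distrib add.assoc add.left_commute)
    have mo: "cmp k 0 p + cmp k \<alpha> p \<in> overlap (total F) i j" if "p \<in> ?O" for p
    proof -
      obtain v where v: "cmp k 0 p = vpt (v, 0)" by (meson Valpha0E cmp_mem_Valpha)
      obtain w where w: "cmp k \<alpha> p = vpt (0, w)" using ValphaE[of _ \<alpha>, OF cmp_mem_Valpha False] by blast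
      have "cmp 0 0 (vpt (v, w)) \<in> overlap B i j" using that v by (simp add: cmp_def)
      then show ?thesis
        using fibred_overlap[OF prolongation_fibred[OF prolongation_0] i j] v w
        by (simp add: vpt_add tmodel_0)
    qed
    note s1 = smooth_comp_lin[OF S R O l mo tt]
    have "smooth sc (tmodel k) (Valpha \<alpha>) ?O
        (\<lambda>p. cmp 0 \<alpha> (transition (total F) i j (cmp k 0 p + cmp k \<alpha> p)))"
      by (rule smooth_comp[OF S R s1 smooth_mem[OF s1] smooth_lin[OF R _ lin_on_cmp]]) auto
    then show ?thesis using False by (simp add: atrans_def cmp_def)
  qed
qed

lemma AkF_chart_change:
  assumes i: "i \<in> I" and j: "j \<in> I" and p: "p \<in> tmodel k" "cmp k 0 p \<in> overlap B i j"
  shows "AkF_chart k F j (inv_into (Adom i) (AkF_chart k F i) p) =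
    pnt k (transition B i j (cmp k 0 p)) (\<lambda>\<alpha>. atrans i j \<alpha> (cmp k 0 p) (cmp k \<alpha> p))"
proof -
  have "p \<in> AkF_chart k F i ` (Adom i \<inter> Adom j)" unfolding AkF_chart_image[OF i j] using p by blast
  then obtain x u where xu: "p = AkF_chart k F i (x, u)" "(x, u) \<in> Adom i" "(x, u) \<in> Adom j" by auto
  have x: "x \<in> cdom B i" "x \<in> cdom B j" using AdomD(1)[OF i xu(2)] AdomD(1)[OF j xu(3)] by auto
  have "inv_into (Adom i) (AkF_chart k F i) p = (x, u)"
    unfolding xu(1) by (rule inv_into_f_f[OF AkF_chart_inj[OF i] xu(2)])
  then have "AkF_chart k F j (inv_into (Adom i) (AkF_chart k F i) p) = pnt k (chart B j x) (\<lambda>\<alpha>. Fcoord F j (u \<alpha>))"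
    by (simp add: AkF_chart_simp)
  also have "\<dots> = pnt k (transition B i j (cmp k 0 p)) (\<lambda>\<alpha>. Fcoord F j (u \<alpha>))"
    using AkF_chart_cmp(1)[OF i xu(2)] xu(1) transition_chart[OF base_manifold i x(1)] by simp
  also have "\<dots> = pnt k (transition B i j (cmp k 0 p)) (\<lambda>\<alpha>. atrans i j \<alpha> (cmp k 0 p) (cmp k \<alpha> p))"
    using AkF_chart_cmp[OF i xu(2)] Fcoord_trans[OF i j x AdomD(4)[OF i xu(2)]] xu(1)
    by (intro pnt_cong) simp
  finally show ?thesis .
qed

lemma AkF_simps [simp]:
  "ind A = I" "cdom A = Adom" "chart A = AkF_chart k F" "model A = tmodel k"
  by (simp_all add: AkF_def TD(3))

text \<open>The transition maps of \<open>A\<^sup>kF\<close> are sums of those of the summands \<open>F\<^sup>\<alpha>\<close>, composed with linear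
  maps.\<close>

lemma A_fibred: "fibred k A fst"
  and pts_A: "pts A = (\<Union>i\<in>I. Adom i)"
proof -
  have tr: "smooth sc (tmodel k) (tmodel k) (AkF_chart k F i ` (Adom i \<inter> Adom j))
      (\<lambda>z. AkF_chart k F j (inv_into (Adom i) (AkF_chart k F i) z))"
    if i: "i \<in> I" and j: "j \<in> I" for i j
  proof -
    let ?O = "{p \<in> tmodel k. cmp k 0 p \<in> overlap B i j}"
    note S = subspace_tmodel[of k] and VS = subspace_Valpha
    have O: "openin (top_of_set (tmodel k)) ?O"
      using openin_over[OF openin_overlap[OF base_manifold base_subspace i j, unfolded base_model]] .
    have tB: "smooth sc (Valpha 0) (Valpha 0) (overlap B i j) (transition B i j)"
      using manifold_transition_smooth[OF base_manifold i j] unfolding base_model .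
    have s0: "smooth sc (tmodel k) (Valpha 0) ?O (\<lambda>p. transition B i j (cmp k 0 p))"
      by (rule smooth_comp_lin[OF S VS O lin_on_cmp _ tB]) auto
    have e: "smooth sc (tmodel k) (tmodel k) ?O (\<lambda>p. eps k \<alpha> (h p))"
      if "smooth sc (tmodel k) (Valpha \<alpha>) ?O h" for \<alpha> h
      by (rule smooth_comp[OF S VS that smooth_mem[OF that] smooth_lin[OF VS _ lin_on_eps]]) auto
    have "smooth sc (tmodel k) (tmodel k) ?O
        (\<lambda>p. pnt k (transition B i j (cmp k 0 p)) (\<lambda>\<alpha>. atrans i j \<alpha> (cmp k 0 p) (cmp k \<alpha> p)))"
      unfolding pnt_def by (rule smooth_add[OF S S e[OF s0] smooth_sum[OF S S O e[OF atrans_smooth[OF i j]]]])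
    moreover have "pnt k (transition B i j (cmp k 0 z)) (\<lambda>\<alpha>. atrans i j \<alpha> (cmp k 0 z) (cmp k \<alpha> z))
        = AkF_chart k F j (inv_into (Adom i) (AkF_chart k F i) z)" if "z \<in> ?O" for z
      using that AkF_chart_change[OF i j] by simp
    ultimately show ?thesis
      unfolding AkF_chart_image[OF i j] by (rule smooth_eq)
  qed
  have ov: "openin (top_of_set (tmodel k)) (AkF_chart k F i ` (Adom i \<inter> Adom j))"
    if "i \<in> I" "j \<in> I" for i j
    by (rule smooth_openin[OF tr[OF that]])
  have eq: "A = \<lparr>mtop = atlas_topology I Adom (AkF_chart k F) (tmodel k), ind = I, cdom = Adom,
      chart = AkF_chart k F, model = tmodel k\<rparr>"
    by (simp add: AkF_def TD(3))
  have M: "manifold sc A"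
    by (rule manifold_atlas(1)[where c = "AkF_chart k F" and D = Adom and I = I and E = "tmodel k",
          OF AkF_chart_inj ov tr eq])
  have pt: "pts A = (\<Union>i\<in>I. Adom i)"
    by (rule manifold_atlas(2)[where c = "AkF_chart k F" and D = Adom and I = I and E = "tmodel k",
          OF AkF_chart_inj ov tr eq])
  show "pts A = (\<Union>i\<in>I. Adom i)" by (rule pt)
  show "fibred k A fst"
    unfolding fibred_def
  proof (intro conjI ballI)
    show "fst \<in> pts A \<rightarrow> pts B" unfolding pt using AdomD(2) by auto
    fix i assume i: "i \<in> I"
    show "cdom A i = {c \<in> pts A. fst c \<in> cdom B i}"
      unfolding pt using i by (auto simp: AkF_dom_def)
    show "chart A i ` cdom A i = {p \<in> tmodel k. cmp k 0 p \<in> chart B i ` cdom B i}"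
      using AkF_chart_image[OF i i] by (simp add: overlap_self)
    show "chart B i (fst c) = cmp k 0 (chart A i c)" if "c \<in> cdom A i" for c
      using that AkF_chart_cmp(1)[OF i] by (cases c) auto
  qed (use M in auto)
qed

lemmas AD = fibredD[OF A_fibred]

lemma AkF_pt_fpt: "AkF_pt sV sW k F i x v = fpt k F A i x v"
  unfolding AkF_pt_def fpt_def ..

lemma TkF_pt_fpt: "TkF_pt sV sW k F i x v = fpt k F T i x v"
  unfolding TkF_pt_def fpt_def ..

lemma A_pt_eq:
  assumes i: "i \<in> I" and xu: "(x, u) \<in> Adom i"
  shows "(x, u) = fpt k F A i x (\<lambda>\<alpha>\<in>pos (Suc k). Fcoord F i (u \<alpha>))"
    and "(\<lambda>\<alpha>\<in>pos (Suc k). Fcoord F i (u \<alpha>)) \<in> Efib k"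
proof -
  have "fcoord k A i (x, u) = (\<lambda>\<alpha>\<in>pos (Suc k). Fcoord F i (u \<alpha>))"
    unfolding fcoord_def using AkF_chart_cmp(2)[OF i xu] by (intro restrict_ext) simp
  moreover have "(x, u) \<in> pts A" unfolding pts_A using xu i by blast
  then have "fpt k F A i (fst (x, u)) (fcoord k A i (x, u)) = (x, u)"
    by (rule fpt_fcoord[OF A_fibred i]) (simp add: AdomD(1)[OF i xu])
  ultimately show "(x, u) = fpt k F A i x (\<lambda>\<alpha>\<in>pos (Suc k). Fcoord F i (u \<alpha>))" by simp
  show "(\<lambda>\<alpha>\<in>pos (Suc k). Fcoord F i (u \<alpha>)) \<in> Efib k"
    using AdomD(5)[OF i xu] by auto
qed

lemma A_ptE:
  assumes i: "i \<in> I" and x: "x \<in> cdom B i" and v: "v \<in> Efib k"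
  obtains u where "fpt k F A i x v = (x, u)" "(x, u) \<in> Adom i"
    "\<And>\<alpha>. \<alpha> \<in> pos (Suc k) \<Longrightarrow> Fcoord F i (u \<alpha>) = v \<alpha>"
proof -
  obtain u where u: "fpt k F A i x v = (x, u)"
    using fpt_proj[OF A_fibred i x v] by (metis prod.collapse)
  have d: "(x, u) \<in> Adom i" using fpt_cdom[OF A_fibred i x v] u by simp
  have "(\<lambda>\<alpha>\<in>pos (Suc k). Fcoord F i (u \<alpha>)) = v"
    using A_pt_eq[OF i d] u by (intro fpt_inj[OF A_fibred i x _ v]) auto
  then have "\<And>\<alpha>. \<alpha> \<in> pos (Suc k) \<Longrightarrow> Fcoord F i (u \<alpha>) = v \<alpha>" by (metis restrict_apply')
  with u d show ?thesis by (rule that)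
qed

lemma Eadd_mem:
  fixes v :: "index \<Rightarrow> ('v \<times> 'w, 'k) pt"
  shows "v \<in> Efib k \<Longrightarrow> w \<in> Efib k \<Longrightarrow> Eadd k v w \<in> Efib k"
  unfolding Eadd_def by (auto intro!: P.subspace_add[OF subspace_Valpha] simp: PiE_mem)

lemma Escale_mem: "v \<in> Efib k \<Longrightarrow> Escale (pscale sc) k t v \<in> Efib k"
  unfolding Escale_def by (auto intro!: P.subspace_scale[OF subspace_Valpha] simp: PiE_mem)

text \<open>In every chart the canonical structure \<open>L\<^sub>0\<close> is that of \<open>E\<close>, because the operations of \<open>F\<^sup>\<alpha>\<close> are
  computed in coordinates.\<close>

lemma L0_add_pt:
  assumes i: "i \<in> I" and x: "x \<in> cdom B i" and v: "v \<in> Efib k" and w: "w \<in> Efib k"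
  shows "L0_add sV sW k F (fpt k F A i x v, fpt k F A i x w) = fpt k F A i x (Eadd k v w)"
proof -
  obtain u where u: "fpt k F A i x v = (x, u)" "(x, u) \<in> Adom i"
    "\<And>\<alpha>. \<alpha> \<in> pos (Suc k) \<Longrightarrow> Fcoord F i (u \<alpha>) = v \<alpha>" by (rule A_ptE[OF i x v]) blast
  obtain u' where u': "fpt k F A i x w = (x, u')" "(x, u') \<in> Adom i"
    "\<And>\<alpha>. \<alpha> \<in> pos (Suc k) \<Longrightarrow> Fcoord F i (u' \<alpha>) = w \<alpha>" by (rule A_ptE[OF i x w]) blast
  note a = axis_add[OF AdomD(2)[OF i u(2)] AdomD(4)[OF i u(2)] AdomD(4)[OF i u'(2)]]
  let ?z = "\<lambda>\<alpha>\<in>pos (Suc k). Fadd sV sW F \<alpha> x (u \<alpha>) (u' \<alpha>)"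
  have z: "(x, ?z) \<in> Adom i" unfolding AkF_dom_def using x a(1) by auto
  have "(\<lambda>\<alpha>\<in>pos (Suc k). Fcoord F i (?z \<alpha>)) = Eadd k v w"
    unfolding Eadd_def using a(2)[OF _ _ i x] u(3) u'(3) by (intro restrict_ext) simp
  then show ?thesis using A_pt_eq(1)[OF i z] by (simp add: u(1) u'(1) L0_add_def)
qed

lemma L0_scale_pt:
  assumes i: "i \<in> I" and x: "x \<in> cdom B i" and v: "v \<in> Efib k"
  shows "L0_scale sV sW k F (t, fpt k F A i x v) = fpt k F A i x (Escale (pscale sc) k t v)"
proof -
  obtain u where u: "fpt k F A i x v = (x, u)" "(x, u) \<in> Adom i"
    "\<And>\<alpha>. \<alpha> \<in> pos (Suc k) \<Longrightarrow> Fcoord F i (u \<alpha>) = v \<alpha>" by (rule A_ptE[OF i x v]) blast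
  note a = axis_scale[OF AdomD(2)[OF i u(2)] AdomD(4)[OF i u(2)]]
  let ?z = "\<lambda>\<alpha>\<in>pos (Suc k). Fscale sV sW F \<alpha> x t (u \<alpha>)"
  have z: "(x, ?z) \<in> Adom i" unfolding AkF_dom_def using x a(1) by auto
  have "(\<lambda>\<alpha>\<in>pos (Suc k). Fcoord F i (?z \<alpha>)) = Escale (pscale sc) k t v"
    unfolding Escale_def using a(2)[OF _ i x] u(3) by (intro restrict_ext) simp
  then show ?thesis using A_pt_eq(1)[OF i z] by (simp add: u(1) L0_scale_def)
qed

lemma AkF_axis_pt:
  assumes i: "i \<in> I" and x: "x \<in> cdom B i" and a: "\<alpha> \<in> pos (Suc k)" and u: "u \<in> Falpha sV sW F \<alpha> x"
  shows "AkF_axis sV sW k F \<alpha> x u = fpt k F A i x (single k \<alpha> (Fcoord F i u))"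
proof -
  have xB: "x \<in> pts B" using x base_cdom_subset[OF i] by blast
  let ?z = "\<lambda>\<beta>\<in>pos (Suc k). if \<beta> = \<alpha> then u else Fzero sV sW F \<beta> x"
  have z: "(x, ?z) \<in> Adom i" unfolding AkF_dom_def using x axis_zero(1)[OF xB] u by auto
  have "(\<lambda>\<alpha>\<in>pos (Suc k). Fcoord F i (?z \<alpha>)) = single k \<alpha> (Fcoord F i u)"
    unfolding single_def using axis_zero(2)[OF xB i x] by (intro restrict_ext) simp
  then show ?thesis using A_pt_eq(1)[OF i z] by (simp add: AkF_axis_def)
qed

text \<open>The point given by one chart has the required coordinates in all others, because the transition
  maps of \<open>T\<^sup>kF\<close> act on the axis in the same way as those of \<open>F\<^sup>\<alpha>\<close> do.\<close>

lemma TkF_axis_pt: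
  assumes i: "i \<in> I" and x: "x \<in> cdom B i" and a: "\<alpha> \<in> pos (Suc k)" and u: "u \<in> Falpha sV sW F \<alpha> x"
  shows "TkF_axis sV sW k F \<alpha> x u = fpt k F T i x (single k \<alpha> (Fcoord F i u))"
  unfolding TkF_axis_def
proof (rule the_equality)
  let ?c = "fpt k F T i x (single k \<alpha> (Fcoord F i u))"
  have e: "single k \<alpha> (Fcoord F i u) \<in> Efib k" by (rule single_mem[OF Fcoord_mem[OF i i x x u]])
  note c = fibred_point[OF T_fibred i x e]
  have chi: "chart T i ?c = eps k 0 (chart B i x) + eps k \<alpha> (Fcoord F i u)"
    unfolding c(1) by (rule pnt_single[OF a])
  have "?c \<in> cdom T j \<and> chart T j ?c = eps k 0 (chart B j x) + eps k \<alpha> (Fcoord F j u)"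
    if j: "j \<in> I" and xj: "x \<in> cdom B j" for j
  proof
    show "?c \<in> cdom T j" using fibred_mem_cdom_iff[OF T_fibred j c(3)] c(4) xj by simp
    have "chart T j ?c = transition T i j (chart T i ?c)"
      using transition_chart[OF TD(1) _ c(2)] TD(2) i by simp
    also have "\<dots> = eps k 0 (transition B i j (chart B i x)) + eps k \<alpha> (atrans i j \<alpha> (chart B i x) (Fcoord F i u))"
      unfolding chi
      by (rule prolongationD(2)[OF T_prolongation i j chart_mem_overlap[OF x xj] a Fcoord_mem[OF i i x x u]])
    finally show "chart T j ?c = eps k 0 (chart B j x) + eps k \<alpha> (Fcoord F j u)"
      using Fcoord_trans[OF i j x xj u] transition_chart[OF base_manifold i x] by simp
  qed
  then show "?c \<in> pts T \<and> (\<forall>i\<in>I. x \<in> cdom B i \<longrightarrow> ?c \<in> cdom T i \<and>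
      chart T i ?c = eps k 0 (chart B i x) + eps k \<alpha> (Fcoord F i u))"
    using c(3) by blast
  show "d = ?c" if "d \<in> pts T \<and> (\<forall>i\<in>I. x \<in> cdom B i \<longrightarrow> d \<in> cdom T i \<and>
      chart T i d = eps k 0 (chart B i x) + eps k \<alpha> (Fcoord F i u))" for d
    using that i x chi c(2) TD(2) by (intro inj_onD[OF manifold_inj[OF TD(1)], of i]) auto
qed

end

section \<open>The general multilinear group\<close>

text \<open>The length \<open>|\<alpha>|\<close>, the number of units in \<open>\<epsilon>\<^sup>\<alpha>\<close>.\<close>

definition wt :: "nat \<Rightarrow> index \<Rightarrow> nat" where
  "wt n \<alpha> = (\<Sum>i<n. \<alpha> i)"

lemma wt_pos: assumes "\<alpha> \<in> pos n" shows "0 < wt n \<alpha>"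
proof (rule ccontr)
  assume "\<not> 0 < wt n \<alpha>"
  then have z: "\<alpha> i = 0" if "i < n" for i using that by (auto simp: wt_def)
  have "\<alpha> i = 0" for i
    using z[of i] idxD(2)[of \<alpha> n i] assms pos_subset_idx[of n] by (cases "i < n") auto
  then have "\<alpha> = 0" by (simp add: fun_eq_iff)
  then show False using assms by simp
qed

lemma wt_le: assumes "\<alpha> \<in> pos n" shows "wt n \<alpha> \<le> n"
proof -
  have "\<alpha> i \<le> 1" if "i < n" for i using idxD(1)[OF subsetD[OF pos_subset_idx assms] that] by auto
  then have "(\<Sum>i<n. \<alpha> i) \<le> (\<Sum>i<n. 1)" by (intro sum_mono) auto
  then show ?thesis by (simp add: wt_def)
qed

lemma partsD:
  assumes "\<Lambda> \<in> parts n \<alpha>"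
  shows "\<Lambda> \<subseteq> pos n" "finite \<Lambda>" "\<Sum>\<Lambda> = \<alpha>"
  using assms finite_subset[OF _ finite_pos] unfolding parts_def by auto

lemma finite_parts [simp]: "finite (parts n \<alpha>)"
  by (rule finite_subset[of _ "Pow (pos n)"]) (auto simp: parts_def)

lemma singleton_mem_parts [simp]: "{\<alpha>} \<in> parts n \<alpha> \<longleftrightarrow> \<alpha> \<in> pos n"
  unfolding parts_def by auto

lemma parts_nonempty: "\<alpha> \<in> pos n \<Longrightarrow> \<Lambda> \<in> parts n \<alpha> \<Longrightarrow> \<Lambda> \<noteq> {}"
  by (auto simp: parts_def)

lemma sum_index_apply: "(\<Sum>\<beta>\<in>\<Lambda>. f \<beta>) i = (\<Sum>\<beta>\<in>\<Lambda>. (f \<beta> :: index) i)"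
  by (induction \<Lambda> rule: infinite_finite_induct) (auto simp: plus_fun_apply)

text \<open>The length is additive; the members of a partition have positive length.\<close>

lemma wt_parts:
  assumes "\<Lambda> \<in> parts n \<alpha>" shows "wt n \<alpha> = (\<Sum>\<beta>\<in>\<Lambda>. wt n \<beta>)"
proof -
  have "wt n \<alpha> = (\<Sum>i<n. \<Sum>\<beta>\<in>\<Lambda>. \<beta> i)"
    unfolding wt_def partsD(3)[OF assms, symmetric] by (simp add: sum_index_apply)
  also have "\<dots> = (\<Sum>\<beta>\<in>\<Lambda>. wt n \<beta>)" unfolding wt_def by (rule sum.swap)
  finally show ?thesis .
qed

text \<open>If a partition has a second member, this takes away from the length that is left for the
  first. The lemma makes the elements of the general multilinear group triangular.\<close>

lemma wt_parts_less:
  assumes L: "\<Lambda> \<in> parts n \<alpha>" and ne: "\<Lambda> \<noteq> {\<alpha>}" and b: "\<beta> \<in> \<Lambda>"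
  shows "wt n \<beta> < wt n \<alpha>"
proof -
  note D = partsD[OF L]
  have "\<Lambda> \<noteq> {\<beta>}"
  proof
    assume "\<Lambda> = {\<beta>}"
    then show False using D(3) ne by simp
  qed
  then obtain \<gamma> where g: "\<gamma> \<in> \<Lambda>" "\<gamma> \<noteq> \<beta>" using b by blast
  have "wt n \<alpha> = wt n \<beta> + (\<Sum>\<gamma>\<in>\<Lambda> - {\<beta>}. wt n \<gamma>)"
    unfolding wt_parts[OF L] by (rule sum.remove[OF D(2) b])
  moreover have "0 < (\<Sum>\<gamma>\<in>\<Lambda> - {\<beta>}. wt n \<gamma>)"
    using D(1,2) g wt_pos[of \<gamma> n] by (intro sum_pos2[of _ \<gamma>]) auto
  ultimately show ?thesis by simp
qed

context vbundle_power begin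

abbreviation "E \<equiv> (Efib k :: (index \<Rightarrow> ('v \<times> 'w, 'k) pt) set)"
abbreviation "pk \<equiv> pos (Suc k)"
abbreviation "Mgrp \<equiv> (Gm (pscale sc) (Suc k) Valpha :: ((index \<Rightarrow> ('v \<times> 'w, 'k) pt) \<Rightarrow> index \<Rightarrow> ('v \<times> 'w, 'k) pt) set)"

lemma multilinear_zero:
  assumes "multilinear_on (pscale sc) \<Lambda> Valpha V b" "v \<in> Pi\<^sub>E \<Lambda> Valpha" "\<beta> \<in> \<Lambda>" "v \<beta> = 0"
  shows "b v = 0"
proof -
  have "b (v(\<beta> := 0 *\<^sub>p 0)) = 0 *\<^sub>p b (v(\<beta> := 0))"
    using assms(1,2,3) zero_mem_Valpha unfolding multilinear_on_def by blast
  moreover have "v(\<beta> := 0 *\<^sub>p 0) = v" using assms(4) by auto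
  ultimately show ?thesis by simp
qed

text \<open>Triangular maps with identity diagonal, the normal form of the elements of the general
  multilinear group. The triangular shape is what allows to invert them.\<close>

definition unipotent :: "((index \<Rightarrow> ('v \<times> 'w, 'k) pt) \<Rightarrow> index \<Rightarrow> ('v \<times> 'w, 'k) pt) \<Rightarrow> bool" where
  "unipotent g \<longleftrightarrow> (\<forall>v\<in>E. g v \<in> E) \<and>
     (\<forall>\<alpha>\<in>pk. \<forall>v\<in>E. \<forall>w\<in>E. (\<forall>\<beta>\<in>pk. wt (Suc k) \<beta> < wt (Suc k) \<alpha> \<longrightarrow> v \<beta> = w \<beta>) \<longrightarrow>
        g v \<alpha> - v \<alpha> = g w \<alpha> - w \<alpha>)"

lemma unipotent_mem: "unipotent g \<Longrightarrow> v \<in> E \<Longrightarrow> g v \<in> E"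
  unfolding unipotent_def by blast

lemma unipotentD:
  assumes "unipotent g" "\<alpha> \<in> pk" "v \<in> E" "w \<in> E"
    "\<And>\<beta>. \<beta> \<in> pk \<Longrightarrow> wt (Suc k) \<beta> < wt (Suc k) \<alpha> \<Longrightarrow> v \<beta> = w \<beta>"
  shows "g v \<alpha> - v \<alpha> = g w \<alpha> - w \<alpha>"
  using assms unfolding unipotent_def by blast

text \<open>\<open>g v = w\<close> says that \<open>v\<close> is a fixed point of \<open>v \<mapsto> w - (g v - v)\<close>. For unipotent \<open>g\<close> the
  iteration of this map becomes stationary after as many steps as the longest index has length.\<close>

definition newton :: "((index \<Rightarrow> ('v \<times> 'w, 'k) pt) \<Rightarrow> index \<Rightarrow> ('v \<times> 'w, 'k) pt) \<Rightarrow>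
    (index \<Rightarrow> ('v \<times> 'w, 'k) pt) \<Rightarrow> (index \<Rightarrow> ('v \<times> 'w, 'k) pt) \<Rightarrow> index \<Rightarrow> ('v \<times> 'w, 'k) pt" where
  "newton g w v = (\<lambda>\<alpha>\<in>pk. w \<alpha> - (g v \<alpha> - v \<alpha>))"

lemma newton_mem:
  assumes "unipotent g" "w \<in> E" "v \<in> E"
  shows "newton g w v \<in> E"
  using EfibD[OF assms(2)] EfibD[OF assms(3)] EfibD[OF unipotent_mem[OF assms(1,3)]]
  unfolding newton_def by (auto intro!: P.subspace_diff[OF subspace_Valpha])

lemma newton_iterate_mem: "unipotent g \<Longrightarrow> w \<in> E \<Longrightarrow> (newton g w ^^ m) w \<in> E"
  by (induction m) (simp_all add: newton_mem)

text \<open>A component is stationary as soon as all components of smaller length are. Indices have positive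
  length, which starts the induction.\<close>

lemma newton_stationary:
  assumes g: "unipotent g" and w: "w \<in> E" and a: "\<alpha> \<in> pk" and m: "wt (Suc k) \<alpha> \<le> m"
  shows "(newton g w ^^ Suc m) w \<alpha> = (newton g w ^^ m) w \<alpha>"
  using a m
proof (induction m arbitrary: \<alpha>)
  case 0
  then show ?case using wt_pos[of \<alpha> "Suc k"] by simp
next
  case (Suc m)
  let ?u = "\<lambda>m. (newton g w ^^ m) w"
  have "g (?u (Suc m)) \<alpha> - ?u (Suc m) \<alpha> = g (?u m) \<alpha> - ?u m \<alpha>"
    using Suc by (intro unipotentD[OF g Suc.prems(1)] newton_iterate_mem g w) auto
  then have "newton g w (?u (Suc m)) \<alpha> = newton g w (?u m) \<alpha>"
    using Suc.prems(1) by (simp add: newton_def)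
  then show ?case by simp
qed

text \<open>After \<open>k + 1\<close> steps all components are stationary, since this is the maximal length.\<close>

lemma newton_solves:
  assumes g: "unipotent g" and w: "w \<in> E"
  shows "g ((newton g w ^^ Suc k) w) = w"
proof (rule Efib_eqI[OF unipotent_mem[OF g newton_iterate_mem[OF g w]] w])
  fix \<alpha> assume a: "\<alpha> \<in> pk"
  let ?v = "(newton g w ^^ Suc k) w"
  have "newton g w ?v \<alpha> = ?v \<alpha>"
    using newton_stationary[OF g w a wt_le[OF a]] by simp
  then show "g ?v \<alpha> = w \<alpha>" using a by (simp add: newton_def algebra_simps)
qed

lemma unipotent_inj:
  assumes g: "unipotent g" and v: "v \<in> E" and w: "w \<in> E" and eq: "g v = g w"
  shows "v = w"
proof (rule Efib_eqI[OF v w])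
  fix \<alpha> assume "\<alpha> \<in> pk"
  then show "v \<alpha> = w \<alpha>"
  proof (induction "wt (Suc k) \<alpha>" arbitrary: \<alpha> rule: less_induct)
    case less
    have "g v \<alpha> - v \<alpha> = g w \<alpha> - w \<alpha>"
      using less by (intro unipotentD[OF g less.prems v w]) auto
    then show ?case using eq by simp
  qed
qed

lemma unipotent_bij: assumes g: "unipotent g" shows "bij_betw g E E"
proof (rule bij_betwI')
  show "g v = g w \<longleftrightarrow> v = w" if "v \<in> E" "w \<in> E" for v w
    using unipotent_inj[OF g that] by blast
  show "g v \<in> E" if "v \<in> E" for v by (rule unipotent_mem[OF g that])
  show "\<exists>v\<in>E. w = g v" if "w \<in> E" for w
    using newton_solves[OF g that] newton_iterate_mem[OF g that] by metis
qed

lemma restrict_mem: "v \<in> E \<Longrightarrow> \<Lambda> \<subseteq> pk \<Longrightarrow> restrict v \<Lambda> \<in> Pi\<^sub>E \<Lambda> Valpha"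
  by (auto simp: PiE_mem subset_iff)

lemma Mgrp_components:
  assumes "f \<in> Mgrp"
  shows "\<exists>b. (\<forall>\<alpha>\<in>pk. \<forall>\<Lambda>\<in>parts (Suc k) \<alpha>. multilinear_on (pscale sc) \<Lambda> Valpha (Valpha \<alpha>) (b \<Lambda>)) \<and>
    (\<forall>\<alpha>\<in>pk. bij_betw (\<lambda>x. b {\<alpha>} (\<lambda>\<beta>\<in>{\<alpha>}. x)) (Valpha \<alpha>) (Valpha \<alpha>)) \<and>
    (\<forall>v\<in>E. f v = (\<lambda>\<alpha>\<in>pk. \<Sum>\<Lambda>\<in>parts (Suc k) \<alpha>. b \<Lambda> (restrict v \<Lambda>)))"
  using assms unfolding Gm_def by (elim CollectE conjE) assumption

lemma multilinear_mem:
  "multilinear_on sc' \<Lambda> V W b \<Longrightarrow> v \<in> Pi\<^sub>E \<Lambda> V \<Longrightarrow> b v \<in> W"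
  unfolding multilinear_on_def by blast

text \<open>An element \<open>f\<close> of the general multilinear group maps each axis to itself, linearly and
  bijectively, because \<open>{\<alpha>}\<close> is the only partition with no member besides \<open>\<alpha>\<close>. Composing \<open>f\<close> with
  the inverses \<open>D\<^sub>\<alpha>\<close> of these restrictions gives a unipotent element of the group, which is the
  identity on the axes.\<close>

lemma Mgrp_normalize:
  assumes f: "f \<in> Mgrp"
  obtains D where
    "\<And>\<alpha>. \<alpha> \<in> pk \<Longrightarrow> bij_betw (D \<alpha>) (Valpha \<alpha>) (Valpha \<alpha>)"
    "\<And>\<alpha> x y. \<alpha> \<in> pk \<Longrightarrow> x \<in> Valpha \<alpha> \<Longrightarrow> y \<in> Valpha \<alpha> \<Longrightarrow> D \<alpha> (x + y) = D \<alpha> x + D \<alpha> y"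
    "\<And>\<alpha> x t. \<alpha> \<in> pk \<Longrightarrow> x \<in> Valpha \<alpha> \<Longrightarrow> D \<alpha> (t *\<^sub>p x) = t *\<^sub>p D \<alpha> x"
    "\<And>\<alpha> x. \<alpha> \<in> pk \<Longrightarrow> x \<in> Valpha \<alpha> \<Longrightarrow> f (single k \<alpha> (D \<alpha> x)) = single k \<alpha> x"
    "(\<lambda>v\<in>E. f (\<lambda>\<alpha>\<in>pk. D \<alpha> (v \<alpha>))) \<in> Mgrp"
    "unipotent (\<lambda>v\<in>E. f (\<lambda>\<alpha>\<in>pk. D \<alpha> (v \<alpha>)))"
proof -
  from Mgrp_components[OF f] obtain b where b:
    "\<forall>\<alpha>\<in>pk. \<forall>\<Lambda>\<in>parts (Suc k) \<alpha>. multilinear_on (pscale sc) \<Lambda> Valpha (Valpha \<alpha>) (b \<Lambda>)"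
    "\<forall>\<alpha>\<in>pk. bij_betw (\<lambda>x. b {\<alpha>} (\<lambda>\<beta>\<in>{\<alpha>}. x)) (Valpha \<alpha>) (Valpha \<alpha>)"
    "\<forall>v\<in>E. f v = (\<lambda>\<alpha>\<in>pk. \<Sum>\<Lambda>\<in>parts (Suc k) \<alpha>. b \<Lambda> (restrict v \<Lambda>))"
    by (elim exE conjE)
  then have ml: "\<And>\<alpha> \<Lambda>. \<alpha> \<in> pk \<Longrightarrow> \<Lambda> \<in> parts (Suc k) \<alpha> \<Longrightarrow> multilinear_on (pscale sc) \<Lambda> Valpha (Valpha \<alpha>) (b \<Lambda>)"
    and bb: "\<And>\<alpha>. \<alpha> \<in> pk \<Longrightarrow> bij_betw (\<lambda>x. b {\<alpha>} (\<lambda>\<beta>\<in>{\<alpha>}. x)) (Valpha \<alpha>) (Valpha \<alpha>)"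
    and fv: "\<And>v. v \<in> E \<Longrightarrow> f v = (\<lambda>\<alpha>\<in>pk. \<Sum>\<Lambda>\<in>parts (Suc k) \<alpha>. b \<Lambda> (restrict v \<Lambda>))"
    by blast+
  define c where "c = (\<lambda>\<alpha> x. b {\<alpha>} (\<lambda>\<beta>\<in>{\<alpha>}. x))"
  define D where "D = (\<lambda>\<alpha>. inv_into (Valpha \<alpha>) (c \<alpha>))"
  have cb: "bij_betw (c \<alpha>) (Valpha \<alpha>) (Valpha \<alpha>)" if "\<alpha> \<in> pk" for \<alpha>
    using bb[OF that] unfolding c_def .
  have Db: "bij_betw (D \<alpha>) (Valpha \<alpha>) (Valpha \<alpha>)" if "\<alpha> \<in> pk" for \<alpha>
    unfolding D_def by (rule bij_betw_inv_into[OF cb[OF that]])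
  have cD: "c \<alpha> (D \<alpha> x) = x" if "\<alpha> \<in> pk" "x \<in> Valpha \<alpha>" for \<alpha> x
    unfolding D_def by (rule bij_betw_inv_into_right[OF cb[OF that(1)] that(2)])
  have Dc: "D \<alpha> (c \<alpha> x) = x" if "\<alpha> \<in> pk" "x \<in> Valpha \<alpha>" for \<alpha> x
    unfolding D_def by (rule bij_betw_inv_into_left[OF cb[OF that(1)] that(2)])
  have Dm: "D \<alpha> x \<in> Valpha \<alpha>" if "\<alpha> \<in> pk" "x \<in> Valpha \<alpha>" for \<alpha> x
    using bij_betwE[OF Db[OF that(1)]] that(2) by blast
  have upd: "(\<lambda>\<beta>\<in>{\<alpha>}. x)(\<alpha> := y) = (\<lambda>\<beta>\<in>{\<alpha>}. y)" for \<alpha> :: index and x y :: "('v \<times> 'w, 'k) pt"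
    by auto
  have c_add: "c \<alpha> (x + y) = c \<alpha> x + c \<alpha> y" and c_scale: "c \<alpha> (t *\<^sub>p x) = t *\<^sub>p c \<alpha> x"
    if "\<alpha> \<in> pk" "x \<in> Valpha \<alpha>" "y \<in> Valpha \<alpha>" for \<alpha> x y t
  proof -
    have m: "multilinear_on (pscale sc) {\<alpha>} Valpha (Valpha \<alpha>) (b {\<alpha>})" using ml that(1) by simp
    have v: "(\<lambda>\<beta>\<in>{\<alpha>}. x) \<in> Pi\<^sub>E {\<alpha>} Valpha" using that by simp
    have "b {\<alpha>} ((\<lambda>\<beta>\<in>{\<alpha>}. x)(\<alpha> := x + y)) = b {\<alpha>} ((\<lambda>\<beta>\<in>{\<alpha>}. x)(\<alpha> := x)) + b {\<alpha>} ((\<lambda>\<beta>\<in>{\<alpha>}. x)(\<alpha> := y))"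
      using m v that(2,3) unfolding multilinear_on_def by blast
    then show "c \<alpha> (x + y) = c \<alpha> x + c \<alpha> y" unfolding upd c_def .
    have "b {\<alpha>} ((\<lambda>\<beta>\<in>{\<alpha>}. x)(\<alpha> := t *\<^sub>p x)) = t *\<^sub>p b {\<alpha>} ((\<lambda>\<beta>\<in>{\<alpha>}. x)(\<alpha> := x))"
      using m v that(2) unfolding multilinear_on_def by blast
    then show "c \<alpha> (t *\<^sub>p x) = t *\<^sub>p c \<alpha> x" unfolding upd c_def .
  qed
  have D_add: "D \<alpha> (x + y) = D \<alpha> x + D \<alpha> y" if "\<alpha> \<in> pk" "x \<in> Valpha \<alpha>" "y \<in> Valpha \<alpha>" for \<alpha> x y
  proof -
    have "D \<alpha> (x + y) = D \<alpha> (c \<alpha> (D \<alpha> x + D \<alpha> y))"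
      using that by (simp add: c_add Dm cD)
    then show ?thesis using that by (simp add: Dc Dm P.subspace_add[OF subspace_Valpha])
  qed
  have D_scale: "D \<alpha> (t *\<^sub>p x) = t *\<^sub>p D \<alpha> x" if "\<alpha> \<in> pk" "x \<in> Valpha \<alpha>" for \<alpha> x t
  proof -
    have "D \<alpha> (t *\<^sub>p x) = D \<alpha> (c \<alpha> (t *\<^sub>p D \<alpha> x))"
      using that by (simp add: c_scale Dm cD)
    then show ?thesis using that by (simp add: Dc Dm P.subspace_scale[OF subspace_Valpha])
  qed
  have single: "f (single k \<alpha> u) = single k \<alpha> (c \<alpha> u)" if a: "\<alpha> \<in> pk" and u: "u \<in> Valpha \<alpha>" for \<alpha> u
  proof -
    have s: "single k \<alpha> u \<in> E" by (rule single_mem[OF u])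
    have "(\<Sum>\<Lambda>\<in>parts (Suc k) \<beta>. b \<Lambda> (restrict (single k \<alpha> u) \<Lambda>)) = (if \<beta> = \<alpha> then c \<alpha> u else 0)"
      if be: "\<beta> \<in> pk" for \<beta>
    proof -
      \<comment> \<open>A partition other than \<open>{\<alpha>}\<close> has a member at which the axis element vanishes.\<close>
      have z: "b \<Lambda> (restrict (single k \<alpha> u) \<Lambda>) = 0" if L: "\<Lambda> \<in> parts (Suc k) \<beta>" "\<Lambda> \<noteq> {\<alpha>}" for \<Lambda>
      proof -
        obtain \<gamma> where g: "\<gamma> \<in> \<Lambda>" "\<gamma> \<noteq> \<alpha>" using L parts_nonempty[OF be L(1)] by blast
        then have "restrict (single k \<alpha> u) \<Lambda> \<gamma> = 0"
          using partsD(1)[OF L(1)] by (auto simp: single_def)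
        then show ?thesis
          by (rule multilinear_zero[OF ml[OF be L(1)] restrict_mem[OF s partsD(1)[OF L(1)]] g(1)])
      qed
      show ?thesis
      proof (cases "\<beta> = \<alpha>")
        case True
        have "restrict (single k \<alpha> u) {\<alpha>} = (\<lambda>_\<in>{\<alpha>}. u)"
          using a by (auto simp: single_def)
        then have "(\<Sum>\<Lambda>\<in>parts (Suc k) \<beta>. b \<Lambda> (restrict (single k \<alpha> u) \<Lambda>)) = (\<Sum>\<Lambda>\<in>{{\<alpha>}}. c \<alpha> u)"
          using a True z by (intro sum.mono_neutral_cong_right) (auto simp: c_def)
        then show ?thesis using True by simp
      next
        case False
        then have "{\<alpha>} \<notin> parts (Suc k) \<beta>" using partsD(3) by fastforce
        then have "b \<Lambda> (restrict (single k \<alpha> u) \<Lambda>) = 0" if "\<Lambda> \<in> parts (Suc k) \<beta>" for \<Lambda>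
          using z[OF that] that by blast
        then show ?thesis using False by (simp add: sum.neutral)
      qed
    qed
    then show ?thesis unfolding fv[OF s] by (auto simp: single_def fun_eq_iff)
  qed
  have axis: "f (single k \<alpha> (D \<alpha> x)) = single k \<alpha> x" if "\<alpha> \<in> pk" "x \<in> Valpha \<alpha>" for \<alpha> x
    using single[OF that(1) Dm[OF that]] cD[OF that] by simp
  \<comment> \<open>The components of the composition of \<open>f\<close> with the \<open>D\<^sub>\<alpha>\<close>.\<close>
  define b' where "b' = (\<lambda>\<Lambda> v. b \<Lambda> (\<lambda>\<beta>\<in>\<Lambda>. D \<beta> (v \<beta>)))"
  have Dv: "(\<lambda>\<alpha>\<in>pk. D \<alpha> (v \<alpha>)) \<in> E" if "v \<in> E" for v
    using that Dm by (auto simp: PiE_mem)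
  have ml': "multilinear_on (pscale sc) \<Lambda> Valpha (Valpha \<alpha>) (b' \<Lambda>)"
    if a: "\<alpha> \<in> pk" and L: "\<Lambda> \<in> parts (Suc k) \<alpha>" for \<alpha> \<Lambda>
    unfolding multilinear_on_def
  proof (intro ballI conjI allI)
    fix v :: "index \<Rightarrow> ('v \<times> 'w, 'k) pt" assume v: "v \<in> Pi\<^sub>E \<Lambda> Valpha"
    let ?d = "\<lambda>v. (\<lambda>\<beta>\<in>\<Lambda>. D \<beta> (v \<beta>))"
    have Lp: "\<beta> \<in> pk" if "\<beta> \<in> \<Lambda>" for \<beta> using partsD(1)[OF L] that by blast
    have d: "?d v \<in> Pi\<^sub>E \<Lambda> Valpha" using v Dm Lp by (auto simp: PiE_mem)
    note M = ml[OF a L, unfolded multilinear_on_def, rule_format, OF d]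
    show "b' \<Lambda> v \<in> Valpha \<alpha>" unfolding b'_def using M by blast
    have du: "?d (v(\<beta> := x)) = (?d v)(\<beta> := D \<beta> x)" if "\<beta> \<in> \<Lambda>" for \<beta> x using that by auto
    fix \<beta> and x :: "('v \<times> 'w, 'k) pt" assume b: "\<beta> \<in> \<Lambda>" and x: "x \<in> Valpha \<beta>"
    show "b' \<Lambda> (v(\<beta> := x + y)) = b' \<Lambda> (v(\<beta> := x)) + b' \<Lambda> (v(\<beta> := y))" if y: "y \<in> Valpha \<beta>" for y :: "('v \<times> 'w, 'k) pt"
      unfolding b'_def du[OF b] D_add[OF Lp[OF b] x y]
      using M b Dm[OF Lp[OF b] x] Dm[OF Lp[OF b] y] by blast
    show "b' \<Lambda> (v(\<beta> := t *\<^sub>p x)) = t *\<^sub>p b' \<Lambda> (v(\<beta> := x))" for t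
      unfolding b'_def du[OF b] D_scale[OF Lp[OF b] x]
      using M b Dm[OF Lp[OF b] x] by blast
  qed
  have b1: "b' {\<alpha>} (\<lambda>\<beta>\<in>{\<alpha>}. x) = x" if "\<alpha> \<in> pk" "x \<in> Valpha \<alpha>" for \<alpha> x
  proof -
    have "(\<lambda>\<beta>\<in>{\<alpha>}. D \<beta> ((\<lambda>\<beta>\<in>{\<alpha>}. x) \<beta>)) = (\<lambda>\<beta>\<in>{\<alpha>}. D \<alpha> x)" by auto
    then show ?thesis using cD[OF that] by (simp add: b'_def c_def)
  qed
  define g where "g = (\<lambda>v\<in>E. f (\<lambda>\<alpha>\<in>pk. D \<alpha> (v \<alpha>)))"
  have gv: "g v = (\<lambda>\<alpha>\<in>pk. \<Sum>\<Lambda>\<in>parts (Suc k) \<alpha>. b' \<Lambda> (restrict v \<Lambda>))" if v: "v \<in> E" for v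
  proof -
    have "b \<Lambda> (restrict (\<lambda>\<alpha>\<in>pk. D \<alpha> (v \<alpha>)) \<Lambda>) = b' \<Lambda> (restrict v \<Lambda>)" if "\<Lambda> \<in> parts (Suc k) \<alpha>" for \<Lambda> \<alpha>
    proof -
      have "restrict (\<lambda>\<alpha>\<in>pk. D \<alpha> (v \<alpha>)) \<Lambda> = (\<lambda>\<beta>\<in>\<Lambda>. D \<beta> (restrict v \<Lambda> \<beta>))"
        using partsD(1)[OF that] by (auto simp: fun_eq_iff subset_iff)
      then show ?thesis by (simp add: b'_def)
    qed
    then show ?thesis using v by (auto simp: g_def fv[OF Dv[OF v]] intro!: restrict_ext sum.cong)
  qed
  have gM: "g \<in> Mgrp"
    unfolding Gm_def
  proof (intro CollectI conjI exI[of _ b'] ballI)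
    show "g \<in> extensional E" unfolding g_def by simp
    show "bij_betw (\<lambda>x. b' {\<alpha>} (\<lambda>\<beta>\<in>{\<alpha>}. x)) (Valpha \<alpha>) (Valpha \<alpha>)" if "\<alpha> \<in> pk" for \<alpha>
      using bij_betw_cong[of "Valpha \<alpha>" "\<lambda>x. b' {\<alpha>} (\<lambda>\<beta>\<in>{\<alpha>}. x)" "\<lambda>x. x" "Valpha \<alpha>"] b1[OF that]
        bij_betw_id[of "Valpha \<alpha>", unfolded id_def] by blast
  qed (use ml' gv in auto)
  have gu: "unipotent g"
    unfolding unipotent_def
  proof (intro conjI ballI impI)
    show "g v \<in> E" if v: "v \<in> E" for v
      unfolding gv[OF v]
      using multilinear_mem[OF ml' restrict_mem[OF v partsD(1)]]
      by (auto intro!: P.subspace_sum[OF subspace_Valpha])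
    fix \<alpha> v w assume a: "\<alpha> \<in> pk" and v: "v \<in> E" and w: "w \<in> E"
      and vw: "\<forall>\<beta>\<in>pk. wt (Suc k) \<beta> < wt (Suc k) \<alpha> \<longrightarrow> v \<beta> = w \<beta>"
    have split: "g v \<alpha> - v \<alpha> = (\<Sum>\<Lambda>\<in>parts (Suc k) \<alpha> - {{\<alpha>}}. b' \<Lambda> (restrict v \<Lambda>))" if v: "v \<in> E" for v
    proof -
      have "restrict v {\<alpha>} = (\<lambda>\<beta>\<in>{\<alpha>}. v \<alpha>)" by auto
      then have "b' {\<alpha>} (restrict v {\<alpha>}) = v \<alpha>" using b1[OF a EfibD[OF v a]] by simp
      then show ?thesis
        using a sum.remove[of "parts (Suc k) \<alpha>" "{\<alpha>}" "\<lambda>\<Lambda>. b' \<Lambda> (restrict v \<Lambda>)"]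
        by (simp add: gv[OF v])
    qed
    have "restrict v \<Lambda> = restrict w \<Lambda>" if "\<Lambda> \<in> parts (Suc k) \<alpha> - {{\<alpha>}}" for \<Lambda>
      using that vw wt_parts_less partsD(1) by (intro restrict_ext) blast
    then show "g v \<alpha> - v \<alpha> = g w \<alpha> - w \<alpha>"
      unfolding split[OF v] split[OF w] by (intro sum.cong) auto
  qed
  show ?thesis
    by (rule that[of D]) (use Db D_add D_scale axis gM gu g_def in auto)
qed

text \<open>\<open>f\<close> is a unipotent map composed with a product of bijections.\<close>

lemma Mgrp_bij:
  assumes f: "f \<in> Mgrp" shows "bij_betw f E E"
proof -
  obtain D where D: "\<And>\<alpha>. \<alpha> \<in> pk \<Longrightarrow> bij_betw (D \<alpha>) (Valpha \<alpha>) (Valpha \<alpha>)"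
    and u: "unipotent (\<lambda>v\<in>E. f (\<lambda>\<alpha>\<in>pk. D \<alpha> (v \<alpha>)))"
    by (rule Mgrp_normalize[OF f]) blast
  let ?d = "\<lambda>v. (\<lambda>\<alpha>\<in>pk. D \<alpha> (v \<alpha>))" and ?d' = "\<lambda>v. (\<lambda>\<alpha>\<in>pk. inv_into (Valpha \<alpha>) (D \<alpha>) (v \<alpha>))"
  have Dm: "D \<alpha> x \<in> Valpha \<alpha>" "inv_into (Valpha \<alpha>) (D \<alpha>) x \<in> Valpha \<alpha>"
    if "\<alpha> \<in> pk" "x \<in> Valpha \<alpha>" for \<alpha> x
    using bij_betwE[OF D[OF that(1)]] bij_betwE[OF bij_betw_inv_into[OF D[OF that(1)]]] that(2) by blast+
  have b: "bij_betw ?d' E E"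
  proof (rule bij_betw_byWitness[where f' = ?d])
    show "\<forall>v\<in>E. ?d (?d' v) = v"
      using bij_betw_inv_into_right[OF D] by (auto intro!: Efib_eqI simp: PiE_mem Dm)
    show "\<forall>v\<in>E. ?d' (?d v) = v"
      using bij_betw_inv_into_left[OF D] by (auto intro!: Efib_eqI simp: PiE_mem Dm)
  qed (auto simp: PiE_mem Dm)
  have "bij_betw ((\<lambda>v\<in>E. f (?d v)) \<circ> ?d') E E"
    by (rule bij_betw_trans[OF b unipotent_bij[OF u]])
  moreover have "((\<lambda>v\<in>E. f (?d v)) \<circ> ?d') v = f v" if v: "v \<in> E" for v
  proof -
    have m: "?d' v \<in> E" using v by (auto simp: PiE_mem Dm)
    have "?d (?d' v) = v"
      using bij_betw_inv_into_right[OF D] v by (intro Efib_eqI) (auto simp: PiE_mem Dm)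
    then show ?thesis using m by simp
  qed
  ultimately show ?thesis using bij_betw_cong[of E "(\<lambda>v\<in>E. f (?d v)) \<circ> ?d'" f E] by blast
qed

lemma Mgrp_mem: "f \<in> Mgrp \<Longrightarrow> v \<in> E \<Longrightarrow> f v \<in> E"
  using bij_betwE[OF Mgrp_bij] by blast

text \<open>The step of the iteration, written in the model of \<open>T\<^sup>kF\<close>.\<close>

lemma pnt_newton:
  "pnt k x (newton g w v) = pnt k x w - (pnt k x (g v) - pnt k x v)"
proof -
  have ed: "eps k \<alpha> (a - b) = eps k \<alpha> a - eps k \<alpha> b" for \<alpha> and a b :: "('v \<times> 'w, 'k) pt"
    using eps_add[of k \<alpha> "a - b" b] by (simp add: algebra_simps)
  have "(\<Sum>\<alpha>\<in>pk. eps k \<alpha> (newton g w v \<alpha>)) = (\<Sum>\<alpha>\<in>pk. eps k \<alpha> (w \<alpha>) - (eps k \<alpha> (g v \<alpha>) - eps k \<alpha> (v \<alpha>)))"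
    by (rule sum.cong) (simp_all add: newton_def ed)
  then show ?thesis unfolding pnt_def by (simp add: sum_subtractf)
qed

end

context vbundle_power begin

section \<open>The fibers of a linear structure\<close>

abbreviation "Tp \<equiv> fpt k F T"
abbreviation "Ap \<equiv> fpt k F A"

text \<open>The structure \<open>L\<^sub>x\<close> is the one that \<open>f\<close> transports from the module \<open>E\<close>, read in the \<open>i\<close>-th chart.\<close>

definition conj_by where
  "conj_by L i x f \<longleftrightarrow> (\<forall>v\<in>E. \<forall>w\<in>E. \<forall>t.
     fst L (Tp i x (f v), Tp i x (f w)) = Tp i x (f (Eadd k v w)) \<and>
     snd L (t, Tp i x (f v)) = Tp i x (f (Escale (pscale sc) k t v)))"

lemma conj_byD:
  assumes "conj_by L i x f" "v \<in> E"
  shows "w \<in> E \<Longrightarrow> fst L (Tp i x (f v), Tp i x (f w)) = Tp i x (f (Eadd k v w))"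
    and "snd L (t, Tp i x (f v)) = Tp i x (f (Escale (pscale sc) k t v))"
  using assms unfolding conj_by_def by blast+

definition Ezero :: "index \<Rightarrow> ('v \<times> 'w, 'k) pt" where
  "Ezero = (\<lambda>\<alpha>\<in>pk. 0)"

lemma Ezero_mem: "Ezero \<in> E"
  unfolding Ezero_def by auto

lemma E_module:
  assumes "v \<in> E"
  shows "Eadd k Ezero v = v" "Eadd k v Ezero = v" "Eadd k (Escale (pscale sc) k (- 1) v) v = Ezero"
    "Escale (pscale sc) k 1 v = v"
proof -
  note z = Ezero_mem
  show "Eadd k Ezero v = v"
    by (rule Efib_eqI[OF Eadd_mem[OF z assms] assms]) (simp add: Eadd_def Ezero_def)
  show "Eadd k v Ezero = v"
    by (rule Efib_eqI[OF Eadd_mem[OF assms z] assms]) (simp add: Eadd_def Ezero_def)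
  show "Eadd k (Escale (pscale sc) k (- 1) v) v = Ezero"
    by (rule Efib_eqI[OF Eadd_mem[OF Escale_mem[OF assms] assms] z])
      (simp add: Eadd_def Escale_def Ezero_def)
  show "Escale (pscale sc) k 1 v = v"
    by (rule Efib_eqI[OF Escale_mem[OF assms] assms]) (simp add: Escale_def)
qed

lemma E_module_laws:
  "Eadd k (Eadd k u v) w = Eadd k u (Eadd k v w)" "Eadd k u v = Eadd k v u"
  "Escale (pscale sc) k (t + t') v = Eadd k (Escale (pscale sc) k t v) (Escale (pscale sc) k t' v)"
  "Escale (pscale sc) k t (Eadd k u v) = Eadd k (Escale (pscale sc) k t u) (Escale (pscale sc) k t v)"
  "Escale (pscale sc) k (t * t') v = Escale (pscale sc) k t (Escale (pscale sc) k t' v)"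
  unfolding Eadd_def Escale_def
  by (auto intro!: restrict_ext simp: algebra_simps P.scale_left_distrib P.scale_right_distrib)

lemma TkF_fiber_eq:
  assumes i: "i \<in> I" and x: "x \<in> cdom B i" and f: "bij_betw f E E"
  shows "TkF_fiber sV sW k F x = (\<lambda>v. Tp i x (f v)) ` E"
proof -
  have "TkF_fiber sV sW k F x = Tp i x ` E"
  proof (intro equalityI subsetI)
    fix c assume "c \<in> TkF_fiber sV sW k F x"
    then have "c \<in> pts T" "\<pi> c = x" unfolding TkF_fiber_def by auto
    then show "c \<in> Tp i x ` E"
      using fpt_fcoord[OF T_fibred i, of c] x fcoord_mem[of k T i c] by (metis image_eqI)
  next
    fix c assume "c \<in> Tp i x ` E"
    then show "c \<in> TkF_fiber sV sW k F x"
      using fpt_pts[OF T_fibred i x] fpt_proj[OF T_fibred i x] unfolding TkF_fiber_def by auto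
  qed
  also have "\<dots> = Tp i x ` (f ` E)" using f by (simp add: bij_betw_def)
  finally show ?thesis by (simp add: image_image)
qed

lemma fiber_module_simps [simp]:
  "carrier (fiber_module sV sW k F L x) = TkF_fiber sV sW k F x"
  "a \<oplus>\<^bsub>fiber_module sV sW k F L x\<^esub> b = fst L (a, b)"
  "t \<odot>\<^bsub>fiber_module sV sW k F L x\<^esub> a = snd L (t, a)"
  by (simp_all add: fiber_module_def)

lemma fiber_zero:
  assumes i: "i \<in> I" and x: "x \<in> cdom B i" and f: "bij_betw f E E" and L: "conj_by L i x f"
  shows "\<zero>\<^bsub>fiber_module sV sW k F L x\<^esub> = Tp i x (f Ezero)"
proof -
  note fib = TkF_fiber_eq[OF i x f]
  have "(THE z. z \<in> TkF_fiber sV sW k F x \<and> (\<forall>a\<in>TkF_fiber sV sW k F x. fst L (z, a) = a)) = Tp i x (f Ezero)"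
  proof (rule the_equality)
    show "Tp i x (f Ezero) \<in> TkF_fiber sV sW k F x \<and>
        (\<forall>a\<in>TkF_fiber sV sW k F x. fst L (Tp i x (f Ezero), a) = a)"
      unfolding fib using Ezero_mem by (auto simp: conj_byD[OF L] E_module)
    show "z = Tp i x (f Ezero)"
      if "z \<in> TkF_fiber sV sW k F x \<and> (\<forall>a\<in>TkF_fiber sV sW k F x. fst L (z, a) = a)" for z
    proof -
      from that obtain u where u: "z = Tp i x (f u)" "u \<in> E" unfolding fib by blast
      have "Tp i x (f Ezero) \<in> TkF_fiber sV sW k F x" unfolding fib using Ezero_mem by blast
      then have "fst L (z, Tp i x (f Ezero)) = Tp i x (f Ezero)" using that by blast
      then show ?thesis using u by (simp add: conj_byD(1)[OF L u(2) Ezero_mem] E_module)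
    qed
  qed
  then show ?thesis by (simp add: fiber_module_def)
qed

lemma cring_scalar_ring: "cring (scalar_ring :: 'k ring)"
  by (intro cringI abelian_groupI comm_monoidI)
    (auto simp: scalar_ring_def algebra_simps intro: exI[of _ "- _"] left_minus)

text \<open>The axioms hold in \<open>E\<close> and are transported by the bijection \<open>f\<close>.\<close>

lemma module_of_conj:
  assumes i: "i \<in> I" and x: "x \<in> cdom B i" and f: "bij_betw f E E" and L: "conj_by L i x f"
  shows "Module.module scalar_ring (fiber_module sV sW k F L x)"
proof -
  note fib = TkF_fiber_eq[OF i x f] and z = fiber_zero[OF i x f L] and D = conj_byD[OF L]
  have sc: "carrier (scalar_ring :: 'k ring) = UNIV" "a \<oplus>\<^bsub>scalar_ring\<^esub> b = a + b"
    "a \<otimes>\<^bsub>scalar_ring\<^esub> b = a * b" "\<one>\<^bsub>scalar_ring\<^esub> = (1 :: 'k)" for a b :: 'k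
    by (simp_all add: scalar_ring_def)
  have "abelian_group (fiber_module sV sW k F L x)"
  proof (rule abelian_groupI)
    fix a assume "a \<in> carrier (fiber_module sV sW k F L x)"
    then obtain v where v: "a = Tp i x (f v)" "v \<in> E" by (auto simp: fib)
    have "Tp i x (f (Escale (pscale sc) k (- 1) v)) \<in> carrier (fiber_module sV sW k F L x)"
      using Escale_mem[OF v(2)] by (auto simp: fib)
    moreover have "Tp i x (f (Escale (pscale sc) k (- 1) v)) \<oplus>\<^bsub>fiber_module sV sW k F L x\<^esub> a
        = \<zero>\<^bsub>fiber_module sV sW k F L x\<^esub>"
      by (simp add: v z D Escale_mem E_module)
    ultimately show "\<exists>y\<in>carrier (fiber_module sV sW k F L x).
        y \<oplus>\<^bsub>fiber_module sV sW k F L x\<^esub> a = \<zero>\<^bsub>fiber_module sV sW k F L x\<^esub>" by blast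
  next
    fix a b
    assume "a \<in> carrier (fiber_module sV sW k F L x)" "b \<in> carrier (fiber_module sV sW k F L x)"
    then obtain v w where vw: "a = Tp i x (f v)" "v \<in> E" "b = Tp i x (f w)" "w \<in> E" by (auto simp: fib)
    show "a \<oplus>\<^bsub>fiber_module sV sW k F L x\<^esub> b = b \<oplus>\<^bsub>fiber_module sV sW k F L x\<^esub> a"
      by (simp add: vw D E_module_laws(2)[of v w])
  qed (auto simp: fib z D Ezero_mem Eadd_mem E_module E_module_laws(1))
  then show ?thesis
    by (intro Module.moduleI cring_scalar_ring)
      (auto simp: sc fib D Eadd_mem Escale_mem E_module E_module_laws(3,4,5))
qed

lemma finsum_conj:
  assumes M: "Module.module scalar_ring (fiber_module sV sW k F L x)"
    and i: "i \<in> I" and x: "x \<in> cdom B i" and f: "bij_betw f E E" and L: "conj_by L i x f"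
    and S: "finite S" and g: "\<And>a. a \<in> S \<Longrightarrow> g a \<in> E"
  shows "finsum (fiber_module sV sW k F L x) (\<lambda>a. Tp i x (f (g a))) S
    = Tp i x (f (\<lambda>\<alpha>\<in>pk. \<Sum>a\<in>S. g a \<alpha>))"
proof -
  let ?G = "fiber_module sV sW k F L x"
  interpret G: abelian_group ?G using M by (rule Module.module.axioms(2))
  note fib = TkF_fiber_eq[OF i x f]
  show ?thesis
    using S g
  proof (induction S)
    case empty
    show ?case
      unfolding G.finsum_empty sum.empty Ezero_def[symmetric] by (rule fiber_zero[OF i x f L])
  next
    case (insert a S)
    have s: "(\<lambda>\<alpha>\<in>pk. \<Sum>a\<in>S. g a \<alpha>) \<in> E"
      using insert.prems by (auto intro!: P.subspace_sum[OF subspace_Valpha] simp: PiE_mem)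
    have "finsum ?G (\<lambda>a. Tp i x (f (g a))) (insert a S)
        = Tp i x (f (g a)) \<oplus>\<^bsub>?G\<^esub> finsum ?G (\<lambda>a. Tp i x (f (g a))) S"
      using insert.prems insert.hyps by (intro G.finsum_insert) (auto simp: fib)
    also have "finsum ?G (\<lambda>a. Tp i x (f (g a))) S = Tp i x (f (\<lambda>\<alpha>\<in>pk. \<Sum>a\<in>S. g a \<alpha>))"
      by (rule insert.IH[OF insert.prems[OF insertI2]])
    also have "Tp i x (f (g a)) \<oplus>\<^bsub>?G\<^esub> Tp i x (f (\<lambda>\<alpha>\<in>pk. \<Sum>a\<in>S. g a \<alpha>))
        = fst L (Tp i x (f (g a)), Tp i x (f (\<lambda>\<alpha>\<in>pk. \<Sum>a\<in>S. g a \<alpha>)))"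
      by (rule fiber_module_simps(2))
    also have "\<dots> = Tp i x (f (Eadd k (g a) (\<lambda>\<alpha>\<in>pk. \<Sum>a\<in>S. g a \<alpha>)))"
      using conj_byD(1)[OF L _ s] insert.prems by simp
    also have "Eadd k (g a) (\<lambda>\<alpha>\<in>pk. \<Sum>a\<in>S. g a \<alpha>) = (\<lambda>\<alpha>\<in>pk. \<Sum>a\<in>insert a S. g a \<alpha>)"
      unfolding Eadd_def using insert.hyps by (intro restrict_ext) simp
    finally show ?case .
  qed
qed

lemma A_ptsE:
  assumes "a \<in> pts A"
  obtains i v where "i \<in> I" "fst a \<in> cdom B i" "v \<in> E" "a = Ap i (fst a) v"
proof -
  have "fst a \<in> pts B" using AD(4)[OF assms] .
  then obtain i where i: "i \<in> I" "fst a \<in> cdom B i" using base_cover by blast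
  show ?thesis
    using that[OF i fcoord_mem] fpt_fcoord[OF A_fibred i(1) assms i(2)] by metis
qed

lemma T_ptsE:
  assumes "c \<in> pts T"
  obtains i v where "i \<in> I" "\<pi> c \<in> cdom B i" "v \<in> E" "c = Tp i (\<pi> c) v"
proof -
  have "\<pi> c \<in> pts B" using TD(4)[OF assms] .
  then obtain i where i: "i \<in> I" "\<pi> c \<in> cdom B i" using base_cover by blast
  show ?thesis
    using that[OF i fcoord_mem] fpt_fcoord[OF T_fibred i(1) assms i(2)] by metis
qed

text \<open>If the module structure of a fiber is transported by a map \<open>f\<close> that is the identity on the
  axes, the sum of the elements \<open>v\<^sub>\<alpha>\<close> of the axes is \<open>f(v)\<close>.\<close>

lemma sum_map_pt:
  assumes M: "Module.module scalar_ring (fiber_module sV sW k F L x)"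
    and i: "i \<in> I" and x: "x \<in> cdom B i" and f: "bij_betw f E E" and L: "conj_by L i x f"
    and axis: "\<And>\<alpha> u. \<alpha> \<in> pk \<Longrightarrow> u \<in> Valpha \<alpha> \<Longrightarrow> f (single k \<alpha> u) = single k \<alpha> u"
    and v: "v \<in> E"
  shows "sum_map sV sW k F L (Ap i x v) = Tp i x (f v)"
proof -
  let ?G = "fiber_module sV sW k F L x"
  interpret G: abelian_group ?G using M by (rule Module.module.axioms(2))
  obtain u where u: "Ap i x v = (x, u)" "(x, u) \<in> AkF_dom sV sW k F i"
    "\<And>\<alpha>. \<alpha> \<in> pk \<Longrightarrow> Fcoord F i (u \<alpha>) = v \<alpha>" by (rule A_ptE[OF i x v]) blast
  have "(x, u) \<in> pts A" using fpt_pts[OF A_fibred i x v] u(1) by simp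
  then have "sum_map sV sW k F L (Ap i x v) = finsum ?G (\<lambda>\<alpha>. TkF_axis sV sW k F \<alpha> x (u \<alpha>)) pk"
    unfolding u(1) sum_map_def by simp
  also have "\<dots> = finsum ?G (\<lambda>\<alpha>. Tp i x (f (single k \<alpha> (v \<alpha>)))) pk"
  proof (rule G.finsum_cong')
    show "(\<lambda>\<alpha>. Tp i x (f (single k \<alpha> (v \<alpha>)))) \<in> pk \<rightarrow> carrier ?G"
      using single_mem[OF EfibD[OF v]] by (auto simp: TkF_fiber_eq[OF i x f])
    show "TkF_axis sV sW k F \<alpha> x (u \<alpha>) = Tp i x (f (single k \<alpha> (v \<alpha>)))" if a: "\<alpha> \<in> pk" for \<alpha>
      using TkF_axis_pt[OF i x a AdomD(4)[OF i u(2) a]] u(3)[OF a] axis[OF a EfibD[OF v a]] by simp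
  qed simp
  also have "\<dots> = Tp i x (f (\<lambda>\<alpha>\<in>pk. \<Sum>a\<in>pk. single k a (v a) \<alpha>))"
    by (rule finsum_conj[OF M i x f L finite_pos single_mem[OF EfibD[OF v]]])
  also have "(\<lambda>\<alpha>\<in>pk. \<Sum>a\<in>pk. single k a (v a) \<alpha>) = v"
  proof (rule Efib_eqI[OF _ v])
    have *: "(\<Sum>a\<in>pk. single k a (v a) \<alpha>) = v \<alpha>" if a: "\<alpha> \<in> pk" for \<alpha>
    proof -
      have "(\<Sum>a\<in>pk. single k a (v a) \<alpha>) = (\<Sum>a\<in>pk. if \<alpha> = a then v a else 0)"
        by (rule sum.cong) (use a in \<open>auto simp: single_def\<close>)
      then show ?thesis using a by (simp add: sum.delta)
    qed
    then show "(\<lambda>\<alpha>\<in>pk. \<Sum>a\<in>pk. single k a (v a) \<alpha>) \<in> E" using EfibD[OF v] by auto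
    show "(\<lambda>\<alpha>\<in>pk. \<Sum>a\<in>pk. single k a (v a) \<alpha>) \<alpha> = v \<alpha>" if "\<alpha> \<in> pk" for \<alpha>
      using *[OF that] that by simp
  qed
  finally show ?thesis .
qed

lemma E_surj:
  assumes "bij_betw g E E" "v \<in> E" obtains u where "u \<in> E" "v = g u"
proof -
  have "v \<in> g ` E" unfolding bij_betw_imp_surj_on[OF assms(1)] by (rule assms(2))
  then show thesis by (rule imageE) (rule that)
qed

text \<open>A map that preserves base points is bijective if it is so on each fiber.\<close>

lemma fibrewise_bij:
  assumes \<Phi>: "\<And>i x. i \<in> I \<Longrightarrow> x \<in> cdom B i \<Longrightarrow> \<exists>g. bij_betw g E E \<and> (\<forall>v\<in>E. \<Phi> (Ap i x v) = Tp i x (g v))"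
  shows "bij_betw \<Phi> (pts A) (pts T)" and "a \<in> pts A \<Longrightarrow> \<pi> (\<Phi> a) = fst a"
    and "a \<in> pts A \<Longrightarrow> \<Phi> a \<in> pts T"
proof -
  have fst: "\<pi> (\<Phi> a) = fst a \<and> \<Phi> a \<in> pts T" if a: "a \<in> pts A" for a
  proof -
    obtain i v where iv: "i \<in> I" "fst a \<in> cdom B i" "v \<in> E" "a = Ap i (fst a) v" by (rule A_ptsE[OF a])
    obtain g where g: "bij_betw g E E" "\<forall>v\<in>E. \<Phi> (Ap i (fst a) v) = Tp i (fst a) (g v)"
      using \<Phi>[OF iv(1,2)] by blast
    have "\<Phi> a = Tp i (fst a) (g v)" using g(2) iv(3,4) by metis
    then show ?thesis
      using fpt_proj[OF T_fibred iv(1,2)] fpt_pts[OF T_fibred iv(1,2)] bij_betwE[OF g(1)] iv(3) by simp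
  qed
  then show "a \<in> pts A \<Longrightarrow> \<pi> (\<Phi> a) = fst a" "a \<in> pts A \<Longrightarrow> \<Phi> a \<in> pts T" by blast+
  show "bij_betw \<Phi> (pts A) (pts T)"
    unfolding bij_betw_def
  proof (intro conjI inj_onI equalityI subsetI)
    fix a b assume a: "a \<in> pts A" and b: "b \<in> pts A" and eq: "\<Phi> a = \<Phi> b"
    then have ab: "fst a = fst b" using fst by metis
    obtain i v where iv: "i \<in> I" "fst a \<in> cdom B i" "v \<in> E" "a = Ap i (fst a) v" by (rule A_ptsE[OF a])
    define w where "w = fcoord k A i b"
    have w: "w \<in> E" unfolding w_def by (rule fcoord_mem)
    have bw: "b = Ap i (fst a) w"
      using fpt_fcoord[OF A_fibred iv(1) b] iv(2) ab by (simp add: w_def)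
    obtain g where g: "bij_betw g E E" "\<forall>v\<in>E. \<Phi> (Ap i (fst a) v) = Tp i (fst a) (g v)"
      using \<Phi>[OF iv(1,2)] by blast
    have "Tp i (fst a) (g v) = Tp i (fst a) (g w)" using g(2) iv(3,4) w bw eq by metis
    then have "g v = g w"
      using fpt_inj[OF T_fibred iv(1,2)] bij_betwE[OF g(1)] iv(3) w by blast
    then have "v = w" using g(1) iv(3) w by (meson bij_betw_def inj_onD)
    then show "a = b" using iv(4) bw by metis
  next
    show "c \<in> pts T" if "c \<in> \<Phi> ` pts A" for c using that fst by blast
    fix c assume "c \<in> pts T"
    then obtain i v where iv: "i \<in> I" "\<pi> c \<in> cdom B i" "v \<in> E" "c = Tp i (\<pi> c) v" by (rule T_ptsE)
    obtain g where g: "bij_betw g E E" "\<forall>v\<in>E. \<Phi> (Ap i (\<pi> c) v) = Tp i (\<pi> c) (g v)"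
      using \<Phi>[OF iv(1,2)] by blast
    obtain u where u: "u \<in> E" "v = g u" by (rule E_surj[OF g(1) iv(3)])
    have "c = \<Phi> (Ap i (\<pi> c) u)" using g(2) u iv(4) by metis
    then show "c \<in> \<Phi> ` pts A" by (rule image_eqI) (rule fpt_pts[OF A_fibred iv(1,2) u(1)])
  qed
qed

section \<open>Chart representatives\<close>

text \<open>The range of the \<open>i\<close>-th bundle chart, for both \<open>T\<^sup>kF\<close> and \<open>A\<^sup>kF\<close>, and the module of vertical
  vectors, those with base coordinate \<open>0\<close>.\<close>

definition UU :: "'i \<Rightarrow> ('v \<times> 'w, 'k) pt set" where
  "UU i = {p \<in> tmodel k. cmp k 0 p \<in> chart B i ` cdom B i}"

definition VT :: "('v \<times> 'w, 'k) pt set" where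
  "VT = {p \<in> tmodel k. cmp k 0 p = 0}"

lemma openin_UU: "i \<in> I \<Longrightarrow> openin (top_of_set (tmodel k)) (UU i)"
  unfolding UU_def
  using openin_over manifold_openin_image[OF base_manifold] unfolding base_model by blast

lemma UU_image: "i \<in> I \<Longrightarrow> chart T i ` cdom T i = UU i" "i \<in> I \<Longrightarrow> chart A i ` cdom A i = UU i"
  unfolding UU_def using TD(6) AD(6) by auto

lemma pnt_mem_UU: "i \<in> I \<Longrightarrow> x \<in> cdom B i \<Longrightarrow> v \<in> E \<Longrightarrow> pnt k (chart B i x) v \<in> UU i"
  using fpt_chart[OF T_fibred] fpt_cdom[OF T_fibred] UU_image(1) by (metis image_eqI)

lemma UUE:
  assumes "i \<in> I" "p \<in> UU i"
  obtains x v where "p = pnt k (chart B i x) v" "x \<in> cdom B i" "v \<in> E"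
proof -
  from assms(2) obtain x where x: "cmp k 0 p = chart B i x" "x \<in> cdom B i" and p: "p \<in> tmodel k"
    unfolding UU_def by auto
  have "pnt k (chart B i x) (\<lambda>\<alpha>\<in>pk. cmp k \<alpha> p) = pnt k (cmp k 0 p) (\<lambda>\<alpha>. cmp k \<alpha> p)"
    unfolding x(1) by (rule pnt_cong) simp
  then have "p = pnt k (chart B i x) (\<lambda>\<alpha>\<in>pk. cmp k \<alpha> p)" using pnt_cmp[OF p] by simp
  then show ?thesis using that[OF _ x(2), of "\<lambda>\<alpha>\<in>pk. cmp k \<alpha> p"] by auto
qed

lemma cmp_chart_pnt:
  assumes "i \<in> I" "x \<in> cdom B i" "v \<in> E"
  shows "cmp k 0 (pnt k (chart B i x) v) = chart B i x"
    and "\<alpha> \<in> pk \<Longrightarrow> cmp k \<alpha> (pnt k (chart B i x) v) = v \<alpha>"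
proof -
  have "chart B i x \<in> Valpha 0" using base_image_subset[OF assms(1)] assms(2) by blast
  then show "cmp k 0 (pnt k (chart B i x) v) = chart B i x"
    "\<alpha> \<in> pk \<Longrightarrow> cmp k \<alpha> (pnt k (chart B i x) v) = v \<alpha>"
    using cmp_pnt EfibD[OF assms(3)] by blast+
qed

lemma vert_cmp: "vert k p = p - eps k 0 (cmp k 0 p)"
  unfolding vert_def base_pt_cmp ..

lemma cmp_0_eps_0: "cmp k 0 (eps k 0 (cmp k 0 p)) = cmp k 0 p"
  using cmp_eps[OF zero_mem_idx zero_mem_idx cmp_mem_Valpha[of k 0 p], of k] by simp

lemma vert_mem: fixes p :: "('v \<times> 'w, 'k) pt" assumes "p \<in> tmodel k" shows "vert k p \<in> VT"
  using P.subspace_diff[OF subspace_tmodel assms eps_mem_tmodel[OF cmp_mem_Valpha]]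
  unfolding VT_def vert_cmp by (simp add: cmp_diff cmp_0_eps_0)

lemma vert_image: "vert k ` tmodel k = VT"
proof (intro equalityI subsetI)
  fix p assume "p \<in> VT"
  then have "vert k p = p" "p \<in> tmodel k" unfolding vert_cmp VT_def by auto
  then show "p \<in> vert k ` tmodel k" by (metis image_eqI)
qed (use vert_mem in auto)

lemma subspace_VT: "P.subspace VT"
  using subspace_tmodel[of k] unfolding P.subspace_def VT_def by (auto simp: cmp_add cmp_pscale)

lemma lin_on_base: "lin_on (tmodel k) (tmodel k) (\<lambda>p. eps k 0 (cmp k 0 p))"
  by (rule lin_on_comp[OF lin_on_cmp lin_on_eps])

lemma lin_on_vert: "lin_on (tmodel k) VT (vert k)"
  using vert_mem unfolding lin_on_def vert_cmp
  by (auto simp: cmp_add cmp_pscale eps_add eps_pscale P.scale_right_diff_distrib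
      intro!: continuous_on_diff continuous_on_id continuous_on_eps continuous_on_cmp)

lemma vert_pnt:
  assumes "i \<in> I" "x \<in> cdom B i" "v \<in> E"
  shows "vert k (pnt k (chart B i x) v) = (\<Sum>\<alpha>\<in>pk. eps k \<alpha> (v \<alpha>))"
  unfolding vert_cmp cmp_chart_pnt[OF assms] unfolding pnt_def by simp

lemma pnt_Eadd:
  assumes "i \<in> I" "x \<in> cdom B i" "v \<in> E" "w \<in> E"
  shows "pnt k (chart B i x) v + vert k (pnt k (chart B i x) w) = pnt k (chart B i x) (Eadd k v w)"
proof -
  have "(\<Sum>\<alpha>\<in>pk. eps k \<alpha> (Eadd k v w \<alpha>)) = (\<Sum>\<alpha>\<in>pk. eps k \<alpha> (v \<alpha>) + eps k \<alpha> (w \<alpha>))"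
    by (rule sum.cong) (simp_all add: Eadd_def eps_add)
  then show ?thesis
    unfolding vert_pnt[OF assms(1,2,4)] unfolding pnt_def by (simp add: sum.distrib algebra_simps)
qed

lemma pnt_Escale:
  assumes "i \<in> I" "x \<in> cdom B i" "v \<in> E"
  shows "eps k 0 (chart B i x) + t *\<^sub>p vert k (pnt k (chart B i x) v)
    = pnt k (chart B i x) (Escale (pscale sc) k t v)"
proof -
  have "(\<Sum>\<alpha>\<in>pk. eps k \<alpha> (Escale (pscale sc) k t v \<alpha>)) = (\<Sum>\<alpha>\<in>pk. t *\<^sub>p eps k \<alpha> (v \<alpha>))"
    by (rule sum.cong) (simp_all add: Escale_def eps_pscale)
  then show ?thesis
    unfolding vert_pnt[OF assms] unfolding pnt_def by (simp add: P.scale_sum_right)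
qed

text \<open>The inverse of a fiberwise unipotent map is obtained from the map by finitely many sums and
  compositions, hence is smooth if the map is.\<close>

lemma newton_smooth:
  assumes i: "i \<in> I" and \<psi>: "smooth sc (tmodel k) (tmodel k) (UU i) \<psi>"
    and g: "\<And>x. x \<in> cdom B i \<Longrightarrow> unipotent (g x)"
    and rep: "\<And>x v. x \<in> cdom B i \<Longrightarrow> v \<in> E \<Longrightarrow> \<psi> (pnt k (chart B i x) v) = pnt k (chart B i x) (g x v)"
  shows "\<exists>h. smooth sc (tmodel k) (tmodel k) (UU i) h \<and>
    (\<forall>x\<in>cdom B i. \<forall>w\<in>E. h (pnt k (chart B i x) w) = pnt k (chart B i x) ((newton (g x) w ^^ m) w))"
proof (induction m)
  case 0
  show ?case
    by (intro exI[of _ "\<lambda>p. p"] conjI smooth_lin subspace_tmodel openin_UU i lin_on_id) auto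
next
  case (Suc m)
  then obtain h where h: "smooth sc (tmodel k) (tmodel k) (UU i) h"
    and hr: "\<And>x w. x \<in> cdom B i \<Longrightarrow> w \<in> E \<Longrightarrow>
      h (pnt k (chart B i x) w) = pnt k (chart B i x) ((newton (g x) w ^^ m) w)" by blast
  note S = subspace_tmodel[of k]
  have hU: "h p \<in> UU i" if "p \<in> UU i" for p
    using that by (auto elim!: UUE[OF i] simp: hr intro!: pnt_mem_UU i newton_iterate_mem g)
  have "smooth sc (tmodel k) (tmodel k) (UU i) (\<lambda>p. p + - (\<psi> (h p) + - h p))"
    by (intro smooth_add smooth_minus S h smooth_lin[OF S openin_UU[OF i] lin_on_id[OF order_refl]]
        smooth_comp[OF S S h hU \<psi>])
  moreover have "pnt k (chart B i x) w + - (\<psi> (h (pnt k (chart B i x) w)) + - h (pnt k (chart B i x) w))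
      = pnt k (chart B i x) ((newton (g x) w ^^ Suc m) w)" if x: "x \<in> cdom B i" and w: "w \<in> E" for x w
    using rep[OF x newton_iterate_mem[OF g[OF x] w]] by (simp add: hr[OF x w] pnt_newton)
  ultimately show ?case by blast
qed

section \<open>The fiber product and the domain of scalar multiplication\<close>

abbreviation "Q \<equiv> TkF_fprod sV sW k F"

lemma Q_simps:
  "ind Q = I" "cdom Q i = {(a, b). a \<in> pts T \<and> b \<in> pts T \<and> \<pi> a = \<pi> b \<and> a \<in> cdom T i \<and> b \<in> cdom T i}"
  "chart Q i (a, b) = pair (chart T i a) (vert k (chart T i b))" "model Q = prd (tmodel k) VT"
  "pts Q = {(a, b). a \<in> pts T \<and> b \<in> pts T \<and> \<pi> a = \<pi> b}"
  unfolding TkF_fprod_def Let_def by (auto simp: TD(2,3) vert_image)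

lemma Q_cdom:
  assumes "i \<in> I"
  shows "(a, b) \<in> cdom Q i \<longleftrightarrow> (\<exists>x\<in>cdom B i. \<exists>v\<in>E. \<exists>w\<in>E. a = Tp i x v \<and> b = Tp i x w)"
proof
  assume "(a, b) \<in> cdom Q i"
  then have ab: "a \<in> pts T" "b \<in> pts T" "\<pi> a = \<pi> b" "a \<in> cdom T i" by (auto simp: Q_simps)
  then have x: "\<pi> a \<in> cdom B i" using fibred_mem_cdom_iff[OF T_fibred assms] by blast
  then show "\<exists>x\<in>cdom B i. \<exists>v\<in>E. \<exists>w\<in>E. a = Tp i x v \<and> b = Tp i x w"
    using fpt_fcoord[OF T_fibred assms ab(1)] fpt_fcoord[OF T_fibred assms ab(2)] ab(3) fcoord_mem
    by metis
next
  assume "\<exists>x\<in>cdom B i. \<exists>v\<in>E. \<exists>w\<in>E. a = Tp i x v \<and> b = Tp i x w"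
  then show "(a, b) \<in> cdom Q i"
    using fpt_pts[OF T_fibred assms] fpt_cdom[OF T_fibred assms] fpt_proj[OF T_fibred assms]
    by (auto simp: Q_simps)
qed

lemma Q_chart_pt:
  "i \<in> I \<Longrightarrow> x \<in> cdom B i \<Longrightarrow> v \<in> E \<Longrightarrow> w \<in> E \<Longrightarrow>
    chart Q i (Tp i x v, Tp i x w) = pair (pnt k (chart B i x) v) (vert k (pnt k (chart B i x) w))"
  by (simp add: Q_simps fpt_chart[OF T_fibred])

text \<open>The base coordinate of the second point is that of the first, so its fiber coordinates suffice.\<close>

lemma Q_inj: assumes i: "i \<in> I" shows "inj_on (chart Q i) (cdom Q i)"
proof (rule inj_onI, clarsimp)
  fix a b a' b' assume "(a, b) \<in> cdom Q i" "(a', b') \<in> cdom Q i" and eq: "chart Q i (a, b) = chart Q i (a', b')"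
  then obtain x v w x' v' w' where *: "x \<in> cdom B i" "v \<in> E" "w \<in> E" "a = Tp i x v" "b = Tp i x w"
    "x' \<in> cdom B i" "v' \<in> E" "w' \<in> E" "a' = Tp i x' v'" "b' = Tp i x' w'"
    unfolding Q_cdom[OF i] by blast
  have e: "pnt k (chart B i x) v = pnt k (chart B i x') v'"
    "vert k (pnt k (chart B i x) w) = vert k (pnt k (chart B i x') w')"
    using eq * by (auto simp: Q_chart_pt i)
  have "chart B i x = chart B i x'"
    using e(1) cmp_chart_pnt(1)[OF i] * by metis
  then have x: "x = x'" using inj_onD[OF manifold_inj[OF base_manifold i]] * by blast
  have "pnt k (chart B i x) w = pnt k (chart B i x) w'"
    using e(2) x * by (simp add: vert_cmp cmp_chart_pnt[OF i])
  then show "a = a' \<and> b = b'"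
    using * x e(1) by (simp add: fpt_def)
qed

text \<open>The second point is recovered by adding the base coordinate of the first to its vertical part.\<close>

lemma Q_image:
  assumes i: "i \<in> I" and j: "j \<in> I"
  shows "overlap Q i j = prd (overlap T i j) VT"
proof (intro equalityI subsetI)
  fix z assume "z \<in> overlap Q i j"
  then obtain a b where ab: "z = chart Q i (a, b)" "(a, b) \<in> cdom Q i" "(a, b) \<in> cdom Q j"
    unfolding overlap_def by auto
  then have "chart T i b \<in> tmodel k" using UU_image(1)[OF i] unfolding UU_def by (auto simp: Q_simps)
  then show "z \<in> prd (overlap T i j) VT"
    using ab vert_mem unfolding overlap_def by (auto simp: Q_simps)
next
  fix z assume "z \<in> prd (overlap T i j) VT"
  then obtain p q where z: "z = pair p q" "p \<in> overlap T i j" "q \<in> VT" by (auto elim: prdE)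
  then obtain a where a: "p = chart T i a" "a \<in> cdom T i" "a \<in> cdom T j" unfolding overlap_def by blast
  have ap: "a \<in> pts T" "\<pi> a \<in> cdom B i" "\<pi> a \<in> cdom B j" using a TD(5)[OF i] TD(5)[OF j] by auto
  let ?x = "\<pi> a"
  have xV: "chart B i ?x \<in> Valpha 0" using base_image_subset[OF i] ap(2) by blast
  let ?q = "eps k 0 (chart B i ?x) + q"
  have cx: "cmp k 0 (eps k 0 (chart B i ?x)) = chart B i ?x"
    using cmp_eps[OF zero_mem_idx zero_mem_idx xV] by simp
  have "?q \<in> UU i"
    using z(3) ap(2) unfolding UU_def VT_def
    by (auto simp: cmp_add cx intro!: P.subspace_add[OF subspace_tmodel] eps_mem_tmodel xV)
  then obtain b where b: "?q = chart T i b" "b \<in> cdom T i" using UU_image(1)[OF i] by auto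
  have "chart B i (\<pi> b) = chart B i ?x"
    using TD(7)[OF i b(2)] b(1)[symmetric] z(3) unfolding VT_def by (simp add: cmp_add cx)
  then have pb: "\<pi> b = ?x"
    using inj_onD[OF manifold_inj[OF base_manifold i]] b(2) TD(5)[OF i] ap(2) by blast
  have bp: "b \<in> pts T" "b \<in> cdom T j" using b(2) TD(5)[OF i] TD(5)[OF j] pb ap by auto
  have "vert k ?q = q" using z(3) unfolding vert_cmp VT_def by (simp add: cmp_add cx)
  then have "z = chart Q i (a, b)" using z(1) a(1) b(1) by (simp add: Q_simps)
  then show "z \<in> overlap Q i j"
    unfolding overlap_def using a b bp ap pb by (intro image_eqI[of _ _ "(a, b)"]) (auto simp: Q_simps)
qed

lemma overlap_T_self: "i \<in> I \<Longrightarrow> overlap T i i = UU i"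
  unfolding overlap_self using UU_image by blast

lemma Q_cinv:
  assumes "i \<in> I" "x \<in> cdom B i" "v \<in> E" "w \<in> E"
  shows "cinv Q i (pair (pnt k (chart B i x) v) (vert k (pnt k (chart B i x) w))) = (Tp i x v, Tp i x w)"
proof -
  have "(Tp i x v, Tp i x w) \<in> cdom Q i" unfolding Q_cdom[OF assms(1)] using assms by blast
  from inv_into_f_f[OF Q_inj[OF assms(1)] this] show ?thesis
    unfolding cinv_def by (simp add: Q_chart_pt assms)
qed

lemma continuous_map_pt_pair:
  assumes "continuous_map X euclidean f" "continuous_map X euclidean g"
  shows "continuous_map X euclidean (\<lambda>a. pair (f a) (g a))"
proof -
  have fg: "continuous_map X euclidean (\<lambda>a. (f a, g a))"
    unfolding prod_topology_euclidean[symmetric] continuous_map_pairwise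
    using assms by (simp only: comp_def fst_conv snd_conv)
  have "continuous_map euclidean euclidean (\<lambda>z. pair (fst z) (snd z))"
    unfolding continuous_map_iff_continuous2
    by (intro continuous_on_pair continuous_on_fst continuous_on_snd continuous_on_id)
  from continuous_map_compose[OF fg this] show ?thesis by (simp add: comp_def)
qed

lemma T_chart_continuous:
  "i \<in> I \<Longrightarrow> continuous_map (subtopology (mtop T) (cdom T i)) euclidean (chart T i)"
  using manifold_chart_continuous[OF TD(1)] TD(2) by (auto simp: continuous_map_in_subtopology)

lemma Q_openin: "i \<in> I \<Longrightarrow> openin (mtop Q) (cdom Q i)"
proof -
  assume i: "i \<in> I"
  have "openin (prod_topology (mtop T) (mtop T)) (cdom T i \<times> cdom T i)"
    using manifold_openin_cdom[OF TD(1), of i] TD(2) i by (simp add: openin_prod_Times_iff)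
  then show "openin (mtop Q) (cdom Q i)"
    unfolding TkF_fprod_def Let_def by (auto simp: openin_subtopology)
qed

lemma Q_chart_continuous:
  assumes i: "i \<in> I"
  shows "continuous_map (subtopology (mtop Q) (cdom Q i)) (top_of_set (model Q)) (chart Q i)"
proof -
  let ?X = "subtopology (mtop Q) (cdom Q i)"
  have X: "?X = subtopology (prod_topology (mtop T) (mtop T)) (cdom Q i)"
  proof -
    have "mtop Q = subtopology (prod_topology (mtop T) (mtop T)) (pts Q)"
      unfolding TkF_fprod_def Let_def by (rule topology_eq[THEN iffD2]) (auto simp: openin_subtopology)
    moreover have "pts Q \<inter> cdom Q i = cdom Q i" by (auto simp: Q_simps)
    ultimately show ?thesis by (metis subtopology_subtopology)
  qed
  have f: "continuous_map ?X (subtopology (mtop T) (cdom T i)) fst"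
    and s: "continuous_map ?X (subtopology (mtop T) (cdom T i)) snd"
    unfolding X continuous_map_in_subtopology
    using continuous_map_from_subtopology[OF continuous_map_fst] continuous_map_from_subtopology[OF continuous_map_snd]
    by (auto simp: Q_simps)
  have v: "continuous_map euclidean euclidean (vert k :: ('v \<times> 'w, 'k) pt \<Rightarrow> _)"
    unfolding continuous_map_iff_continuous2 vert_cmp
    by (intro continuous_on_diff continuous_on_id continuous_on_eps continuous_on_cmp)
  have "continuous_map ?X euclidean (\<lambda>a. pair ((chart T i \<circ> fst) a) ((vert k \<circ> (chart T i \<circ> snd)) a))"
    by (intro continuous_map_pt_pair continuous_map_compose[OF f T_chart_continuous[OF i]]
        continuous_map_compose[OF continuous_map_compose[OF s T_chart_continuous[OF i]] v])
  moreover have "(\<lambda>a. pair ((chart T i \<circ> fst) a) ((vert k \<circ> (chart T i \<circ> snd)) a)) = chart Q i"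
    by (auto simp: Q_simps fun_eq_iff)
  moreover have "chart Q i ` cdom Q i \<subseteq> model Q"
  proof -
    have "prd (overlap T i i) VT \<subseteq> prd (tmodel k) VT"
      unfolding overlap_T_self[OF i] UU_def by (auto simp: mem_prd_iff)
    then show ?thesis using Q_image[OF i i] by (simp add: overlap_self Q_simps)
  qed
  ultimately show ?thesis unfolding continuous_map_in_subtopology by auto
qed

lemma openin_overlap_T: "i \<in> I \<Longrightarrow> j \<in> I \<Longrightarrow> openin (top_of_set (tmodel k)) (overlap T i j)"
  using smooth_openin[OF manifold_transition_smooth[OF TD(1)]] TD(2,3) by simp

text \<open>The fiber product and \<open>\<K> \<times> T\<^sup>kF\<close> enter only as domains of maps, for which open domains, continuous
  injective charts and open overlaps are enough.\<close>

lemma smooth_map_from_Q: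
  assumes f: "\<And>i p. i \<in> I \<Longrightarrow> p \<in> pts Q \<Longrightarrow> f p \<in> cdom T i \<longleftrightarrow> p \<in> cdom Q i"
    and sm: "\<And>i. i \<in> I \<Longrightarrow>
      smooth sc (prd (tmodel k) VT) (tmodel k) (prd (UU i) VT) (\<lambda>z. chart T i (f (cinv Q i z)))"
  shows "smooth_map sc Q T f"
proof (rule smooth_mapI[OF TD(1)])
  show "P.subspace (model T)" unfolding TD(3) by (rule subspace_tmodel)
  show "ind T = ind Q" by (simp add: TD(2) Q_simps)
  show "P.subspace (model Q)" unfolding Q_simps by (intro subspace_prd subspace_tmodel subspace_VT)
  show "(\<Union>i\<in>ind Q. cdom Q i) = pts Q"
  proof (intro equalityI subsetI)
    fix p assume "p \<in> pts Q"
    then obtain a b where ab: "p = (a, b)" "a \<in> pts T" "b \<in> pts T" "\<pi> a = \<pi> b" by (auto simp: Q_simps)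
    obtain i where i: "i \<in> I" "\<pi> a \<in> cdom B i" using base_cover[OF TD(4)[OF ab(2)]] by blast
    then have "(a, b) \<in> cdom Q i"
      using ab fibred_mem_cdom_iff[OF T_fibred i(1) ab(2)] fibred_mem_cdom_iff[OF T_fibred i(1) ab(3)]
      by (simp add: Q_simps)
    then show "p \<in> (\<Union>i\<in>ind Q. cdom Q i)" using ab i by (auto simp: Q_simps)
  qed (auto simp: Q_simps)
  fix i assume "i \<in> ind Q"
  then have i: "i \<in> I" by (simp add: Q_simps)
  show "openin (mtop Q) (cdom Q i)" by (rule Q_openin[OF i])
  show "continuous_map (subtopology (mtop Q) (cdom Q i)) (top_of_set (model Q)) (chart Q i)"
    by (rule Q_chart_continuous[OF i])
  show "inj_on (chart Q i) (cdom Q i)" by (rule Q_inj[OF i])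
  show "openin (top_of_set (model Q)) (overlap Q i j)" if "j \<in> ind Q" for j
    using that Q_image[OF i] openin_prd[OF openin_overlap_T[OF i]] by (simp add: Q_simps)
  show "f p \<in> cdom T i \<longleftrightarrow> p \<in> cdom Q i" if "p \<in> pts Q" for p by (rule f[OF i that])
  show "smooth sc (model Q) (model T) (chart Q i ` cdom Q i) (\<lambda>z. chart T i (f (cinv Q i z)))"
    using sm[OF i] Q_image[OF i i] by (simp add: Q_simps TD(3) overlap_self overlap_T_self[OF i, unfolded overlap_self])
qed

abbreviation "ST \<equiv> scalar_times T"

lemma ST_simps:
  "ind ST = I" "cdom ST i = UNIV \<times> cdom T i" "chart ST i (t, a) = pair (spt t) (chart T i a)"
  "model ST = prd (range spt) (tmodel k)" "pts ST = UNIV \<times> pts T"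
  unfolding scalar_times_def by (auto simp: TD(2,3))

lemma ST_inj: assumes i: "i \<in> I" shows "inj_on (chart ST i) (cdom ST i)"
proof (rule inj_onI)
  fix p q assume p: "p \<in> cdom ST i" and q: "q \<in> cdom ST i" and eq: "chart ST i p = chart ST i q"
  obtain t a u b where ab: "p = (t, a)" "q = (u, b)" by (cases p; cases q)
  have "a = b"
    by (rule inj_onD[OF manifold_inj[OF TD(1), of i]]) (use p q eq ab i TD(2) in \<open>simp_all add: ST_simps\<close>)
  then show "p = q" using eq ab by (simp add: ST_simps)
qed

lemma ST_overlap: "overlap ST i j = prd (range spt) (overlap T i j)"
proof (intro equalityI subsetI)
  fix z assume "z \<in> overlap ST i j"
  then obtain p where p: "z = chart ST i p" "p \<in> cdom ST i" "p \<in> cdom ST j"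
    unfolding overlap_def by blast
  then show "z \<in> prd (range spt) (overlap T i j)"
    unfolding overlap_def by (cases p) (simp add: ST_simps)
next
  fix z assume "z \<in> prd (range spt) (overlap T i j)"
  then obtain p q where z: "z = pair p q" "p \<in> range spt" "q \<in> overlap T i j" by (rule prdE)
  then obtain t a where ta: "p = spt t" "q = chart T i a" "a \<in> cdom T i" "a \<in> cdom T j"
    unfolding overlap_def by blast
  have "z = chart ST i (t, a)" using z ta by (simp add: ST_simps)
  moreover have "(t, a) \<in> cdom ST i \<inter> cdom ST j" using ta by (simp add: ST_simps)
  ultimately show "z \<in> overlap ST i j" unfolding overlap_def by blast
qed

lemma ST_cinv:
  assumes "i \<in> I" "x \<in> cdom B i" "v \<in> E"
  shows "cinv ST i (pair (spt t) (pnt k (chart B i x) v)) = (t, Tp i x v)"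
proof -
  have "(t, Tp i x v) \<in> cdom ST i" using fpt_cdom[OF T_fibred assms] by (simp add: ST_simps)
  from inv_into_f_f[OF ST_inj[OF assms(1)] this] show ?thesis
    unfolding cinv_def by (simp add: ST_simps fpt_chart[OF T_fibred assms])
qed

lemma ST_chart_continuous:
  assumes i: "i \<in> I"
  shows "continuous_map (subtopology (mtop ST) (cdom ST i)) (top_of_set (model ST)) (chart ST i)"
proof -
  let ?X = "subtopology (mtop ST) (cdom ST i)"
  have X: "?X = subtopology (prod_topology euclidean (mtop T)) (UNIV \<times> cdom T i)"
    unfolding ST_simps by (simp add: scalar_times_def)
  have s: "continuous_map ?X (subtopology (mtop T) (cdom T i)) snd"
    unfolding X continuous_map_in_subtopology
    using continuous_map_from_subtopology[OF continuous_map_snd] by auto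
  have f: "continuous_map ?X euclidean (fst :: 'k \<times> _ \<Rightarrow> 'k)"
    unfolding X using continuous_map_from_subtopology[OF continuous_map_fst] .
  have p: "continuous_map euclidean euclidean (spt :: 'k \<Rightarrow> ('v \<times> 'w, 'k) pt)"
    unfolding continuous_map_iff_continuous2 by (intro continuous_on_spt continuous_on_id)
  have "continuous_map ?X euclidean (\<lambda>a. pair ((spt \<circ> fst) a) ((chart T i \<circ> snd) a))"
    by (intro continuous_map_pt_pair continuous_map_compose[OF f p]
        continuous_map_compose[OF s T_chart_continuous[OF i]])
  moreover have "(\<lambda>a. pair ((spt \<circ> fst) a) ((chart T i \<circ> snd) a)) = chart ST i"
    by (auto simp: ST_simps fun_eq_iff)
  moreover have "chart ST i ` cdom ST i \<subseteq> model ST"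
    using UU_image(1)[OF i] unfolding UU_def by (auto simp: ST_simps)
  ultimately show ?thesis unfolding continuous_map_in_subtopology by auto
qed

lemma smooth_map_from_ST:
  assumes f: "\<And>i p. i \<in> I \<Longrightarrow> p \<in> pts ST \<Longrightarrow> f p \<in> cdom T i \<longleftrightarrow> p \<in> cdom ST i"
    and sm: "\<And>i. i \<in> I \<Longrightarrow>
      smooth sc (prd (range spt) (tmodel k)) (tmodel k) (prd (range spt) (UU i)) (\<lambda>z. chart T i (f (cinv ST i z)))"
  shows "smooth_map sc ST T f"
proof (rule smooth_mapI[OF TD(1)])
  show "P.subspace (model T)" unfolding TD(3) by (rule subspace_tmodel)
  show "ind T = ind ST" by (simp add: TD(2) ST_simps)
  show "P.subspace (model ST)" unfolding ST_simps by (intro subspace_prd subspace_tmodel subspace_spt)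
  show "(\<Union>i\<in>ind ST. cdom ST i) = pts ST"
    using manifold_cover[OF TD(1)] TD(2) by (auto simp: ST_simps)
  fix i assume "i \<in> ind ST"
  then have i: "i \<in> I" by (simp add: ST_simps)
  show "openin (mtop ST) (cdom ST i)"
    using manifold_openin_cdom[OF TD(1), of i] TD(2) i
    unfolding ST_simps by (simp add: scalar_times_def openin_prod_Times_iff)
  show "continuous_map (subtopology (mtop ST) (cdom ST i)) (top_of_set (model ST)) (chart ST i)"
    by (rule ST_chart_continuous[OF i])
  show "inj_on (chart ST i) (cdom ST i)" by (rule ST_inj[OF i])
  show "openin (top_of_set (model ST)) (overlap ST i j)" if "j \<in> ind ST" for j
    using that openin_prd[OF openin_subtopology_self openin_overlap_T[OF i]]
    unfolding ST_overlap by (simp add: ST_simps)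
  show "f p \<in> cdom T i \<longleftrightarrow> p \<in> cdom ST i" if "p \<in> pts ST" for p by (rule f[OF i that])
  show "smooth sc (model ST) (model T) (chart ST i ` cdom ST i) (\<lambda>z. chart T i (f (cinv ST i z)))"
    using sm[OF i] ST_overlap[of i i] by (simp add: ST_simps TD(3) overlap_self overlap_T_self[OF i, unfolded overlap_self])
qed

end

context vbundle_power begin

section \<open>From connections to isomorphisms\<close>

abbreviation "conns \<equiv> multilinear_connections sV sW k F"
abbreviation "isos \<equiv> {\<Phi> \<in> multilinear_isos sV sW k F. identity_on_axes sV sW k F \<Phi>}"
abbreviation "\<Sigma>map \<equiv> sum_map sV sW k F"
abbreviation "push \<equiv> push_L0 sV sW k F"

lemma single_zero: "\<alpha> \<in> pk \<Longrightarrow> single k \<alpha> 0 = Ezero"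
  unfolding single_def Ezero_def by (intro restrict_ext) simp

lemma pk_nonempty: "\<exists>\<alpha>. \<alpha> \<in> pk"
  by (rule exI[of _ "(\<lambda>_. 0)(0 := 1)"]) (auto simp: pos_def idx_def fun_eq_iff)

text \<open>A conjugating map of the kind that determines \<open>\<Phi>\<^sup>L\<close>: unipotent and the identity on the axes.\<close>

definition normal where
  "normal L i x g \<longleftrightarrow> g \<in> Mgrp \<and> unipotent g \<and> conj_by L i x g \<and>
     (\<forall>\<alpha>\<in>pk. \<forall>u\<in>Valpha \<alpha>. g (single k \<alpha> u) = single k \<alpha> u)"

text \<open>The maps \<open>D\<close> that normalize a conjugating element act linearly on each \<open>V\<^sub>\<alpha>\<close>, hence are
  automorphisms of the module \<open>E\<close>; composing with them does not change the transported structure.\<close>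

lemma connection_normal:
  assumes L: "L \<in> conns" and i: "i \<in> I" and x: "x \<in> cdom B i"
  shows "\<exists>g. normal L i x g"
proof -
  have "\<forall>i\<in>I. \<forall>x\<in>cdom B i. \<exists>f\<in>Mgrp. conj_by L i x f"
    using L unfolding multilinear_connections_def conj_by_def TkF_pt_fpt by (elim CollectE conjE)
  then obtain f where f: "f \<in> Mgrp" and c: "conj_by L i x f"
    using i x by blast
  obtain D where D: "\<And>\<alpha>. \<alpha> \<in> pk \<Longrightarrow> bij_betw (D \<alpha>) (Valpha \<alpha>) (Valpha \<alpha>)"
    "\<And>\<alpha> x y. \<alpha> \<in> pk \<Longrightarrow> x \<in> Valpha \<alpha> \<Longrightarrow> y \<in> Valpha \<alpha> \<Longrightarrow> D \<alpha> (x + y) = D \<alpha> x + D \<alpha> y"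
    "\<And>\<alpha> x t. \<alpha> \<in> pk \<Longrightarrow> x \<in> Valpha \<alpha> \<Longrightarrow> D \<alpha> (t *\<^sub>p x) = t *\<^sub>p D \<alpha> x"
    "\<And>\<alpha> x. \<alpha> \<in> pk \<Longrightarrow> x \<in> Valpha \<alpha> \<Longrightarrow> f (single k \<alpha> (D \<alpha> x)) = single k \<alpha> x"
    and g: "(\<lambda>v\<in>E. f (\<lambda>\<alpha>\<in>pk. D \<alpha> (v \<alpha>))) \<in> Mgrp" "unipotent (\<lambda>v\<in>E. f (\<lambda>\<alpha>\<in>pk. D \<alpha> (v \<alpha>)))"
    by (rule Mgrp_normalize[OF f]) (rule that)
  let ?d = "\<lambda>v. (\<lambda>\<alpha>\<in>pk. D \<alpha> (v \<alpha>))"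
  let ?g = "\<lambda>v\<in>E. f (?d v)"
  have d: "?d v \<in> E" if "v \<in> E" for v
    using bij_betwE[OF D(1)] EfibD[OF that] by auto
  have D0: "D \<alpha> 0 = 0" if "\<alpha> \<in> pk" for \<alpha>
    using D(3)[OF that zero_mem_Valpha, of 0] by simp
  have add: "?d (Eadd k v w) = Eadd k (?d v) (?d w)" if "v \<in> E" "w \<in> E" for v w
    unfolding Eadd_def using D(2) EfibD[OF that(1)] EfibD[OF that(2)] by (intro restrict_ext) simp
  have scale: "?d (Escale (pscale sc) k t v) = Escale (pscale sc) k t (?d v)" if "v \<in> E" for t v
    unfolding Escale_def using D(3) EfibD[OF that] by (intro restrict_ext) simp
  have "conj_by L i x ?g"
    unfolding conj_by_def using conj_byD[OF c] d Eadd_mem Escale_mem add scale by simp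
  moreover have "?g (single k \<alpha> u) = single k \<alpha> u" if a: "\<alpha> \<in> pk" and u: "u \<in> Valpha \<alpha>" for \<alpha> u
  proof -
    have "?d (single k \<alpha> u) = single k \<alpha> (D \<alpha> u)"
      unfolding single_def using D0 by (intro restrict_ext) simp
    then show ?thesis using D(4)[OF a u] single_mem[OF u] by simp
  qed
  ultimately show ?thesis using g unfolding normal_def by blast
qed

lemma normalD:
  assumes "normal L i x g"
  shows "g \<in> Mgrp" "unipotent g" "conj_by L i x g" "bij_betw g E E"
    "\<alpha> \<in> pk \<Longrightarrow> u \<in> Valpha \<alpha> \<Longrightarrow> g (single k \<alpha> u) = single k \<alpha> u" "g Ezero = Ezero"
proof -
  show n: "g \<in> Mgrp" "unipotent g" "conj_by L i x g"
    and a: "\<alpha> \<in> pk \<Longrightarrow> u \<in> Valpha \<alpha> \<Longrightarrow> g (single k \<alpha> u) = single k \<alpha> u" for \<alpha> u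
    using assms unfolding normal_def by blast+
  show "bij_betw g E E" by (rule Mgrp_bij[OF n(1)])
  obtain \<alpha> where "\<alpha> \<in> pk" using pk_nonempty by blast
  from a[OF this zero_mem_Valpha] show "g Ezero = Ezero" by (simp add: single_zero \<open>\<alpha> \<in> pk\<close>)
qed

lemma linear_structureD:
  assumes "linear_structure sV sW k F L"
  shows "fst L \<in> extensional (pts Q)" "snd L \<in> extensional (UNIV \<times> pts T)"
    "smooth_map sc Q T (fst L)" "(a, b) \<in> pts Q \<Longrightarrow> \<pi> (fst L (a, b)) = \<pi> a"
    "x \<in> pts B \<Longrightarrow> Module.module scalar_ring (fiber_module sV sW k F L x)"
  using assms unfolding linear_structure_def Let_def by auto

lemma connection_linear: "L \<in> conns \<Longrightarrow> linear_structure sV sW k F L"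
  unfolding multilinear_connections_def by blast

lemma connection_module:
  "L \<in> conns \<Longrightarrow> i \<in> I \<Longrightarrow> x \<in> cdom B i \<Longrightarrow> Module.module scalar_ring (fiber_module sV sW k F L x)"
  using linear_structureD(5)[OF connection_linear] base_cdom_subset by blast

lemma sum_map_normal:
  assumes "L \<in> conns" "i \<in> I" "x \<in> cdom B i" "normal L i x g" "v \<in> E"
  shows "\<Sigma>map L (Ap i x v) = Tp i x (g v)"
  by (rule sum_map_pt[OF connection_module[OF assms(1-3)] assms(2,3) normalD(4)[OF assms(4)]
        normalD(3)[OF assms(4)] normalD(5)[OF assms(4)] assms(5)])

lemma connection_rep_smooth:
  assumes L: "linear_structure sV sW k F L" and i: "i \<in> I"
  shows "smooth sc (prd (tmodel k) VT) (tmodel k) (prd (UU i) VT) (\<lambda>z. chart T i (fst L (cinv Q i z)))"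
proof -
  note D = linear_structureD[OF L]
  have m: "fst L p \<in> cdom T i" if p: "p \<in> cdom Q i" for p
  proof -
    obtain a b where ab: "p = (a, b)" by (cases p)
    have pq: "(a, b) \<in> pts Q" and pa: "\<pi> a \<in> cdom B i"
      using p ab TD(5)[OF i] by (auto simp: Q_simps)
    have "fst L (a, b) \<in> pts T"
      using D(3) pq unfolding smooth_map_def continuous_map_def by blast
    then show ?thesis using fibred_mem_cdom_iff[OF T_fibred i] D(4)[OF pq] pa ab by simp
  qed
  from smooth_map_rep[OF D(3) _ _ m] show ?thesis
    using i Q_image[OF i i] by (simp add: Q_simps TD(2,3) overlap_self overlap_T_self[OF i, unfolded overlap_self])
qed

text \<open>In a chart, \<open>\<Phi>\<^sup>L\<close> is obtained by adding up the axis components one after the other by means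
  of the smooth addition of \<open>L\<close>.\<close>

lemma sum_map_rep_smooth:
  assumes L: "L \<in> conns" and i: "i \<in> I"
  shows "smooth sc (tmodel k) (tmodel k) (UU i) (\<lambda>z. chart T i (\<Sigma>map L (cinv A i z)))"
proof -
  obtain g where g: "\<And>x. x \<in> cdom B i \<Longrightarrow> normal L i x (g x)"
    using connection_normal[OF L i] by metis
  let ?R = "\<lambda>z. chart T i (fst L (cinv Q i z))"
  let ?r = "\<lambda>S v. (\<lambda>\<alpha>\<in>pk. if \<alpha> \<in> S then v \<alpha> else 0)"
  note S = subspace_tmodel[of k] and O = openin_UU[OF i]
  have part: "\<exists>\<sigma>. smooth sc (tmodel k) (tmodel k) (UU i) \<sigma> \<and>
      (\<forall>x\<in>cdom B i. \<forall>v\<in>E. \<sigma> (pnt k (chart B i x) v) = pnt k (chart B i x) (g x (?r S v)))"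
    if "finite S" "S \<subseteq> pk" for S
    using that
  proof (induction S rule: finite_subset_induct')
    case empty
    have z: "?r {} v = Ezero" for v by (simp add: Ezero_def)
    have "pnt k y Ezero = eps k 0 y" for y :: "('v \<times> 'w, 'k) pt"
      unfolding pnt_def by (simp add: Ezero_def)
    then show ?case
      using normalD(6)[OF g] cmp_chart_pnt(1)[OF i] unfolding z
      by (intro exI[of _ "\<lambda>p. eps k 0 (cmp k 0 p)"] conjI smooth_lin[OF S O lin_on_base]) simp
  next
    case (insert a S)
    then obtain \<sigma> where \<sigma>: "smooth sc (tmodel k) (tmodel k) (UU i) \<sigma>"
      and sv: "\<And>x v. x \<in> cdom B i \<Longrightarrow> v \<in> E \<Longrightarrow> \<sigma> (pnt k (chart B i x) v) = pnt k (chart B i x) (g x (?r S v))"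
      by blast
    note a = \<open>a \<in> pk\<close>
    \<comment> \<open>The pair consists of the axis component of index \<open>a\<close> and the partial sum over \<open>S\<close>.\<close>
    let ?h = "\<lambda>p. pair (eps k 0 (cmp k 0 p) + eps k a (cmp k a p)) (vert k (\<sigma> p))"
    have l: "lin_on (tmodel k) (tmodel k) (\<lambda>p. eps k 0 (cmp k 0 p) + eps k a (cmp k a p))"
      by (intro lin_on_plus[OF S] lin_on_comp[OF lin_on_cmp lin_on_eps])
    have s2: "smooth sc (tmodel k) VT (UU i) (\<lambda>p. vert k (\<sigma> p))"
      by (rule smooth_comp[OF S S \<sigma> smooth_mem[OF \<sigma>] smooth_lin[OF S _ lin_on_vert]]) auto
    have h: "smooth sc (tmodel k) (prd (tmodel k) VT) (UU i) ?h"
      by (rule smooth_pair[OF S smooth_lin[OF S O l] s2])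
    have r: "?r S v \<in> E" if "v \<in> E" for v using EfibD[OF that] by auto
    have hv: "?h (pnt k (chart B i x) v)
        = pair (pnt k (chart B i x) (g x (single k a (v a)))) (vert k (pnt k (chart B i x) (g x (?r S v))))"
      if x: "x \<in> cdom B i" and v: "v \<in> E" for x v
      using cmp_chart_pnt[OF i x v] sv[OF x v] normalD(5)[OF g[OF x] a EfibD[OF v a]] a
      by (simp add: pnt_single)
    have sm: "single k a (v a) \<in> E" if "v \<in> E" for v by (rule single_mem[OF EfibD[OF that a]])
    have gm: "g x v \<in> E" if "x \<in> cdom B i" "v \<in> E" for x v
      using bij_betwE[OF normalD(4)[OF g[OF that(1)]]] that(2) by blast
    have hU: "?h p \<in> prd (UU i) VT" if p: "p \<in> UU i" for p
    proof -
      obtain x v where xv: "p = pnt k (chart B i x) v" "x \<in> cdom B i" "v \<in> E" by (rule UUE[OF i p])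
      have "vert k (\<sigma> p) \<in> VT" by (rule vert_mem[OF smooth_mem[OF \<sigma> p]])
      moreover have "?h p = pair (pnt k (chart B i x) (g x (single k a (v a)))) (vert k (\<sigma> p))"
        using hv[OF xv(2,3)] xv(1) by simp
      ultimately show ?thesis using pnt_mem_UU[OF i xv(2) gm[OF xv(2) sm[OF xv(3)]]] by simp
    qed
    have "smooth sc (tmodel k) (tmodel k) (UU i) (\<lambda>p. ?R (?h p))"
      by (rule smooth_comp[OF S subspace_prd[OF S subspace_VT] h hU
            connection_rep_smooth[OF connection_linear[OF L] i]])
    moreover have "?R (?h (pnt k (chart B i x) v)) = pnt k (chart B i x) (g x (?r (insert a S) v))"
      if x: "x \<in> cdom B i" and v: "v \<in> E" for x v
    proof -
      have e: "Eadd k (single k a (v a)) (?r S v) = ?r (insert a S) v"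
        unfolding Eadd_def single_def using \<open>a \<notin> S\<close> by (intro restrict_ext) auto
      have "?R (?h (pnt k (chart B i x) v)) = chart T i (Tp i x (g x (Eadd k (single k a (v a)) (?r S v))))"
        unfolding hv[OF x v]
        using Q_cinv[OF i x gm[OF x sm[OF v]] gm[OF x r[OF v]]]
          conj_byD(1)[OF normalD(3)[OF g[OF x]] sm[OF v] r[OF v]] by simp
      also have "\<dots> = pnt k (chart B i x) (g x (Eadd k (single k a (v a)) (?r S v)))"
        by (rule fpt_chart[OF T_fibred i x gm[OF x Eadd_mem[OF sm[OF v] r[OF v]]]])
      finally show ?thesis unfolding e .
    qed
    ultimately show ?case by blast
  qed
  obtain \<sigma> where \<sigma>: "smooth sc (tmodel k) (tmodel k) (UU i) \<sigma>"
    and sv: "\<And>x v. x \<in> cdom B i \<Longrightarrow> v \<in> E \<Longrightarrow> \<sigma> (pnt k (chart B i x) v) = pnt k (chart B i x) (g x (?r pk v))"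
    using part[OF finite_pos order_refl] by blast
  show ?thesis
  proof (rule smooth_eq[OF \<sigma>])
    fix p assume "p \<in> UU i"
    then obtain x v where xv: "p = pnt k (chart B i x) v" "x \<in> cdom B i" "v \<in> E" by (rule UUE[OF i])
    have gm: "g x v \<in> E" using bij_betwE[OF normalD(4)[OF g[OF xv(2)]]] xv(3) by blast
    have "?r pk v = v" using xv(3) by (intro Efib_eqI[OF _ xv(3)]) (auto simp: PiE_mem)
    then have "\<sigma> p = pnt k (chart B i x) (g x v)" using sv[OF xv(2,3)] xv(1) by simp
    also have "\<dots> = chart T i (Tp i x (g x v))" by (rule fpt_chart[OF T_fibred i xv(2) gm, symmetric])
    also have "\<dots> = chart T i (\<Sigma>map L (Ap i x v))"
      using sum_map_normal[OF L i xv(2) g[OF xv(2)] xv(3)] by simp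
    finally show "\<sigma> p = chart T i (\<Sigma>map L (cinv A i p))" unfolding fpt_def xv(1) .
  qed
qed

lemma T_subspace: "P.subspace (model T)" and A_subspace: "P.subspace (model A)"
  using subspace_tmodel by (simp_all add: TD(3))

text \<open>\<open>\<Phi>\<^sup>L\<close> is fiberwise the normal conjugating map \<open>g\<close>. The chart representative of its inverse is the
  iteration that solves \<open>g(v) = w\<close>.\<close>

lemma sum_map_iso:
  assumes L: "L \<in> conns"
  shows "\<Sigma>map L \<in> isos"
proof -
  let ?\<Phi> = "\<Sigma>map L" let ?\<Psi> = "inv_into (pts A) ?\<Phi>"
  have "\<exists>g. bij_betw g E E \<and> (\<forall>v\<in>E. ?\<Phi> (Ap i x v) = Tp i x (g v))"
    if i: "i \<in> I" and x: "x \<in> cdom B i" for i x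
    using connection_normal[OF L i x] sum_map_normal[OF L i x] normalD(4) by blast
  note fb = fibrewise_bij[OF this]
  have bij: "bij_betw ?\<Phi> (pts A) (pts T)" by (rule fb(1))
  have fst: "\<pi> (?\<Phi> a) = fst a" "?\<Phi> a \<in> pts T" if "a \<in> pts A" for a
    using fb(2,3) that by blast+
  have inv: "?\<Psi> c \<in> pts A" "?\<Phi> (?\<Psi> c) = c" "fst (?\<Psi> c) = \<pi> c" if "c \<in> pts T" for c
  proof -
    show m: "?\<Psi> c \<in> pts A" using bij that by (metis bij_betw_imp_surj_on inv_into_into)
    show e: "?\<Phi> (?\<Psi> c) = c" by (rule bij_betw_inv_into_right[OF bij that])
    show "fst (?\<Psi> c) = \<pi> c" using fst(1)[OF m] e by simp
  qed
  have "smooth_map sc A T ?\<Phi>"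
  proof (rule smooth_map_between_manifoldsI[OF AD(1) A_subspace TD(1) T_subspace])
    show "ind T = ind A" by (simp add: TD(2))
    fix i assume "i \<in> ind A"
    then have i: "i \<in> I" by simp
    show "?\<Phi> p \<in> cdom T i \<longleftrightarrow> p \<in> cdom A i" if "p \<in> pts A" for p
      using fibred_mem_cdom_iff[OF T_fibred i fst(2)[OF that]] fibred_mem_cdom_iff[OF A_fibred i that]
        fst(1)[OF that] by simp
    show "smooth sc (model A) (model T) (chart A i ` cdom A i) (\<lambda>z. chart T i (?\<Phi> (cinv A i z)))"
      using sum_map_rep_smooth[OF L i] unfolding UU_image(2)[OF i] by (simp add: TD(3))
  qed
  moreover have "smooth_map sc T A ?\<Psi>"
  proof (rule smooth_map_between_manifoldsI[OF TD(1) T_subspace AD(1) A_subspace])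
    show "ind A = ind T" by (simp add: TD(2))
    fix i assume "i \<in> ind T"
    then have i: "i \<in> I" by (simp add: TD(2))
    show "?\<Psi> p \<in> cdom A i \<longleftrightarrow> p \<in> cdom T i" if "p \<in> pts T" for p
      using fibred_mem_cdom_iff[OF T_fibred i that] fibred_mem_cdom_iff[OF A_fibred i inv(1)[OF that]]
        inv(3)[OF that] by simp
    obtain g where g: "\<And>x. x \<in> cdom B i \<Longrightarrow> normal L i x (g x)"
      using connection_normal[OF L i] by metis
    have rep: "chart T i (?\<Phi> (cinv A i (pnt k (chart B i x) v))) = pnt k (chart B i x) (g x v)"
      if x: "x \<in> cdom B i" and v: "v \<in> E" for x v
    proof -
      have gm: "g x v \<in> E" using bij_betwE[OF normalD(4)[OF g[OF x]]] v by blast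
      have "chart T i (?\<Phi> (Ap i x v)) = pnt k (chart B i x) (g x v)"
        unfolding sum_map_normal[OF L i x g[OF x] v] by (rule fpt_chart[OF T_fibred i x gm])
      then show ?thesis unfolding fpt_def .
    qed
    have "\<exists>h. smooth sc (tmodel k) (tmodel k) (UU i) h \<and> (\<forall>x\<in>cdom B i. \<forall>w\<in>E.
        h (pnt k (chart B i x) w) = pnt k (chart B i x) ((newton (g x) w ^^ Suc k) w))"
    proof (rule newton_smooth[OF i sum_map_rep_smooth[OF L i]])
      show "unipotent (g x)" if "x \<in> cdom B i" for x by (rule normalD(2)[OF g[OF that]])
    qed (rule rep)
    then obtain h where h: "smooth sc (tmodel k) (tmodel k) (UU i) h"
      and hr: "\<And>x w. x \<in> cdom B i \<Longrightarrow> w \<in> E \<Longrightarrow>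
        h (pnt k (chart B i x) w) = pnt k (chart B i x) ((newton (g x) w ^^ Suc k) w)"
      by blast
    have "smooth sc (tmodel k) (tmodel k) (UU i) (\<lambda>z. chart A i (?\<Psi> (cinv T i z)))"
    proof (rule smooth_eq[OF h])
      fix p assume "p \<in> UU i"
      then obtain x w where xw: "p = pnt k (chart B i x) w" "x \<in> cdom B i" "w \<in> E" by (rule UUE[OF i])
      let ?u = "(newton (g x) w ^^ Suc k) w"
      note n = normalD[OF g[OF xw(2)]]
      have u: "?u \<in> E" by (rule newton_iterate_mem[OF n(2) xw(3)])
      have "?\<Phi> (Ap i x ?u) = Tp i x w"
        using sum_map_normal[OF L i xw(2) g[OF xw(2)] u] newton_solves[OF n(2) xw(3)] by simp
      then have "?\<Psi> (Tp i x w) = Ap i x ?u"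
        using bij_betw_inv_into_left[OF bij fpt_pts[OF A_fibred i xw(2) u]] by simp
      then have "chart A i (?\<Psi> (Tp i x w)) = pnt k (chart B i x) ?u"
        using fpt_chart[OF A_fibred i xw(2) u] by simp
      then show "h p = chart A i (?\<Psi> (cinv T i p))"
        unfolding xw(1) hr[OF xw(2,3)] fpt_def by (rule sym)
    qed
    then show "smooth sc (model T) (model A) (chart T i ` cdom T i) (\<lambda>z. chart A i (?\<Psi> (cinv T i z)))"
      unfolding UU_image(1)[OF i] by (simp add: TD(3))
  qed
  ultimately have diffeo: "diffeomorphism sc A T ?\<Phi>" unfolding diffeomorphism_def using bij by blast
  have "\<exists>f\<in>Mgrp. \<forall>v\<in>E. ?\<Phi> (AkF_pt sV sW k F i x v) = TkF_pt sV sW k F i x (f v)"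
    if i: "i \<in> I" and x: "x \<in> cdom B i" for i x
    unfolding AkF_pt_fpt TkF_pt_fpt
    using connection_normal[OF L i x] sum_map_normal[OF L i x] normalD(1) by blast
  moreover have "?\<Phi> \<in> extensional (pts A)" unfolding sum_map_def by simp
  ultimately have "?\<Phi> \<in> multilinear_isos sV sW k F"
    unfolding multilinear_isos_def using diffeo fst by blast
  moreover have "identity_on_axes sV sW k F ?\<Phi>"
    unfolding identity_on_axes_def
  proof (intro ballI)
    fix \<alpha> x u assume a: "\<alpha> \<in> pk" and x: "x \<in> pts B" and u: "u \<in> Falpha sV sW F \<alpha> x"
    obtain i where i: "i \<in> I" "x \<in> cdom B i" using base_cover[OF x] by blast
    obtain g where g: "normal L i x g" using connection_normal[OF L i] by blast
    note V = Fcoord_mem[OF i(1,1,2,2) u]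
    show "?\<Phi> (AkF_axis sV sW k F \<alpha> x u) = TkF_axis sV sW k F \<alpha> x u"
      unfolding AkF_axis_pt[OF i a u] TkF_axis_pt[OF i a u]
      using sum_map_normal[OF L i g single_mem[OF V]] normalD(5)[OF g a V] by simp
  qed
  ultimately show ?thesis by blast
qed

section \<open>From isomorphisms to connections\<close>

lemma isoD:
  assumes \<Phi>: "\<Phi> \<in> isos"
  shows "bij_betw \<Phi> (pts A) (pts T)" "smooth_map sc A T \<Phi>" "smooth_map sc T A (inv_into (pts A) \<Phi>)"
    "\<Phi> \<in> extensional (pts A)" "a \<in> pts A \<Longrightarrow> \<pi> (\<Phi> a) = fst a" "a \<in> pts A \<Longrightarrow> \<Phi> a \<in> pts T"
    "c \<in> pts T \<Longrightarrow> inv_into (pts A) \<Phi> c \<in> pts A"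
    "c \<in> pts T \<Longrightarrow> fst (inv_into (pts A) \<Phi> c) = \<pi> c"
proof -
  show b: "bij_betw \<Phi> (pts A) (pts T)" and "smooth_map sc A T \<Phi>"
    "smooth_map sc T A (inv_into (pts A) \<Phi>)" "\<Phi> \<in> extensional (pts A)"
    using \<Phi> unfolding multilinear_isos_def diffeomorphism_def by blast+
  have p: "\<pi> (\<Phi> a) = fst a" if "a \<in> pts A" for a
    using \<Phi> that unfolding multilinear_isos_def by blast
  show "a \<in> pts A \<Longrightarrow> \<pi> (\<Phi> a) = fst a" by (rule p)
  show "a \<in> pts A \<Longrightarrow> \<Phi> a \<in> pts T" using bij_betwE[OF b] by blast
  have m: "inv_into (pts A) \<Phi> c \<in> pts A" if "c \<in> pts T" for c
    using b that by (metis bij_betw_imp_surj_on inv_into_into)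
  then show "c \<in> pts T \<Longrightarrow> inv_into (pts A) \<Phi> c \<in> pts A" .
  show "fst (inv_into (pts A) \<Phi> c) = \<pi> c" if "c \<in> pts T"
    using p[OF m[OF that]] bij_betw_inv_into_right[OF b that] by simp
qed

text \<open>That \<open>\<Phi>\<close> is the identity on the axes means that its chart representatives are.\<close>

lemma iso_fiber:
  assumes \<Phi>: "\<Phi> \<in> isos" and i: "i \<in> I" and x: "x \<in> cdom B i"
  obtains f where "f \<in> Mgrp" "\<And>v. v \<in> E \<Longrightarrow> \<Phi> (Ap i x v) = Tp i x (f v)"
    "\<And>\<alpha> u. \<alpha> \<in> pk \<Longrightarrow> u \<in> Valpha \<alpha> \<Longrightarrow> f (single k \<alpha> u) = single k \<alpha> u"
    "\<And>v. v \<in> E \<Longrightarrow> inv_into (pts A) \<Phi> (Tp i x (f v)) = Ap i x v"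
proof -
  obtain f where f: "f \<in> Mgrp" "\<And>v. v \<in> E \<Longrightarrow> \<Phi> (Ap i x v) = Tp i x (f v)"
    using \<Phi> i x unfolding multilinear_isos_def AkF_pt_fpt TkF_pt_fpt by blast
  show ?thesis
  proof (rule that[OF f])
    show "f (single k \<alpha> u) = single k \<alpha> u" if a: "\<alpha> \<in> pk" and u: "u \<in> Valpha \<alpha>" for \<alpha> u
    proof -
      obtain y where y: "y \<in> Falpha sV sW F \<alpha> x" "Fcoord F i y = u" using Fcoord_surj[OF i x u] by blast
      have "\<Phi> (AkF_axis sV sW k F \<alpha> x y) = TkF_axis sV sW k F \<alpha> x y"
        using \<Phi> a y(1) x base_cdom_subset[OF i] unfolding identity_on_axes_def by blast
      then have "Tp i x (f (single k \<alpha> u)) = Tp i x (single k \<alpha> u)"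
        using f(2)[OF single_mem[OF u]] by (simp add: AkF_axis_pt[OF i x a y(1)] TkF_axis_pt[OF i x a y(1)] y(2))
      then show ?thesis
        by (rule fpt_inj[OF T_fibred i x Mgrp_mem[OF f(1) single_mem[OF u]] single_mem[OF u]])
    qed
    show "inv_into (pts A) \<Phi> (Tp i x (f v)) = Ap i x v" if v: "v \<in> E" for v
      using bij_betw_inv_into_left[OF isoD(1)[OF \<Phi>] fpt_pts[OF A_fibred i x v]] f(2)[OF v] by simp
  qed
qed

lemma push_simps:
  "fst (push \<Phi>) = (\<lambda>(a, b)\<in>pts Q. \<Phi> (L0_add sV sW k F (inv_into (pts A) \<Phi> a, inv_into (pts A) \<Phi> b)))"
  "snd (push \<Phi>) = (\<lambda>(t, a)\<in>UNIV \<times> pts T. \<Phi> (L0_scale sV sW k F (t, inv_into (pts A) \<Phi> a)))"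
  unfolding push_L0_def Let_def by simp_all

text \<open>\<open>L\<^sub>0\<close> is the structure of \<open>E\<close> in each chart, so its push-forward is the one transported by the chart
  representative of \<open>\<Phi>\<close>.\<close>

lemma push_conj:
  assumes i: "i \<in> I" and x: "x \<in> cdom B i" and f: "\<And>v. v \<in> E \<Longrightarrow> f v \<in> E"
    and \<Phi>: "\<And>v. v \<in> E \<Longrightarrow> \<Phi> (Ap i x v) = Tp i x (f v)"
    and \<Psi>: "\<And>v. v \<in> E \<Longrightarrow> inv_into (pts A) \<Phi> (Tp i x (f v)) = Ap i x v"
  shows "conj_by (push \<Phi>) i x f"
  unfolding conj_by_def
proof (intro ballI allI conjI)
  fix v w t assume v: "v \<in> E" and w: "w \<in> E"
  have "(Tp i x (f v), Tp i x (f w)) \<in> pts Q"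
    unfolding Q_simps using f[OF v] f[OF w] fpt_pts[OF T_fibred i x] fpt_proj[OF T_fibred i x] by simp
  then show "fst (push \<Phi>) (Tp i x (f v), Tp i x (f w)) = Tp i x (f (Eadd k v w))"
    unfolding push_simps using \<Psi>[OF v] \<Psi>[OF w] L0_add_pt[OF i x v w] \<Phi>[OF Eadd_mem[OF v w]] by simp
  show "snd (push \<Phi>) (t, Tp i x (f v)) = Tp i x (f (Escale (pscale sc) k t v))"
    unfolding push_simps
    using fpt_pts[OF T_fibred i x f[OF v]] \<Psi>[OF v] L0_scale_pt[OF i x v] \<Phi>[OF Escale_mem[OF v]] by simp
qed

lemma iso_conj:
  assumes \<Phi>: "\<Phi> \<in> isos" and i: "i \<in> I" and x: "x \<in> cdom B i"
  obtains f where "f \<in> Mgrp" "bij_betw f E E" "conj_by (push \<Phi>) i x f"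
    "\<And>v. v \<in> E \<Longrightarrow> \<Phi> (Ap i x v) = Tp i x (f v)"
    "\<And>\<alpha> u. \<alpha> \<in> pk \<Longrightarrow> u \<in> Valpha \<alpha> \<Longrightarrow> f (single k \<alpha> u) = single k \<alpha> u"
    "\<And>v. v \<in> E \<Longrightarrow> inv_into (pts A) \<Phi> (Tp i x (f v)) = Ap i x v"
proof -
  obtain f where f: "f \<in> Mgrp" "\<And>v. v \<in> E \<Longrightarrow> \<Phi> (Ap i x v) = Tp i x (f v)"
    "\<And>\<alpha> u. \<alpha> \<in> pk \<Longrightarrow> u \<in> Valpha \<alpha> \<Longrightarrow> f (single k \<alpha> u) = single k \<alpha> u"
    "\<And>v. v \<in> E \<Longrightarrow> inv_into (pts A) \<Phi> (Tp i x (f v)) = Ap i x v"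
    by (rule iso_fiber[OF assms]) blast
  show ?thesis
    by (rule that[OF f(1) Mgrp_bij[OF f(1)] push_conj[OF i x Mgrp_mem[OF f(1)] f(2,4)] f(2,3,4)])
qed

lemma push_module:
  assumes \<Phi>: "\<Phi> \<in> isos" and x: "x \<in> pts B"
  shows "Module.module scalar_ring (fiber_module sV sW k F (push \<Phi>) x)"
proof -
  obtain i where i: "i \<in> I" "x \<in> cdom B i" using base_cover[OF x] by blast
  obtain f where "bij_betw f E E" "conj_by (push \<Phi>) i x f" by (rule iso_conj[OF \<Phi> i]) blast
  then show ?thesis by (rule module_of_conj[OF i])
qed

lemma push_fst_point:
  assumes \<Phi>: "\<Phi> \<in> isos" and ab: "(a, b) \<in> pts Q"
  shows "fst (push \<Phi>) (a, b) \<in> pts T" "\<pi> (fst (push \<Phi>) (a, b)) = \<pi> a"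
proof -
  have ab': "a \<in> pts T" "b \<in> pts T" "\<pi> a = \<pi> b" using ab by (auto simp: Q_simps)
  obtain i where i: "i \<in> I" "\<pi> a \<in> cdom B i" using base_cover[OF TD(4)[OF ab'(1)]] by blast
  obtain f where f: "bij_betw f E E" "conj_by (push \<Phi>) i (\<pi> a) f" by (rule iso_conj[OF \<Phi> i]) blast
  have fib: "a \<in> TkF_fiber sV sW k F (\<pi> a)" "b \<in> TkF_fiber sV sW k F (\<pi> a)"
    using ab' by (auto simp: TkF_fiber_def)
  obtain v w where vw: "a = Tp i (\<pi> a) (f v)" "v \<in> E" "b = Tp i (\<pi> a) (f w)" "w \<in> E"
    using fib unfolding TkF_fiber_eq[OF i f(1)] by blast
  have m: "f (Eadd k v w) \<in> E" using bij_betwE[OF f(1)] Eadd_mem[OF vw(2,4)] by blast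
  have "fst (push \<Phi>) (a, b) = Tp i (\<pi> a) (f (Eadd k v w))"
    using conj_byD(1)[OF f(2) vw(2,4)] vw(1,3) by metis
  then show "fst (push \<Phi>) (a, b) \<in> pts T" "\<pi> (fst (push \<Phi>) (a, b)) = \<pi> a"
    using fpt_pts[OF T_fibred i m] fpt_proj[OF T_fibred i m] by simp_all
qed

lemma push_snd_point:
  assumes \<Phi>: "\<Phi> \<in> isos" and a: "a \<in> pts T"
  shows "snd (push \<Phi>) (t, a) \<in> pts T" "\<pi> (snd (push \<Phi>) (t, a)) = \<pi> a"
proof -
  obtain i where i: "i \<in> I" "\<pi> a \<in> cdom B i" using base_cover[OF TD(4)[OF a]] by blast
  obtain f where f: "bij_betw f E E" "conj_by (push \<Phi>) i (\<pi> a) f" by (rule iso_conj[OF \<Phi> i]) blast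
  have fib: "a \<in> TkF_fiber sV sW k F (\<pi> a)" using a by (auto simp: TkF_fiber_def)
  obtain v where v: "a = Tp i (\<pi> a) (f v)" "v \<in> E" using fib unfolding TkF_fiber_eq[OF i f(1)] by blast
  have m: "f (Escale (pscale sc) k t v) \<in> E" using bij_betwE[OF f(1)] Escale_mem[OF v(2)] by blast
  have "snd (push \<Phi>) (t, a) = Tp i (\<pi> a) (f (Escale (pscale sc) k t v))"
    using conj_byD(2)[OF f(2) v(2)] v(1) by metis
  then show "snd (push \<Phi>) (t, a) \<in> pts T" "\<pi> (snd (push \<Phi>) (t, a)) = \<pi> a"
    using fpt_pts[OF T_fibred i m] fpt_proj[OF T_fibred i m] by simp_all
qed

lemma iso_rep_smooth:
  assumes \<Phi>: "\<Phi> \<in> isos" and i: "i \<in> I"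
  shows "smooth sc (tmodel k) (tmodel k) (UU i) (\<lambda>z. chart T i (\<Phi> (cinv A i z)))"
    and "smooth sc (tmodel k) (tmodel k) (UU i) (\<lambda>z. chart A i (inv_into (pts A) \<Phi> (cinv T i z)))"
proof -
  note D = isoD[OF \<Phi>]
  have 1: "\<Phi> p \<in> cdom T i" if "p \<in> cdom A i" for p
    using that fibred_mem_cdom_iff[OF T_fibred i] AD(5)[OF i] D(5,6) by auto
  have 2: "inv_into (pts A) \<Phi> p \<in> cdom A i" if "p \<in> cdom T i" for p
    using that fibred_mem_cdom_iff[OF A_fibred i] TD(5)[OF i] D(7,8) by auto
  show "smooth sc (tmodel k) (tmodel k) (UU i) (\<lambda>z. chart T i (\<Phi> (cinv A i z)))"
    using smooth_map_rep[OF D(2) _ _ 1] i UU_image(2)[OF i] by (simp add: TD(2,3))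
  show "smooth sc (tmodel k) (tmodel k) (UU i) (\<lambda>z. chart A i (inv_into (pts A) \<Phi> (cinv T i z)))"
    using smooth_map_rep[OF D(3) _ _ 2] i UU_image(1)[OF i] by (simp add: TD(2,3))
qed

lemma UU_add:
  assumes "p \<in> UU i" "q \<in> VT" shows "p + q \<in> UU i"
  using assms P.subspace_add[OF subspace_tmodel, of p k q] unfolding UU_def VT_def by (simp add: cmp_add)

text \<open>With the chart representatives \<open>\<psi>\<close> of \<open>\<Phi>\<close> and \<open>\<theta>\<close> of its inverse, the addition of \<open>L\<^sup>\<Phi>\<close> is
  \<open>(p, q) \<mapsto> \<psi>(\<theta>(p) + vert(\<theta>(q)))\<close> and the scalar multiplication is
  \<open>(t, p) \<mapsto> \<psi>(x + t vert(\<theta>(p)))\<close>, where \<open>x\<close> is the base coordinate of \<open>p\<close>.\<close>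

lemma push_smooth:
  assumes \<Phi>: "\<Phi> \<in> isos"
  shows "smooth_map sc Q T (fst (push \<Phi>))" and "smooth_map sc ST T (snd (push \<Phi>))"
proof -
  let ?\<Psi> = "inv_into (pts A) \<Phi>"
  note S = subspace_tmodel[of k]
  define \<psi> \<theta> where "\<psi> = (\<lambda>i z. chart T i (\<Phi> (cinv A i z)))" and "\<theta> = (\<lambda>i z. chart A i (?\<Psi> (cinv T i z)))"
  have \<psi>: "smooth sc (tmodel k) (tmodel k) (UU i) (\<psi> i)" and \<theta>: "smooth sc (tmodel k) (tmodel k) (UU i) (\<theta> i)"
    if "i \<in> I" for i
    using iso_rep_smooth[OF \<Phi> that] unfolding \<psi>_def \<theta>_def by auto
  have \<psi>v: "\<psi> i (pnt k (chart B i x) v) = chart T i (\<Phi> (Ap i x v))" for i x v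
    unfolding \<psi>_def fpt_def ..
  have \<theta>v: "\<theta> i (pnt k (chart B i x) (f v)) = pnt k (chart B i x) v"
    if "i \<in> I" "x \<in> cdom B i" "\<And>v. v \<in> E \<Longrightarrow> ?\<Psi> (Tp i x (f v)) = Ap i x v" "v \<in> E" for i x f v
    using that(3)[OF that(4)] fpt_chart[OF A_fibred that(1,2,4)] by (simp add: \<theta>_def fpt_def)
  have \<theta>U: "\<theta> i p \<in> UU i \<and> cmp k 0 (\<theta> i p) = cmp k 0 p" if i: "i \<in> I" and p: "p \<in> UU i" for i p
  proof -
    obtain x w where xw: "p = pnt k (chart B i x) w" "x \<in> cdom B i" "w \<in> E" by (rule UUE[OF i p])
    obtain f where f: "bij_betw f E E" "\<And>v. v \<in> E \<Longrightarrow> ?\<Psi> (Tp i x (f v)) = Ap i x v"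
      by (rule iso_conj[OF \<Phi> i xw(2)]) blast
    obtain v where v: "v \<in> E" "w = f v" by (rule E_surj[OF f(1) xw(3)])
    show ?thesis
      using \<theta>v[OF i xw(2) f(2) v(1)] xw v pnt_mem_UU[OF i xw(2) v(1)]
        cmp_chart_pnt(1)[OF i xw(2) v(1)] cmp_chart_pnt(1)[OF i xw(2,3)] by simp
  qed
  show "smooth_map sc Q T (fst (push \<Phi>))"
  proof (rule smooth_map_from_Q)
    fix i assume i: "i \<in> I"
    show "fst (push \<Phi>) p \<in> cdom T i \<longleftrightarrow> p \<in> cdom Q i" if p: "p \<in> pts Q" for p
    proof -
      obtain a b where ab: "p = (a, b)" by (cases p)
      have q: "a \<in> pts T" "b \<in> pts T" "\<pi> a = \<pi> b" using p ab by (auto simp: Q_simps)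
      show ?thesis
        using push_fst_point[OF \<Phi> p[unfolded ab]] q ab fibred_mem_cdom_iff[OF T_fibred i]
        by (simp add: Q_simps)
    qed
    let ?D = "prd (tmodel k) VT" and ?U = "prd (UU i) VT"
    have SD: "P.subspace ?D" by (intro subspace_prd S subspace_VT)
    have OU: "openin (top_of_set ?D) ?U" by (intro openin_prd openin_UU i openin_subtopology_self)
    \<comment> \<open>A point of the fiber product is given by a point and a vertical vector; \<open>?q\<close> is the second point.\<close>
    let ?q = "\<lambda>z. eps k 0 (cmp k 0 (lpt z)) + rpt z"
    have lq: "lin_on ?D (tmodel k) ?q"
      by (intro lin_on_plus[OF S] lin_on_comp[OF lin_on_lpt lin_on_base]
          lin_on_comp[OF lin_on_rpt lin_on_id]) (auto simp: VT_def)
    have qU: "?q z \<in> UU i" if "z \<in> ?U" for z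
      using that lin_onD(1)[OF lq, of z] cmp_0_eps_0[of "lpt z"]
      by (auto simp: UU_def VT_def mem_prd_iff cmp_add)
    have pU: "lpt z \<in> UU i" if "z \<in> ?U" for z using that by (simp add: mem_prd_iff)
    have s1: "smooth sc ?D (tmodel k) ?U (\<lambda>z. \<theta> i (lpt z))"
      by (rule smooth_comp_lin[OF SD S OU lin_on_lpt pU \<theta>[OF i]])
    have s2: "smooth sc ?D (tmodel k) ?U (\<lambda>z. \<theta> i (?q z))"
      by (rule smooth_comp_lin[OF SD S OU lq qU \<theta>[OF i]])
    have s3: "smooth sc ?D (tmodel k) ?U (\<lambda>z. vert k (\<theta> i (?q z)))"
      by (rule smooth_comp[OF SD S s2 smooth_mem[OF s2] smooth_lin[OF S _ lin_on_comp[OF lin_on_vert lin_on_id]]])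
        (auto simp: VT_def)
    have s4: "smooth sc ?D (tmodel k) ?U (\<lambda>z. \<theta> i (lpt z) + vert k (\<theta> i (?q z)))"
      by (rule smooth_add[OF SD S s1 s3])
    have U4: "\<theta> i (lpt z) + vert k (\<theta> i (?q z)) \<in> UU i" if z: "z \<in> ?U" for z
      using \<theta>U[OF i pU[OF z]] by (intro UU_add vert_mem smooth_mem[OF s2 z]) blast
    have s5: "smooth sc ?D (tmodel k) ?U (\<lambda>z. \<psi> i (\<theta> i (lpt z) + vert k (\<theta> i (?q z))))"
      by (rule smooth_comp[OF SD S s4 U4 \<psi>[OF i]])
    show "smooth sc ?D (tmodel k) ?U (\<lambda>z. chart T i (fst (push \<Phi>) (cinv Q i z)))"
    proof (rule smooth_eq[OF s5])
      fix z assume z: "z \<in> ?U"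
      obtain x v' where x: "lpt z = pnt k (chart B i x) v'" "x \<in> cdom B i" "v' \<in> E"
        by (rule UUE[OF i pU[OF z]])
      have cx: "cmp k 0 (lpt z) = chart B i x" using cmp_chart_pnt(1)[OF i x(2,3)] x(1) by simp
      obtain y w' where y: "?q z = pnt k (chart B i y) w'" "y \<in> cdom B i" "w' \<in> E"
        by (rule UUE[OF i qU[OF z]])
      have rz: "rpt z \<in> VT" using z by (simp add: mem_prd_iff)
      have "chart B i y = chart B i x"
        using cmp_chart_pnt(1)[OF i y(2,3)] y(1)[symmetric] cmp_0_eps_0[of "lpt z"] rz cx
        by (simp add: cmp_add VT_def)
      then have yx: "y = x" using inj_onD[OF manifold_inj[OF base_manifold i]] x(2) y(2) by blast
      have vq: "vert k (?q z) = rpt z"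
        using rz cmp_0_eps_0[of "lpt z"] by (simp add: vert_cmp cmp_add VT_def)
      have "z [] = 0" using z by (simp add: mem_prd_iff)
      then have zz: "z = pair (pnt k (chart B i x) v') (vert k (pnt k (chart B i x) w'))"
        using vq x(1) y(1) yx pair_lpt_rpt[of z] by simp
      obtain f where f: "f \<in> Mgrp" "bij_betw f E E" "conj_by (push \<Phi>) i x f"
        "\<And>v. v \<in> E \<Longrightarrow> \<Phi> (Ap i x v) = Tp i x (f v)"
        "\<And>v. v \<in> E \<Longrightarrow> ?\<Psi> (Tp i x (f v)) = Ap i x v"
        by (rule iso_conj[OF \<Phi> i x(2)]) blast
      obtain v where v: "v \<in> E" "v' = f v" by (rule E_surj[OF f(2) x(3)])
      obtain w where w: "w \<in> E" "w' = f w" by (rule E_surj[OF f(2) y(3)])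
      have "\<psi> i (\<theta> i (lpt z) + vert k (\<theta> i (?q z))) = \<psi> i (pnt k (chart B i x) (Eadd k v w))"
        using \<theta>v[OF i x(2) f(5) v(1)] \<theta>v[OF i x(2) f(5) w(1)] x(1) y(1) yx v(2) w(2)
          pnt_Eadd[OF i x(2) v(1) w(1)] by simp
      also have "\<dots> = chart T i (Tp i x (f (Eadd k v w)))"
        unfolding \<psi>v f(4)[OF Eadd_mem[OF v(1) w(1)]] ..
      also have "\<dots> = chart T i (fst (push \<Phi>) (Tp i x (f v), Tp i x (f w)))"
        using conj_byD(1)[OF f(3) v(1) w(1)] by simp
      also have "(Tp i x (f v), Tp i x (f w)) = cinv Q i z"
        unfolding zz using Q_cinv[OF i x(2,3) y(3)] v(2) w(2) by simp
      finally show "\<psi> i (\<theta> i (lpt z) + vert k (\<theta> i (?q z))) = chart T i (fst (push \<Phi>) (cinv Q i z))" .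
    qed
  qed
  show "smooth_map sc ST T (snd (push \<Phi>))"
  proof (rule smooth_map_from_ST)
    fix i assume i: "i \<in> I"
    show "snd (push \<Phi>) p \<in> cdom T i \<longleftrightarrow> p \<in> cdom ST i" if p: "p \<in> pts ST" for p
    proof -
      obtain t a where ta: "p = (t, a)" by (cases p)
      have q: "a \<in> pts T" using p ta by (auto simp: ST_simps)
      show ?thesis
        using push_snd_point[OF \<Phi> q, of t] q ta fibred_mem_cdom_iff[OF T_fibred i]
        by (simp add: ST_simps)
    qed
    let ?D = "prd (range spt) (tmodel k)" and ?U = "prd (range spt) (UU i)"
    have SD: "P.subspace ?D" by (intro subspace_prd S subspace_spt)
    have OU: "openin (top_of_set ?D) ?U" by (intro openin_prd openin_UU i openin_subtopology_self)
    have rU: "rpt z \<in> UU i" if "z \<in> ?U" for z using that by (simp add: mem_prd_iff)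
    have lz: "spt (sval (lpt z)) = lpt z" if "z \<in> ?U" for z
      using that by (auto simp: mem_prd_iff)
    have s1: "smooth sc ?D (tmodel k) ?U (\<lambda>z. \<theta> i (rpt z))"
      by (rule smooth_comp_lin[OF SD S OU lin_on_rpt rU \<theta>[OF i]])
    have s2: "smooth sc ?D VT ?U (\<lambda>z. vert k (\<theta> i (rpt z)))"
      by (rule smooth_comp[OF SD S s1 smooth_mem[OF s1] smooth_lin[OF S _ lin_on_vert]]) auto
    have s3: "smooth sc ?D (prd (range spt) VT) ?U (\<lambda>z. pair (lpt z) (vert k (\<theta> i (rpt z))))"
      by (rule smooth_pair[OF SD smooth_lin[OF SD OU lin_on_lpt] s2])
    have SV: "P.subspace (prd (range spt) VT)" by (intro subspace_prd subspace_spt subspace_VT)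
    have s4: "smooth sc ?D VT ?U (\<lambda>z. sval (lpt z) *\<^sub>p vert k (\<theta> i (rpt z)))"
      using smooth_comp[OF SD SV s3 smooth_mem[OF s3] smooth_scale[OF subspace_VT]] by simp
    have s5: "smooth sc ?D (tmodel k) ?U (\<lambda>z. sval (lpt z) *\<^sub>p vert k (\<theta> i (rpt z)))"
      by (rule smooth_comp[OF SD subspace_VT s4 smooth_mem[OF s4] smooth_lin[OF subspace_VT _ lin_on_id]])
        (auto simp: VT_def)
    let ?e = "\<lambda>z. eps k 0 (cmp k 0 (rpt z)) + sval (lpt z) *\<^sub>p vert k (\<theta> i (rpt z))"
    have s6: "smooth sc ?D (tmodel k) ?U ?e"
      by (rule smooth_add[OF SD S smooth_lin[OF SD OU lin_on_comp[OF lin_on_rpt lin_on_base]] s5])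
    have U6: "?e z \<in> UU i" if z: "z \<in> ?U" for z
      using smooth_mem[OF s4 z] smooth_mem[OF s6 z] rU[OF z] cmp_0_eps_0[of "rpt z"]
      by (auto simp: UU_def VT_def cmp_add)
    have s7: "smooth sc ?D (tmodel k) ?U (\<lambda>z. \<psi> i (?e z))"
      by (rule smooth_comp[OF SD S s6 U6 \<psi>[OF i]])
    show "smooth sc ?D (tmodel k) ?U (\<lambda>z. chart T i (snd (push \<Phi>) (cinv ST i z)))"
    proof (rule smooth_eq[OF s7])
      fix z assume z: "z \<in> ?U"
      obtain x v' where x: "rpt z = pnt k (chart B i x) v'" "x \<in> cdom B i" "v' \<in> E"
        by (rule UUE[OF i rU[OF z]])
      have cx: "cmp k 0 (rpt z) = chart B i x" using cmp_chart_pnt(1)[OF i x(2,3)] x(1) by simp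
      have "z [] = 0" using z by (simp add: mem_prd_iff)
      then have zz: "z = pair (spt (sval (lpt z))) (pnt k (chart B i x) v')"
        using x(1) lz[OF z] pair_lpt_rpt[of z] by simp
      obtain f where f: "f \<in> Mgrp" "bij_betw f E E" "conj_by (push \<Phi>) i x f"
        "\<And>v. v \<in> E \<Longrightarrow> \<Phi> (Ap i x v) = Tp i x (f v)"
        "\<And>v. v \<in> E \<Longrightarrow> ?\<Psi> (Tp i x (f v)) = Ap i x v"
        by (rule iso_conj[OF \<Phi> i x(2)]) blast
      obtain v where v: "v \<in> E" "v' = f v" by (rule E_surj[OF f(2) x(3)])
      let ?t = "sval (lpt z)"
      have "\<psi> i (?e z) = \<psi> i (pnt k (chart B i x) (Escale (pscale sc) k ?t v))"
        using \<theta>v[OF i x(2) f(5) v(1)] x(1) v(2) cx pnt_Escale[OF i x(2) v(1), of ?t] by simp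
      also have "\<dots> = chart T i (Tp i x (f (Escale (pscale sc) k ?t v)))"
        unfolding \<psi>v f(4)[OF Escale_mem[OF v(1)]] ..
      also have "\<dots> = chart T i (snd (push \<Phi>) (?t, Tp i x (f v)))"
        using conj_byD(2)[OF f(3) v(1)] by simp
      also have "(?t, Tp i x (f v)) = cinv ST i z"
        using ST_cinv[OF i x(2,3), of ?t] v(2) zz by simp
      finally show "\<psi> i (?e z) = chart T i (snd (push \<Phi>) (cinv ST i z))" .
    qed
  qed
qed

lemma push_connection:
  assumes \<Phi>: "\<Phi> \<in> isos"
  shows "push \<Phi> \<in> conns"
proof -
  have "linear_structure sV sW k F (push \<Phi>)"
    unfolding linear_structure_def Let_def
  proof (intro conjI ballI allI)
    show "fst (push \<Phi>) \<in> extensional (pts Q)" "snd (push \<Phi>) \<in> extensional (UNIV \<times> pts T)"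
      unfolding push_simps by simp_all
    show "smooth_map sc Q T (fst (push \<Phi>))" "smooth_map sc ST T (snd (push \<Phi>))"
      by (rule push_smooth[OF \<Phi>])+
    show "case p of (a, b) \<Rightarrow> \<pi> (fst (push \<Phi>) (a, b)) = \<pi> a" if "p \<in> pts Q" for p
      using that push_fst_point(2)[OF \<Phi>] by (cases p) auto
    show "\<pi> (snd (push \<Phi>) (t, a)) = \<pi> a" if "a \<in> pts T" for t a
      by (rule push_snd_point(2)[OF \<Phi> that])
    show "Module.module scalar_ring (fiber_module sV sW k F (push \<Phi>) x)" if "x \<in> pts B" for x
      by (rule push_module[OF \<Phi> that])
  qed
  moreover have "\<exists>f\<in>Mgrp. conj_by (push \<Phi>) i x f" if "i \<in> I" "x \<in> cdom B i" for i x
    by (rule iso_conj[OF \<Phi> that]) blast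
  ultimately show ?thesis
    unfolding multilinear_connections_def TkF_pt_fpt conj_by_def by blast
qed

section \<open>The two constructions are inverse to each other\<close>

text \<open>The chart representatives of \<open>\<Phi>\<close> are the identity on the axes and transport the structure of \<open>L\<^sup>\<Phi>\<close>,
  so the sum of the axis elements is computed by them.\<close>

lemma sum_map_push:
  assumes \<Phi>: "\<Phi> \<in> isos"
  shows "\<Sigma>map (push \<Phi>) = \<Phi>"
proof (rule extensionalityI)
  show "\<Sigma>map (push \<Phi>) \<in> extensional (pts A)" unfolding sum_map_def by simp
  show "\<Phi> \<in> extensional (pts A)" by (rule isoD(4)[OF \<Phi>])
  fix a assume "a \<in> pts A"
  then obtain i v where iv: "i \<in> I" "fst a \<in> cdom B i" "v \<in> E" "a = Ap i (fst a) v" by (rule A_ptsE)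
  obtain f where f: "bij_betw f E E" "conj_by (push \<Phi>) i (fst a) f"
    "\<And>v. v \<in> E \<Longrightarrow> \<Phi> (Ap i (fst a) v) = Tp i (fst a) (f v)"
    "\<And>\<alpha> u. \<alpha> \<in> pk \<Longrightarrow> u \<in> Valpha \<alpha> \<Longrightarrow> f (single k \<alpha> u) = single k \<alpha> u"
    by (rule iso_conj[OF \<Phi> iv(1,2)]) blast
  have "\<Sigma>map (push \<Phi>) (Ap i (fst a) v) = Tp i (fst a) (f v)"
    by (rule sum_map_pt[OF connection_module[OF push_connection[OF \<Phi>] iv(1,2)] iv(1,2) f(1,2,4) iv(3)])
  then show "\<Sigma>map (push \<Phi>) a = \<Phi> a" using f(3)[OF iv(3)] iv(4) by metis
qed

text \<open>\<open>L\<close> and the push-forward of \<open>L\<^sub>0\<close> by \<open>\<Phi>\<^sup>L\<close> are both transported by the normal conjugating map of \<open>L\<close>,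
  and that map is bijective.\<close>

lemma push_sum_map:
  assumes L: "L \<in> conns"
  shows "push (\<Sigma>map L) = L"
proof -
  let ?\<Phi> = "\<Sigma>map L"
  note \<Phi> = sum_map_iso[OF L] and LL = linear_structureD[OF connection_linear[OF L]]
  have c: "\<exists>g. bij_betw g E E \<and> conj_by L i x g \<and> conj_by (push ?\<Phi>) i x g"
    if i: "i \<in> I" and x: "x \<in> cdom B i" for i x
  proof -
    obtain g where g: "normal L i x g" using connection_normal[OF L i x] by blast
    note n = normalD[OF g] and s = sum_map_normal[OF L i x g]
    have "inv_into (pts A) ?\<Phi> (Tp i x (g v)) = Ap i x v" if v: "v \<in> E" for v
      using bij_betw_inv_into_left[OF isoD(1)[OF \<Phi>] fpt_pts[OF A_fibred i x v]] s[OF v] by simp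
    then have "conj_by (push ?\<Phi>) i x g"
      using Mgrp_mem[OF n(1)] s by (intro push_conj[OF i x]) auto
    then show ?thesis using n(3,4) by blast
  qed
  show ?thesis
  proof (rule prod_eqI)
    show "fst (push ?\<Phi>) = fst L"
    proof (rule extensionalityI[OF _ LL(1)])
      show "fst (push ?\<Phi>) \<in> extensional (pts Q)" unfolding push_simps by simp
      fix p assume p: "p \<in> pts Q"
      obtain a b where ab: "p = (a, b)" by (cases p)
      have q: "a \<in> pts T" "b \<in> pts T" "\<pi> b = \<pi> a" using p ab by (auto simp: Q_simps)
      obtain i where i: "i \<in> I" "\<pi> a \<in> cdom B i" using base_cover[OF TD(4)[OF q(1)]] by blast
      obtain g where g: "bij_betw g E E" "conj_by L i (\<pi> a) g" "conj_by (push ?\<Phi>) i (\<pi> a) g"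
        using c[OF i] by blast
      have fib: "a \<in> TkF_fiber sV sW k F (\<pi> a)" "b \<in> TkF_fiber sV sW k F (\<pi> a)"
        using q by (auto simp: TkF_fiber_def)
      obtain v w where vw: "a = Tp i (\<pi> a) (g v)" "v \<in> E" "b = Tp i (\<pi> a) (g w)" "w \<in> E"
        using fib unfolding TkF_fiber_eq[OF i g(1)] by blast
      show "fst (push ?\<Phi>) p = fst L p"
        unfolding ab using conj_byD(1)[OF g(2) vw(2,4)] conj_byD(1)[OF g(3) vw(2,4)] vw(1,3) by metis
    qed
    show "snd (push ?\<Phi>) = snd L"
    proof (rule extensionalityI[OF _ LL(2)])
      show "snd (push ?\<Phi>) \<in> extensional (UNIV \<times> pts T)" unfolding push_simps by simp
      fix p assume p: "p \<in> (UNIV :: 'k set) \<times> pts T"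
      obtain t a where ta: "p = (t, a)" by (cases p)
      have q: "a \<in> pts T" using p ta by auto
      obtain i where i: "i \<in> I" "\<pi> a \<in> cdom B i" using base_cover[OF TD(4)[OF q]] by blast
      obtain g where g: "bij_betw g E E" "conj_by L i (\<pi> a) g" "conj_by (push ?\<Phi>) i (\<pi> a) g"
        using c[OF i] by blast
      have fib: "a \<in> TkF_fiber sV sW k F (\<pi> a)" using q by (auto simp: TkF_fiber_def)
      obtain v where v: "a = Tp i (\<pi> a) (g v)" "v \<in> E" using fib unfolding TkF_fiber_eq[OF i g(1)] by blast
      show "snd (push ?\<Phi>) p = snd L p"
        unfolding ta using conj_byD(2)[OF g(2) v(2), of t] conj_byD(2)[OF g(3) v(2), of t] v(1) by metis
    qed
  qed
qed

end

theorem theorem16p2: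
  fixes sV :: "'k::topological_base_ring \<Rightarrow> 'v::{topological_ab_group_add,t2_space} \<Rightarrow> 'v"
    and sW :: "'k \<Rightarrow> 'w::{topological_ab_group_add,t2_space} \<Rightarrow> 'w"
    and F :: "('m, 'f, 'i, 'v, 'w, 'k) vbundle"
    and k :: nat
  assumes "topological_module sV" and "topological_module sW"
    and "vector_bundle sV sW F"
    and "k \<ge> 1"
  defines "connections \<equiv> multilinear_connections sV sW k F"
    and "isos \<equiv> {\<Phi> \<in> multilinear_isos sV sW k F. identity_on_axes sV sW k F \<Phi>}"
  shows "bij_betw (push_L0 sV sW k F) isos connections
    \<and> bij_betw (sum_map sV sW k F) connections isos
    \<and> (\<forall>\<Phi>\<in>isos. sum_map sV sW k F (push_L0 sV sW k F \<Phi>) = \<Phi>)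
    \<and> (\<forall>L\<in>connections. push_L0 sV sW k F (sum_map sV sW k F L) = L)"
proof -
  interpret vbundle_power sV sW F k
    by unfold_locales (rule assms)+
  have 1: "\<forall>\<Phi>\<in>isos. sum_map sV sW k F (push_L0 sV sW k F \<Phi>) = \<Phi>"
    unfolding isos_def using sum_map_push by blast
  have 2: "\<forall>L\<in>connections. push_L0 sV sW k F (sum_map sV sW k F L) = L"
    unfolding connections_def using push_sum_map by blast
  have 3: "push_L0 sV sW k F ` isos \<subseteq> connections"
    unfolding isos_def connections_def using push_connection by blast
  have 4: "sum_map sV sW k F ` connections \<subseteq> isos"
    unfolding isos_def connections_def using sum_map_iso by blast
  show ?thesis
    using bij_betw_byWitness[OF 1 2 3 4] bij_betw_byWitness[OF 2 1 4 3] 1 2 by blast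
qed

end
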